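(* Let $P(M,G)$ be a principal fiber bundle with projection $\pi:P\to M$, and let $\omega$ be a connection form on $P(M,G)$. Let $\nabla^{P}$ be a projectable connection on $P(M,G)$ with projection $\nabla^{M}$, and let $A$ and $T$ be the fundamental tensors determined by $\omega$ and $\nabla^P$, with symmetric parts $A^S$ and $T^S$. Let $N$ be a Riemannian manifold with metric $g$ and let $F:N\to P$ be a smooth map. Then $F$ is a harmonic map (with respect to $g$ and $\nabla^P$) if and only if $$d^{*}F^{*} \omega = \mathrm{tr}\,F^{*}(\nabla^{P}\omega)$$ and $$\tau_{\pi \circ F} = -\mathrm{tr}\; \pi_* \circ (2A^S+T^S) \circ (F_* \otimes F_* ).$$
   Context: Conventions. Manifolds are smooth; a "connection" on a manifold means a torsion-free covariant derivative on its tangent bundle. $G$ acts on $P$ on the right by $R_g(p)=pg$; $\mathfrak g$ is the Lie algebra of $G$; for $B\in\mathfrak g$, $B^*$ is the fundamental (vertical) vector field on $P$ induced by the right action. Connection form: a $\mathfrak g$-valued 1-form $\omega$ on $P$ with $\omega(B^* )=B$ for all $B\in\mathfrak g$ and $R_g^*\omega=ad_{g^{-1}}\omega$ for all $g\in G$, where $ad_g$ is the adjoint action of $G$ on $\mathfrak g$. It gives the splitting $TP=HP\oplus VP$, $VP=\ker\pi_*$, $HP=\ker\omega$, with projections $\mathbf h$ (horizontal) and $\mathbf v$ (vertical). For a vector field $X$ on $M$, $X^h$ is its horizontal lift: $\pi_*X^h=X$, $\omega(X^h)=0$. Projectable connection: a connection $\nabla^P$ on $P$ is $G$-invariant if every $R_g$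 is affine for $\nabla^P$. A $G$-invariant connection $\nabla^P$ is projectable (with respect to $\omega$) if $\mathbf h\nabla^P_{X^h}Y^h$ is a projectable vector field (i.e. $\pi$-related to a vector field on $M$) for all vector fields $X,Y$ on $M$; its projection is the unique connection $\nabla^M$ on $M$ with $\mathbf h\nabla^P_{X^h}Y^h=(\nabla^M_XY)^h$ for all $X,Y$. Fundamental tensors: for vector fields $U,V$ on $P$, $$T_UV=\mathbf h\nabla^P_{\mathbf vU}\mathbf vV+\mathbf v\nabla^P_{\mathbf vU}\mathbf hV,\qquad A_UV=\mathbf v\nabla^P_{\mathbf hU}\mathbf hV+\mathbf h\nabla^P_{\mathbf hU}\mathbf vV.$$ $A^S(U,V)=\frac12(A_UV+A_VU)$ and $T^S(U,V)=\frac12(T_UV+T_VU)$. Also $(\nabla^P\omega)(U,V)=U(\omega(V))-\omega(\nabla^P_UV)$. Harmonic maps. Let $\nabla^g$ be the Levi-Civita connection of $g$. For a smooth map $F$ from $N$ to a manifold with connection $\nabla'$, the second fundamental form is $\beta_F(X,Y)=\nabla'_{X}(F_*Y)-F_*(\nabla^g_XY)$ (with the pulled-back connection on $F^*T$ in the first term), the tension field is $\tau_F=\mathrm{tr}_g\,\beta_F$, and $F$ is harmonic if $\tau_F=0$. For $F:N\to P$ one uses $\nabla'=\nabla^P$; $\tau_{\pi\circ F}$ is computed with $\nabla^M$ on $M$. All traces are with respect to $g$; thus the trace in the second condition is $\sum_i\pi_*(2A^S(F_*e_i,F_*e_i)+T^S(F_*e_i,F_*e_i))$ for a local $g$-orthonormal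 frame $(e_i)$. Sign convention: for a 1-form $\theta$ on $N$, $d^*\theta=\mathrm{tr}_g\nabla^g\theta=\sum_i(\nabla^g_{e_i}\theta)(e_i)$ (no minus sign), applied componentwise to $\mathfrak g$-valued forms. *)

theory Defs
  imports "HOL-Analysis.Analysis" "HOL-Library.Function_Algebras"
begin

section \<open>Preliminaries\<close>

text \<open>Model spaces of manifolds. Contrary to class \<^class>\<open>euclidean_space\<close>, dimension 0 is allowed,
  so that e.g. discrete structure groups are covered.\<close>

class fin_dim = real_inner +
  assumes finite_spanning_set: "\<exists>B. finite B \<and> (\<forall>x. \<exists>r. x = (\<Sum>b\<in>B. r b *\<^sub>R b))"

instance euclidean_space \<subseteq> fin_dim
proof
  show "\<exists>B::'a set. finite B \<and> (\<forall>x. \<exists>r. x = (\<Sum>b\<in>B. r b *\<^sub>R b))"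
    by (metis euclidean_representation finite_Basis)
qed

instantiation "fun" :: (type, scaleR) scaleR
begin
definition scaleR_fun_def: "r *\<^sub>R f = (\<lambda>x. r *\<^sub>R f x)"
instance ..
end

instance "fun" :: (type, real_vector) real_vector
  by standard (auto simp: scaleR_fun_def fun_eq_iff scaleR_add_right scaleR_add_left)

definition linear_between :: "'v::real_vector set \<Rightarrow> 'w::real_vector set \<Rightarrow> ('v \<Rightarrow> 'w) \<Rightarrow> bool" where
  "linear_between V W f \<longleftrightarrow>
     (\<forall>u\<in>V. f u \<in> W) \<and>
     (\<forall>u\<in>V. \<forall>v\<in>V. f (u + v) = f u + f v) \<and>
     (\<forall>r. \<forall>u\<in>V. f (r *\<^sub>R u) = r *\<^sub>R f u)"

text \<open>\<open>C\<^sup>k\<close> and smooth functions, for open subsets \<open>S\<close> of finite-dimensional spaces.\<close>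

primrec Ck_on :: "nat \<Rightarrow> 'a::real_normed_vector set \<Rightarrow> ('a \<Rightarrow> 'b::real_normed_vector) \<Rightarrow> bool" where
  "Ck_on 0 S f \<longleftrightarrow> continuous_on S f"
| "Ck_on (Suc k) S f \<longleftrightarrow>
     (\<forall>x\<in>S. f differentiable (at x)) \<and>
     (\<forall>v. Ck_on k S (\<lambda>x. frechet_derivative f (at x) v))"

definition smooth_on :: "'a::real_normed_vector set \<Rightarrow> ('a \<Rightarrow> 'b::real_normed_vector) \<Rightarrow> bool" where
  "smooth_on S f \<longleftrightarrow> (\<forall>k. Ck_on k S f)"


section \<open>Manifolds and tangent vectors\<close>

text \<open>The points of a manifold are all elements of a topological type; the smooth structure is
  given by a (not necessarily maximal) atlas. A chart is a pair of its domain and its map;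
  values of the map outside the domain are irrelevant.\<close>

type_synonym ('a, 'e) chart = "'a set \<times> ('a \<Rightarrow> 'e)"

definition chart_inv :: "('a, 'e) chart \<Rightarrow> 'e \<Rightarrow> 'a" where
  "chart_inv c = inv_into (fst c) (snd c)"

definition smooth_manifold ::
  "('a::{t2_space, second_countable_topology}, 'e::fin_dim) chart set \<Rightarrow> bool" where
  "smooth_manifold A \<longleftrightarrow>
     (\<forall>c\<in>A. open (fst c) \<and> open (snd c ` fst c) \<and>
        homeomorphism (fst c) (snd c ` fst c) (snd c) (chart_inv c)) \<and>
     (\<Union>c\<in>A. fst c) = UNIV \<and>
     (\<forall>c\<in>A. \<forall>d\<in>A. smooth_on (snd c ` (fst c \<inter> fst d)) (snd d \<circ> chart_inv c))"

definition prod_atlas :: "('a, 'e) chart set \<Rightarrow> ('b, 'f) chart set \<Rightarrow> ('a \<times> 'b, 'e \<times> 'f) chart set" where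
  "prod_atlas A B = {(fst c \<times> fst d, map_prod (snd c) (snd d)) | c d. c \<in> A \<and> d \<in> B}"

text \<open>Smoothness on an open set \<open>S\<close>.\<close>

definition smooth_map_on ::
  "('a::topological_space, 'e::real_normed_vector) chart set \<Rightarrow>
   ('b::topological_space, 'f::real_normed_vector) chart set \<Rightarrow> 'a set \<Rightarrow> ('a \<Rightarrow> 'b) \<Rightarrow> bool" where
  "smooth_map_on A B S F \<longleftrightarrow> continuous_on S F \<and>
     (\<forall>c\<in>A. \<forall>d\<in>B.
        smooth_on (snd c ` (S \<inter> fst c \<inter> F -` fst d)) (snd d \<circ> F \<circ> chart_inv c))"

abbreviation "smooth_map A B F \<equiv> smooth_map_on A B UNIV F"

definition smooth_fun ::
  "('a, 'e::real_normed_vector) chart set \<Rightarrow> ('a \<Rightarrow> 'v::real_normed_vector) \<Rightarrow> bool" where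
  "smooth_fun A f \<longleftrightarrow> (\<forall>c\<in>A. smooth_on (snd c ` fst c) (f \<circ> chart_inv c))"

text \<open>A tangent vector at \<open>p\<close> is the family of its coordinate representations in all charts
  around \<open>p\<close>, which transform by the derivatives of the coordinate changes. The family is
  extended by 0 to all other charts, so that the pointwise operations on families
  are the vector space operations of the tangent space.\<close>

type_synonym ('a, 'e) tvec = "('a, 'e) chart \<Rightarrow> 'e"

type_synonym ('a, 'e) field = "'a \<Rightarrow> ('a, 'e) tvec"

definition tangent_space ::
  "('a, 'e::real_normed_vector) chart set \<Rightarrow> 'a \<Rightarrow> ('a, 'e) tvec set" where
  "tangent_space A p = {v.
     (\<forall>c\<in>A. \<forall>d\<in>A. p \<in> fst c \<longrightarrow> p \<in> fst d \<longrightarrow>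
        v d = frechet_derivative (snd d \<circ> chart_inv c) (at (snd c p)) (v c)) \<and>
     (\<forall>c. c \<notin> A \<or> p \<notin> fst c \<longrightarrow> v c = 0)}"

definition chart_at :: "('a, 'e) chart set \<Rightarrow> 'a \<Rightarrow> ('a, 'e) chart" where
  "chart_at A p = (SOME c. c \<in> A \<and> p \<in> fst c)"

text \<open>The derivative \<open>v(f)\<close> of a vector-valued function \<open>f\<close> in direction of \<open>v \<in> T\<^sub>p\<close>; it does not
  depend on the chart chosen. Similarly for the differential \<open>F\<^sub>*\<close> at \<open>p\<close>.\<close>

definition dir_deriv ::
  "('a, 'e::real_normed_vector) chart set \<Rightarrow> 'a \<Rightarrow> ('a, 'e) tvec \<Rightarrow>
   ('a \<Rightarrow> 'v::real_normed_vector) \<Rightarrow> 'v" where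
  "dir_deriv A p v f =
     (let c = chart_at A p in frechet_derivative (f \<circ> chart_inv c) (at (snd c p)) (v c))"

definition differential ::
  "('a, 'e::real_normed_vector) chart set \<Rightarrow> ('b, 'f::real_normed_vector) chart set \<Rightarrow>
   ('a \<Rightarrow> 'b) \<Rightarrow> 'a \<Rightarrow> ('a, 'e) tvec \<Rightarrow> ('b, 'f) tvec" where
  "differential A B F p v =
     (\<lambda>d. if d \<in> B \<and> F p \<in> fst d then dir_deriv A p v (snd d \<circ> F) else 0)"

definition vector_field ::
  "('a, 'e::real_normed_vector) chart set \<Rightarrow> ('a, 'e) field \<Rightarrow> bool" where
  "vector_field A X \<longleftrightarrow>
     (\<forall>p. X p \<in> tangent_space A p) \<and>
     (\<forall>c\<in>A. smooth_on (snd c ` fst c) (\<lambda>x. X (chart_inv c x) c))"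

text \<open>In local coordinates, \<open>[X,Y]\<^sup>j = X\<^sup>i \<partial>\<^sub>iY\<^sup>j - Y\<^sup>i \<partial>\<^sub>iX\<^sup>j\<close>.\<close>

definition lie_bracket ::
  "('a, 'e::real_normed_vector) chart set \<Rightarrow> ('a, 'e) field \<Rightarrow> ('a, 'e) field \<Rightarrow> ('a, 'e) field" where
  "lie_bracket A X Y p =
     (\<lambda>c. if c \<in> A \<and> p \<in> fst c
          then dir_deriv A p (X p) (\<lambda>q. Y q c) - dir_deriv A p (Y p) (\<lambda>q. X q c) else 0)"

definition related ::
  "('a, 'e::real_normed_vector) chart set \<Rightarrow> ('b, 'f::real_normed_vector) chart set \<Rightarrow>
   ('a \<Rightarrow> 'b) \<Rightarrow> ('a, 'e) field \<Rightarrow> ('b, 'f) field \<Rightarrow> bool" where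
  "related A B F X Y \<longleftrightarrow> (\<forall>p. differential A B F p (X p) = Y (F p))"

text \<open>Some smooth vector field extending a given tangent vector. It serves to evaluate operators
  on vector fields that are tensorial on tangent vectors at a point; for these
  the choice is irrelevant.\<close>

definition extend :: "('a, 'e::real_normed_vector) chart set \<Rightarrow> 'a \<Rightarrow> ('a, 'e) tvec \<Rightarrow> ('a, 'e) field" where
  "extend A p v = (SOME X. vector_field A X \<and> X p = v)"

definition at_point ::
  "('a, 'e::real_normed_vector) chart set \<Rightarrow>
   (('a, 'e) field \<Rightarrow> ('a, 'e) field \<Rightarrow> 'a \<Rightarrow> 'w) \<Rightarrow>
   'a \<Rightarrow> ('a, 'e) tvec \<Rightarrow> ('a, 'e) tvec \<Rightarrow> 'w" where
  "at_point A B p u v = B (extend A p u) (extend A p v) p"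


section \<open>Connections\<close>

type_synonym ('a, 'e) cov_deriv = "('a, 'e) field \<Rightarrow> ('a, 'e) field \<Rightarrow> ('a, 'e) field"

definition connection ::
  "('a, 'e::real_normed_vector) chart set \<Rightarrow> ('a, 'e) cov_deriv \<Rightarrow> bool" where
  "connection A D \<longleftrightarrow>
     (\<forall>X Y. vector_field A X \<longrightarrow> vector_field A Y \<longrightarrow> vector_field A (D X Y)) \<and>
     (\<forall>X X' Y. vector_field A X \<longrightarrow> vector_field A X' \<longrightarrow> vector_field A Y \<longrightarrow>
        D (\<lambda>p. X p + X' p) Y = (\<lambda>p. D X Y p + D X' Y p)) \<and>
     (\<forall>f X Y. smooth_fun A f \<longrightarrow> vector_field A X \<longrightarrow> vector_field A Y \<longrightarrow>
        D (\<lambda>p. f p *\<^sub>R X p) Y = (\<lambda>p. f p *\<^sub>R D X Y p)) \<and>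
     (\<forall>X Y Y'. vector_field A X \<longrightarrow> vector_field A Y \<longrightarrow> vector_field A Y' \<longrightarrow>
        D X (\<lambda>p. Y p + Y' p) = (\<lambda>p. D X Y p + D X Y' p)) \<and>
     (\<forall>f X Y. smooth_fun A f \<longrightarrow> vector_field A X \<longrightarrow> vector_field A Y \<longrightarrow>
        D X (\<lambda>p. f p *\<^sub>R Y p) = (\<lambda>p. dir_deriv A p (X p) f *\<^sub>R Y p + f p *\<^sub>R D X Y p)) \<and>
     (\<forall>X Y. vector_field A X \<longrightarrow> vector_field A Y \<longrightarrow>
        (\<lambda>p. D X Y p - D Y X p) = lie_bracket A X Y)"

text \<open>Some vector field which, near \<open>p\<close>, has the constant coordinates \<open>w\<close> in the chart \<open>c\<close>.\<close>

definition coord_field ::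
  "('a::topological_space, 'e::real_normed_vector) chart set \<Rightarrow> ('a, 'e) chart \<Rightarrow> 'a \<Rightarrow> 'e \<Rightarrow>
   ('a, 'e) field" where
  "coord_field A c p w = (SOME X. vector_field A X \<and> (\<forall>\<^sub>F q in nhds p. X q c = w))"

text \<open>\<open>(\<Gamma>\<^sup>k\<^sub>i\<^sub>j u\<^sup>i w\<^sup>j)\<^sub>k\<close> in the chart \<open>c\<close>, for \<open>u \<in> T\<^sub>p\<close>.\<close>

definition christoffel ::
  "('a::topological_space, 'e::real_normed_vector) chart set \<Rightarrow> ('a, 'e) cov_deriv \<Rightarrow>
   ('a, 'e) chart \<Rightarrow> 'a \<Rightarrow> ('a, 'e) tvec \<Rightarrow> 'e \<Rightarrow> 'e" where
  "christoffel A D c p u w = D (extend A p u) (coord_field A c p w) p c"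

text \<open>The connection on \<open>F\<^sup>*TB\<close> pulled back from \<open>D\<close>: for a section \<open>W\<close> along \<open>F\<close> and \<open>v \<in> T\<^sub>qA\<close>,
  \<open>(\<nabla>\<^sub>vW)\<^sup>k = v(W\<^sup>k) + \<Gamma>\<^sup>k\<^sub>i\<^sub>j (F\<^sub>*v)\<^sup>i W\<^sup>j\<close>.\<close>

definition pullback_deriv ::
  "('a, 'e::real_normed_vector) chart set \<Rightarrow>
   ('b::topological_space, 'f::real_normed_vector) chart set \<Rightarrow> ('b, 'f) cov_deriv \<Rightarrow>
   ('a \<Rightarrow> 'b) \<Rightarrow> 'a \<Rightarrow> ('a, 'e) tvec \<Rightarrow> ('a \<Rightarrow> ('b, 'f) tvec) \<Rightarrow> ('b, 'f) tvec" where
  "pullback_deriv A B D F q v W =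
     (\<lambda>c. if c \<in> B \<and> F q \<in> fst c
          then dir_deriv A q v (\<lambda>x. W x c) + christoffel B D c (F q) (differential A B F q v) (W q c)
          else 0)"

text \<open>Differential forms with values in a tangent space \<open>V\<close> of a (further) manifold. For \<open>k\<close> a
  chart, \<open>\<theta> p v k\<close> is the coordinate vector of \<open>\<theta>\<^sub>p(v)\<close>.\<close>

definition one_form ::
  "('a, 'e::real_normed_vector) chart set \<Rightarrow> ('b, 'f::real_normed_vector) tvec set \<Rightarrow>
   ('a \<Rightarrow> ('a, 'e) tvec \<Rightarrow> ('b, 'f) tvec) \<Rightarrow> bool" where
  "one_form A V \<theta> \<longleftrightarrow>
     (\<forall>p. linear_between (tangent_space A p) V (\<theta> p)) \<and>
     (\<forall>X k. vector_field A X \<longrightarrow> smooth_fun A (\<lambda>p. \<theta> p (X p) k))"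

text \<open>\<open>(\<nabla>\<theta>)(X,Y) = X(\<theta>(Y)) - \<theta>(\<nabla>\<^sub>XY)\<close>.\<close>

definition cov_deriv_form ::
  "('a, 'e::real_normed_vector) chart set \<Rightarrow> ('a, 'e) cov_deriv \<Rightarrow>
   ('a \<Rightarrow> ('a, 'e) tvec \<Rightarrow> ('b, 'f::real_normed_vector) tvec) \<Rightarrow>
   ('a, 'e) field \<Rightarrow> ('a, 'e) field \<Rightarrow> 'a \<Rightarrow> ('b, 'f) tvec" where
  "cov_deriv_form A D \<theta> X Y p =
     (\<lambda>k. dir_deriv A p (X p) (\<lambda>q. \<theta> q (Y q) k)) - \<theta> p (D X Y p)"

definition pullback_form ::
  "('a, 'e::real_normed_vector) chart set \<Rightarrow> ('b, 'f::real_normed_vector) chart set \<Rightarrow>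
   ('a \<Rightarrow> 'b) \<Rightarrow> ('b \<Rightarrow> ('b, 'f) tvec \<Rightarrow> 'w) \<Rightarrow> 'a \<Rightarrow> ('a, 'e) tvec \<Rightarrow> 'w" where
  "pullback_form A B F \<theta> p v = \<theta> (F p) (differential A B F p v)"


section \<open>Riemannian metrics and harmonic maps\<close>

type_synonym ('a, 'e) metric = "'a \<Rightarrow> ('a, 'e) tvec \<Rightarrow> ('a, 'e) tvec \<Rightarrow> real"

definition riemannian_metric ::
  "('a, 'e::real_normed_vector) chart set \<Rightarrow> ('a, 'e) metric \<Rightarrow> bool" where
  "riemannian_metric A g \<longleftrightarrow>
     (\<forall>p. \<forall>u\<in>tangent_space A p.
        linear_between (tangent_space A p) UNIV (g p u) \<and>
        (\<forall>v\<in>tangent_space A p. g p u v = g p v u) \<and>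
        (u \<noteq> 0 \<longrightarrow> g p u u > 0)) \<and>
     (\<forall>X Y. vector_field A X \<longrightarrow> vector_field A Y \<longrightarrow> smooth_fun A (\<lambda>p. g p (X p) (Y p)))"

definition levi_civita ::
  "('a, 'e::real_normed_vector) chart set \<Rightarrow> ('a, 'e) metric \<Rightarrow> ('a, 'e) cov_deriv \<Rightarrow> bool" where
  "levi_civita A g D \<longleftrightarrow> connection A D \<and>
     (\<forall>X Y Z. vector_field A X \<longrightarrow> vector_field A Y \<longrightarrow> vector_field A Z \<longrightarrow>
        (\<forall>p. dir_deriv A p (X p) (\<lambda>q. g q (Y q) (Z q)) =
             g p (D X Y p) (Z p) + g p (Y p) (D X Z p)))"

definition orthonormal_basis ::
  "('a, 'e::real_normed_vector) chart set \<Rightarrow> ('a, 'e) metric \<Rightarrow> 'a \<Rightarrow> ('a, 'e) tvec set \<Rightarrow> bool" where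
  "orthonormal_basis A g p E \<longleftrightarrow> finite E \<and> span E = tangent_space A p \<and>
     (\<forall>u\<in>E. \<forall>v\<in>E. g p u v = (if u = v then 1 else 0))"

definition metric_trace ::
  "('a, 'e::real_normed_vector) chart set \<Rightarrow> ('a, 'e) metric \<Rightarrow> 'a \<Rightarrow>
   (('a, 'e) tvec \<Rightarrow> ('a, 'e) tvec \<Rightarrow> 'w::comm_monoid_add) \<Rightarrow> 'w" where
  "metric_trace A g p b = (\<Sum>e\<in>(SOME E. orthonormal_basis A g p E). b e e)"

definition second_fundamental_form ::
  "('a, 'e::real_normed_vector) chart set \<Rightarrow> ('a, 'e) cov_deriv \<Rightarrow>
   ('b::topological_space, 'f::real_normed_vector) chart set \<Rightarrow> ('b, 'f) cov_deriv \<Rightarrow>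
   ('a \<Rightarrow> 'b) \<Rightarrow> ('a, 'e) field \<Rightarrow> ('a, 'e) field \<Rightarrow> 'a \<Rightarrow> ('b, 'f) tvec" where
  "second_fundamental_form A DA B DB F X Y p =
     pullback_deriv A B DB F p (X p) (\<lambda>q. differential A B F q (Y q))
     - differential A B F p (DA X Y p)"

definition tension_field ::
  "('a, 'e::real_normed_vector) chart set \<Rightarrow> ('a, 'e) metric \<Rightarrow> ('a, 'e) cov_deriv \<Rightarrow>
   ('b::topological_space, 'f::real_normed_vector) chart set \<Rightarrow> ('b, 'f) cov_deriv \<Rightarrow>
   ('a \<Rightarrow> 'b) \<Rightarrow> 'a \<Rightarrow> ('b, 'f) tvec" where
  "tension_field A g DA B DB F p =
     metric_trace A g p (at_point A (second_fundamental_form A DA B DB F) p)"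

definition harmonic_map ::
  "('a, 'e::real_normed_vector) chart set \<Rightarrow> ('a, 'e) metric \<Rightarrow> ('a, 'e) cov_deriv \<Rightarrow>
   ('b::topological_space, 'f::real_normed_vector) chart set \<Rightarrow> ('b, 'f) cov_deriv \<Rightarrow>
   ('a \<Rightarrow> 'b) \<Rightarrow> bool" where
  "harmonic_map A g DA B DB F \<longleftrightarrow> (\<forall>p. tension_field A g DA B DB F p = 0)"

text \<open>\<open>d\<^sup>*\<theta>\<close> with the sign convention \<open>d\<^sup>*\<theta> = tr \<nabla>\<theta>\<close>.\<close>

definition codifferential ::
  "('a, 'e::real_normed_vector) chart set \<Rightarrow> ('a, 'e) metric \<Rightarrow> ('a, 'e) cov_deriv \<Rightarrow>
   ('a \<Rightarrow> ('a, 'e) tvec \<Rightarrow> ('b, 'f::real_normed_vector) tvec) \<Rightarrow> 'a \<Rightarrow> ('b, 'f) tvec" where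
  "codifferential A g D \<theta> p = metric_trace A g p (at_point A (cov_deriv_form A D \<theta>) p)"


section \<open>Principal bundles\<close>

definition lie_group ::
  "('g::{t2_space, second_countable_topology}, 'd::fin_dim) chart set \<Rightarrow>
   ('g \<Rightarrow> 'g \<Rightarrow> 'g) \<Rightarrow> 'g \<Rightarrow> ('g \<Rightarrow> 'g) \<Rightarrow> bool" where
  "lie_group G gmult gid ginv \<longleftrightarrow> smooth_manifold G \<and> Groups.group gmult gid ginv \<and>
     smooth_map (prod_atlas G G) G (\<lambda>(a, b). gmult a b) \<and> smooth_map G G ginv"

definition principal_bundle ::
  "('p::{t2_space, second_countable_topology}, 'c::fin_dim) chart set \<Rightarrow>
   ('m::{t2_space, second_countable_topology}, 'b::fin_dim) chart set \<Rightarrow>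
   ('g::{t2_space, second_countable_topology}, 'd::fin_dim) chart set \<Rightarrow>
   ('g \<Rightarrow> 'g \<Rightarrow> 'g) \<Rightarrow> 'g \<Rightarrow> ('g \<Rightarrow> 'g) \<Rightarrow> ('p \<Rightarrow> 'g \<Rightarrow> 'p) \<Rightarrow> ('p \<Rightarrow> 'm) \<Rightarrow> bool" where
  "principal_bundle P M G gmult gid ginv act \<pi> \<longleftrightarrow>
     smooth_manifold P \<and> smooth_manifold M \<and> lie_group G gmult gid ginv \<and>
     smooth_map (prod_atlas P G) P (\<lambda>(p, a). act p a) \<and>
     (\<forall>p. act p gid = p) \<and> (\<forall>p a b. act p (gmult a b) = act (act p a) b) \<and>
     (\<forall>p a. act p a = p \<longrightarrow> a = gid) \<and>
     smooth_map P M \<pi> \<and> surj \<pi> \<and>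
     (\<forall>p q. \<pi> p = \<pi> q \<longleftrightarrow> (\<exists>a. q = act p a)) \<and>
     (\<forall>x. \<exists>U \<tau>. open U \<and> x \<in> U \<and>
        (let \<psi> = (\<lambda>p. (\<pi> p, \<tau> p)) in
           bij_betw \<psi> (\<pi> -` U) (U \<times> UNIV) \<and>
           smooth_map_on P (prod_atlas M G) (\<pi> -` U) \<psi> \<and>
           smooth_map_on (prod_atlas M G) P (U \<times> UNIV) (inv_into (\<pi> -` U) \<psi>) \<and>
           (\<forall>p\<in>\<pi> -` U. \<forall>a. \<tau> (act p a) = gmult (\<tau> p) a)))"

text \<open>The Lie algebra is, as a vector space, the tangent space at the identity
  (its bracket is not needed).\<close>

abbreviation lie_algebra ::
  "('g, 'd::real_normed_vector) chart set \<Rightarrow> 'g \<Rightarrow> ('g, 'd) tvec set" where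
  "lie_algebra G gid \<equiv> tangent_space G gid"

definition adjoint_action ::
  "('g, 'd::real_normed_vector) chart set \<Rightarrow> ('g \<Rightarrow> 'g \<Rightarrow> 'g) \<Rightarrow> 'g \<Rightarrow> ('g \<Rightarrow> 'g) \<Rightarrow>
   'g \<Rightarrow> ('g, 'd) tvec \<Rightarrow> ('g, 'd) tvec" where
  "adjoint_action G gmult gid ginv a =
     differential G G (\<lambda>x. gmult (gmult a x) (ginv a)) gid"

definition fundamental_field ::
  "('p, 'c::real_normed_vector) chart set \<Rightarrow> ('g, 'd::real_normed_vector) chart set \<Rightarrow> 'g \<Rightarrow>
   ('p \<Rightarrow> 'g \<Rightarrow> 'p) \<Rightarrow> ('g, 'd) tvec \<Rightarrow> ('p, 'c) field" where
  "fundamental_field P G gid act B p = differential G P (act p) gid B"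

definition connection_form ::
  "('p, 'c::real_normed_vector) chart set \<Rightarrow> ('g, 'd::real_normed_vector) chart set \<Rightarrow>
   ('g \<Rightarrow> 'g \<Rightarrow> 'g) \<Rightarrow> 'g \<Rightarrow> ('g \<Rightarrow> 'g) \<Rightarrow> ('p \<Rightarrow> 'g \<Rightarrow> 'p) \<Rightarrow>
   ('p \<Rightarrow> ('p, 'c) tvec \<Rightarrow> ('g, 'd) tvec) \<Rightarrow> bool" where
  "connection_form P G gmult gid ginv act \<omega> \<longleftrightarrow>
     one_form P (lie_algebra G gid) \<omega> \<and>
     (\<forall>B\<in>lie_algebra G gid. \<forall>p. \<omega> p (fundamental_field P G gid act B p) = B) \<and>
     (\<forall>a p. \<forall>v\<in>tangent_space P p.
        pullback_form P P (\<lambda>q. act q a) \<omega> p v =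
        adjoint_action G gmult gid ginv (ginv a) (\<omega> p v))"

definition vertical_space ::
  "('p, 'c::real_normed_vector) chart set \<Rightarrow> ('m, 'b::real_normed_vector) chart set \<Rightarrow>
   ('p \<Rightarrow> 'm) \<Rightarrow> 'p \<Rightarrow> ('p, 'c) tvec set" where
  "vertical_space P M \<pi> p = {v \<in> tangent_space P p. differential P M \<pi> p v = 0}"

definition horizontal_space ::
  "('p, 'c::real_normed_vector) chart set \<Rightarrow> ('p \<Rightarrow> ('p, 'c) tvec \<Rightarrow> ('g, 'd::real_normed_vector) tvec) \<Rightarrow>
   'p \<Rightarrow> ('p, 'c) tvec set" where
  "horizontal_space P \<omega> p = {v \<in> tangent_space P p. \<omega> p v = 0}"

text \<open>The projections of the splitting \<open>TP = HP \<oplus> VP\<close>.\<close>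

definition hor ::
  "('p, 'c::real_normed_vector) chart set \<Rightarrow> ('m, 'b::real_normed_vector) chart set \<Rightarrow>
   ('p \<Rightarrow> 'm) \<Rightarrow> ('p \<Rightarrow> ('p, 'c) tvec \<Rightarrow> ('g, 'd::real_normed_vector) tvec) \<Rightarrow>
   ('p, 'c) field \<Rightarrow> ('p, 'c) field" where
  "hor P M \<pi> \<omega> U p =
     (THE h. h \<in> horizontal_space P \<omega> p \<and> U p - h \<in> vertical_space P M \<pi> p)"

definition ver ::
  "('p, 'c::real_normed_vector) chart set \<Rightarrow> ('m, 'b::real_normed_vector) chart set \<Rightarrow>
   ('p \<Rightarrow> 'm) \<Rightarrow> ('p \<Rightarrow> ('p, 'c) tvec \<Rightarrow> ('g, 'd::real_normed_vector) tvec) \<Rightarrow>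
   ('p, 'c) field \<Rightarrow> ('p, 'c) field" where
  "ver P M \<pi> \<omega> U p =
     (THE v. v \<in> vertical_space P M \<pi> p \<and> U p - v \<in> horizontal_space P \<omega> p)"

definition horizontal_lift ::
  "('p, 'c::real_normed_vector) chart set \<Rightarrow> ('m, 'b::real_normed_vector) chart set \<Rightarrow>
   ('p \<Rightarrow> 'm) \<Rightarrow> ('p \<Rightarrow> ('p, 'c) tvec \<Rightarrow> ('g, 'd::real_normed_vector) tvec) \<Rightarrow>
   ('m, 'b) field \<Rightarrow> ('p, 'c) field" where
  "horizontal_lift P M \<pi> \<omega> X p =
     (THE u. u \<in> horizontal_space P \<omega> p \<and> differential P M \<pi> p u = X (\<pi> p))"

text \<open>A diffeomorphism is affine iff it preserves covariant derivatives,
  i.e. maps \<open>\<nabla>\<^sub>XY\<close> to \<open>\<nabla>\<^sub>X\<^sub>'Y'\<close> whenever it maps \<open>X\<close> to \<open>X'\<close> and \<open>Y\<close> to \<open>Y'\<close>.\<close>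

definition invariant_connection ::
  "('p, 'c::real_normed_vector) chart set \<Rightarrow> ('p \<Rightarrow> 'g \<Rightarrow> 'p) \<Rightarrow> ('p, 'c) cov_deriv \<Rightarrow> bool" where
  "invariant_connection P act D \<longleftrightarrow> connection P D \<and>
     (\<forall>a X Y X' Y'.
        vector_field P X \<longrightarrow> vector_field P Y \<longrightarrow> vector_field P X' \<longrightarrow> vector_field P Y' \<longrightarrow>
        related P P (\<lambda>p. act p a) X X' \<longrightarrow> related P P (\<lambda>p. act p a) Y Y' \<longrightarrow>
        related P P (\<lambda>p. act p a) (D X Y) (D X' Y'))"

definition projectable_connection ::
  "('p, 'c::real_normed_vector) chart set \<Rightarrow> ('m, 'b::real_normed_vector) chart set \<Rightarrow>
   ('p \<Rightarrow> 'g \<Rightarrow> 'p) \<Rightarrow> ('p \<Rightarrow> 'm) \<Rightarrow> ('p \<Rightarrow> ('p, 'c) tvec \<Rightarrow> ('g, 'd::real_normed_vector) tvec) \<Rightarrow>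
   ('p, 'c) cov_deriv \<Rightarrow> bool" where
  "projectable_connection P M act \<pi> \<omega> D \<longleftrightarrow> invariant_connection P act D \<and>
     (\<forall>X Y. vector_field M X \<longrightarrow> vector_field M Y \<longrightarrow>
        (\<exists>Z. vector_field M Z \<and>
           related P M \<pi>
             (hor P M \<pi> \<omega> (D (horizontal_lift P M \<pi> \<omega> X) (horizontal_lift P M \<pi> \<omega> Y))) Z))"

definition is_projection ::
  "('p, 'c::real_normed_vector) chart set \<Rightarrow> ('m, 'b::real_normed_vector) chart set \<Rightarrow>
   ('p \<Rightarrow> 'm) \<Rightarrow> ('p \<Rightarrow> ('p, 'c) tvec \<Rightarrow> ('g, 'd::real_normed_vector) tvec) \<Rightarrow>
   ('p, 'c) cov_deriv \<Rightarrow> ('m, 'b) cov_deriv \<Rightarrow> bool" where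
  "is_projection P M \<pi> \<omega> DP DM \<longleftrightarrow> connection M DM \<and>
     (\<forall>X Y. vector_field M X \<longrightarrow> vector_field M Y \<longrightarrow>
        hor P M \<pi> \<omega> (DP (horizontal_lift P M \<pi> \<omega> X) (horizontal_lift P M \<pi> \<omega> Y)) =
        horizontal_lift P M \<pi> \<omega> (DM X Y))"

text \<open>The fundamental tensors \<open>T\<close> and \<open>A\<close>, on vector fields \<open>U\<close>, \<open>V\<close>.\<close>

definition tensor_T ::
  "('p, 'c::real_normed_vector) chart set \<Rightarrow> ('m, 'b::real_normed_vector) chart set \<Rightarrow>
   ('p \<Rightarrow> 'm) \<Rightarrow> ('p \<Rightarrow> ('p, 'c) tvec \<Rightarrow> ('g, 'd::real_normed_vector) tvec) \<Rightarrow>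
   ('p, 'c) cov_deriv \<Rightarrow> ('p, 'c) cov_deriv" where
  "tensor_T P M \<pi> \<omega> D U V =
     (let h = hor P M \<pi> \<omega>; v = ver P M \<pi> \<omega> in h (D (v U) (v V)) + v (D (v U) (h V)))"

definition tensor_A ::
  "('p, 'c::real_normed_vector) chart set \<Rightarrow> ('m, 'b::real_normed_vector) chart set \<Rightarrow>
   ('p \<Rightarrow> 'm) \<Rightarrow> ('p \<Rightarrow> ('p, 'c) tvec \<Rightarrow> ('g, 'd::real_normed_vector) tvec) \<Rightarrow>
   ('p, 'c) cov_deriv \<Rightarrow> ('p, 'c) cov_deriv" where
  "tensor_A P M \<pi> \<omega> D U V =
     (let h = hor P M \<pi> \<omega>; v = ver P M \<pi> \<omega> in v (D (h U) (h V)) + h (D (h U) (v V)))"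

definition sym_part :: "('f \<Rightarrow> 'f \<Rightarrow> 'w::real_vector) \<Rightarrow> 'f \<Rightarrow> 'f \<Rightarrow> 'w" where
  "sym_part B U V = (1 / 2) *\<^sub>R (B U V + B V U)"

end

theory Submission
  imports Defs
begin

text \<open>Write \<open>\<beta>\<^sub>F\<close> for the second fundamental form and \<open>Z = F\<^sub>*Y\<close>. Expanding \<open>F\<^sub>*Y\<close> along \<open>F\<close>
  in a local frame of vector fields on \<open>P\<close> gives
  \<open>\<omega>(\<beta>\<^sub>F(Y,Y)) = (\<nabla>F\<^sup>*\<omega>)(Y,Y) - (\<nabla>\<^sup>P\<omega>)(Z,Z)\<close> and the composition formula
  \<open>\<beta>\<^bsub>\<pi>\<circ>F\<^esub>(Y,Y) = \<pi>\<^sub>*\<beta>\<^sub>F(Y,Y) + \<beta>\<^sub>\<pi>(Z,Z)\<close>.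
  The form \<open>\<beta>\<^sub>\<pi>\<close> is tensorial and symmetric; it vanishes on horizontal lifts because the
  connection projects to \<open>\<nabla>\<^sup>M\<close>, and \<open>\<beta>\<^sub>\<pi>(U,V) = - \<pi>\<^sub>*(\<nabla>\<^sup>P V)(U)\<close> for vertical \<open>V\<close>.
  Splitting \<open>Z\<close> into its horizontal and vertical parts therefore yields
  \<open>\<beta>\<^sub>\<pi>(Z,Z) = - \<pi>\<^sub>*(2A + T)(Z,Z)\<close>. After taking traces, the two conditions say that
  \<open>\<omega>(\<tau>\<^sub>F)\<close> and \<open>\<pi>\<^sub>*\<tau>\<^sub>F\<close> vanish, which is equivalent to \<open>\<tau>\<^sub>F = 0\<close> since
  \<open>ker \<omega> \<inter> ker \<pi>\<^sub>* = 0\<close>.\<close>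

section \<open>Finite-dimensional spaces\<close>

text \<open>A connection here is an operator on global vector fields, whereas \<open>F_*Y\<close> is
  only a field along \<open>F\<close>, and \<open>F\<close> may be neither injective nor an
  immersion, so that \<open>F_*Y\<close> need not come from a field on \<open>P\<close>. Frames
  resolve this: the coordinate fields of a chart around \<open>F q\<close>, extended to
  \<open>P\<close> by bump functions, are global fields, and the coefficients are functions on
  \<open>N\<close>. Bump functions also show that connections depend on germs only, and a frame
  turns linearity over functions into dependence on the value at one point. The latter gives meaning
  to \<open>at_point\<close>, whose extensions are arbitrary choices. For the second fundamental
  form, independence of the extension in the second slot is deduced from symmetry, that is, from
  vanishing torsion and the symmetry of second derivatives. The same symmetry merges the two mixed
  terms of the horizontal-vertical splitting into one, whence the factor 2 before \<open>A\<close>.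
  All traces at a point are sums over one chosen orthonormal basis, so it suffices to compare
  summands, and the equivalence holds at each point of \<open>N\<close> separately.\<close>

lemma gram_schmidt:
  fixes g :: "'v::real_vector \<Rightarrow> 'v \<Rightarrow> real"
  assumes V: "subspace V"
    and lin: "\<And>u. u \<in> V \<Longrightarrow> linear_between V UNIV (g u)"
    and sym: "\<And>u v. u \<in> V \<Longrightarrow> v \<in> V \<Longrightarrow> g u v = g v u"
    and pos: "\<And>u. u \<in> V \<Longrightarrow> u \<noteq> 0 \<Longrightarrow> g u u > 0"
    and S: "finite S" "S \<subseteq> V"
  shows "\<exists>E. finite E \<and> span E = span S \<and> (\<forall>u\<in>E. \<forall>v\<in>E. g u v = (if u = v then 1 else 0))"
  using S
proof (induction S rule: finite_induct)
  case empty
  show ?case by (intro exI[of _ "{}"]) auto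
next
  case (insert s S)
  then obtain E where E: "finite E" "span E = span S" "\<forall>u\<in>E. \<forall>v\<in>E. g u v = (if u = v then 1 else 0)"
    by auto
  have add: "g u (v + w) = g u v + g u w" if "u \<in> V" "v \<in> V" "w \<in> V" for u v w
    using lin[OF that(1)] that by (auto simp: linear_between_def)
  have scl: "g u (r *\<^sub>R v) = r * g u v" if "u \<in> V" "v \<in> V" for u v r
    using lin[OF that(1)] that by (auto simp: linear_between_def)
  have zero: "g u 0 = 0" if "u \<in> V" for u
    using scl[OF that subspace_0[OF V], of 0] by simp
  have EV: "E \<subseteq> V"
    using E(2) insert.prems V by (metis insert_subset span_minimal span_superset subset_trans)
  have sV: "s \<in> V" using insert.prems by auto
  define p where "p = (\<Sum>e\<in>E. g s e *\<^sub>R e)"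
  have pE: "p \<in> span E" unfolding p_def by (intro span_sum span_scale span_base)
  have pV: "p \<in> V" using pE EV V span_minimal by blast
  have gsum: "g u (\<Sum>e\<in>E'. r e *\<^sub>R e) = (\<Sum>e\<in>E'. r e * g u e)" if "u \<in> V" "finite E'" "E' \<subseteq> E" for u r E'
    using that(2,3)
  proof (induction E' rule: finite_induct)
    case empty
    then show ?case using zero[OF that(1)] by simp
  next
    case (insert x F)
    have "(\<Sum>e\<in>F. r e *\<^sub>R e) \<in> V"
      using insert.prems EV by (intro subspace_sum[OF V] subspace_scale[OF V]) auto
    moreover have "r x *\<^sub>R x \<in> V" using insert.prems EV by (intro subspace_scale[OF V]) auto
    ultimately show ?case using insert that(1) EV by (simp add: add scl subset_iff)
  qed
  have gp: "g u p = g s u" if "u \<in> E" for u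
  proof -
    have "g u p = (\<Sum>e\<in>E. g s e * g u e)" unfolding p_def using that E EV by (intro gsum) auto
    also have "\<dots> = (\<Sum>e\<in>E. if e = u then g s e else 0)" using E that by (intro sum.cong) auto
    also have "\<dots> = g s u" using E that by (simp add: sum.delta)
    finally show ?thesis .
  qed
  define t where "t = s - p"
  have tV: "t \<in> V" unfolding t_def using sV pV V by (simp add: subspace_diff)
  have gt: "g u t = 0" if "u \<in> E" for u
  proof -
    have "g u s = g u (t + p)" by (simp add: t_def)
    also have "\<dots> = g u t + g s u" using that EV tV pV by (subst add) (auto simp: gp)
    finally show ?thesis using sym[of s u] that EV sV by auto
  qed
  show ?case
  proof (cases "t = 0")
    case True
    then have "s \<in> span S" using pE E(2) t_def by simp
    then have "span (insert s S) = span E" using E(2) by (simp add: span_redundant)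
    then show ?thesis using E by (intro exI[of _ E]) auto
  next
    case False
    define e where "e = (1 / sqrt (g t t)) *\<^sub>R t"
    have gtt: "g t t > 0" using pos tV False by blast
    have eV: "e \<in> V" unfolding e_def by (intro subspace_scale[OF V] tV)
    have ge: "g u e = 0" if "u \<in> E" for u unfolding e_def using that EV tV by (auto simp: scl gt)
    have gte: "g t e = sqrt (g t t)" unfolding e_def using gtt tV by (simp add: scl real_div_sqrt)
    have "g e e = (1 / sqrt (g t t)) * g e t" using e_def scl[OF eV tV] by metis
    then have gee: "g e e = 1" using gte sym[OF eV tV] gtt by simp
    have ts: "t = sqrt (g t t) *\<^sub>R e" unfolding e_def using gtt by simp
    have "span (insert e E) = span (insert s S)"
    proof (rule antisym)
      have "t \<in> span (insert s S)" unfolding t_def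
        using pE E(2) span_mono[of S "insert s S"] by (intro span_diff) (auto intro: span_base)
      then have "e \<in> span (insert s S)" unfolding e_def by (rule span_scale)
      moreover have "E \<subseteq> span (insert s S)"
        using E(2) span_mono[of S "insert s S"] span_superset[of E] by blast
      ultimately show "span (insert e E) \<subseteq> span (insert s S)" by (intro span_minimal) auto
      have "e \<in> span (insert e E)" by (auto intro: span_base)
      then have "t \<in> span (insert e E)" by (subst ts) (rule span_scale)
      moreover have "p \<in> span (insert e E)" using pE span_mono[of E "insert e E"] by blast
      ultimately have "t + p \<in> span (insert e E)" by (rule span_add)
      then have "s \<in> span (insert e E)" by (simp add: t_def)
      moreover have "S \<subseteq> span (insert e E)"
        using E(2) span_mono[of E "insert e E"] span_superset[of S] by blast
      ultimately show "span (insert s S) \<subseteq> span (insert e E)" by (intro span_minimal) auto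
    qed
    moreover have "\<forall>u\<in>insert e E. \<forall>v\<in>insert e E. g u v = (if u = v then 1 else 0)"
    proof -
      have "e \<notin> E" using ge[of e] gee by auto
      then show ?thesis using E(3) ge gee sym[OF eV] EV by (auto simp: subset_iff)
    qed
    ultimately show ?thesis using E(1) by (intro exI[of _ "insert e E"]) auto
  qed
qed

text \<open>The class \<open>fin_dim\<close> fixes no basis of the model space, so one orthonormal
  basis is chosen once and for all. \<open>gram_schmidt\<close> takes a form on a subspace so that
  it yields both this basis and the orthonormal bases of tangent spaces, which are subspaces of a
  function space.\<close>

definition onb :: "'a::fin_dim set" where
  "onb = (SOME E. finite E \<and> span E = UNIV \<and> (\<forall>u\<in>E. \<forall>v\<in>E. u \<bullet> v = (if u = v then 1 else 0)))"

lemma onb_props: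
  "finite (onb :: 'a::fin_dim set)" "span (onb :: 'a set) = UNIV"
  "u \<in> onb \<Longrightarrow> v \<in> onb \<Longrightarrow> (u::'a) \<bullet> v = (if u = v then 1 else 0)"
proof -
  obtain B :: "'a set" where "finite B \<and> (\<forall>x. \<exists>r. x = (\<Sum>b\<in>B. r b *\<^sub>R b))"
    using finite_spanning_set by (elim exE)
  then have B: "finite B" "\<forall>x. \<exists>r. x = (\<Sum>b\<in>B. r b *\<^sub>R b)" by simp_all
  have "x \<in> span B" for x
  proof -
    obtain r where "x = (\<Sum>b\<in>B. r b *\<^sub>R b)" using B(2)[THEN spec, of x] by (elim exE)
    then show ?thesis by (auto intro: span_sum span_scale span_base)
  qed
  then have *: "span B = UNIV" by auto
  have "\<exists>E::'a set. finite E \<and> span E = span B \<and> (\<forall>u\<in>E. \<forall>v\<in>E. u \<bullet> v = (if u = v then 1 else 0))"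
    by (rule gram_schmidt[where V = UNIV])
       (use B in \<open>auto simp: linear_between_def inner_right_distrib inner_commute\<close>)
  then have "\<exists>E::'a set. finite E \<and> span E = UNIV \<and> (\<forall>u\<in>E. \<forall>v\<in>E. u \<bullet> v = (if u = v then 1 else 0))"
    using * by simp
  from someI_ex[OF this, folded onb_def]
  show "finite (onb :: 'a::fin_dim set)" "span (onb :: 'a set) = UNIV"
  "u \<in> onb \<Longrightarrow> v \<in> onb \<Longrightarrow> (u::'a) \<bullet> v = (if u = v then 1 else 0)" by auto
qed

lemmas finite_onb [simp, intro] = onb_props(1)

lemma onb_sum: "(\<Sum>b\<in>onb. (x \<bullet> b) *\<^sub>R b) = (x::'a::fin_dim)"
proof -
  have "x \<in> span onb" by (simp add: onb_props)
  then show ?thesis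
  proof (induction rule: span_induct_alt)
    case base
    then show ?case by simp
  next
    case (step c u y)
    have "(\<Sum>b\<in>onb. ((c *\<^sub>R u + y) \<bullet> b) *\<^sub>R b) = c *\<^sub>R (\<Sum>b\<in>onb. (u \<bullet> b) *\<^sub>R b) + (\<Sum>b\<in>onb. (y \<bullet> b) *\<^sub>R b)"
      by (simp add: inner_left_distrib scaleR_add_left sum.distrib scaleR_sum_right)
    also have "(\<Sum>b\<in>onb. (u \<bullet> b) *\<^sub>R b) = (\<Sum>b\<in>onb. if b = u then u else 0)"
      by (intro sum.cong) (use step in \<open>auto simp: onb_props(3)\<close>)
    also have "\<dots> = u" using step by simp
    finally show ?case using step by simp
  qed
qed

lemma linear_onb_sum:
  assumes "linear (f :: 'a::fin_dim \<Rightarrow> 'b::real_vector)"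
  shows "f x = (\<Sum>b\<in>onb. (x \<bullet> b) *\<^sub>R f b)"
proof -
  have "f x = f (\<Sum>b\<in>onb. (x \<bullet> b) *\<^sub>R b)" by (simp add: onb_sum)
  also have "\<dots> = (\<Sum>b\<in>onb. (x \<bullet> b) *\<^sub>R f b)"
    using assms by (simp add: linear_sum linear_scale)
  finally show ?thesis .
qed

text \<open>The charts of \<open>prod_atlas\<close> take values in a product, and the chain rule
  \<open>Ck_on_comp\<close> is proved for intermediate spaces of class
  \<open>fin_dim\<close>.\<close>

instance prod :: (fin_dim, fin_dim) fin_dim
proof
  let ?B = "(\<lambda>b. (b, 0)) ` onb \<union> (\<lambda>b. (0, b)) ` onb :: ('a \<times> 'b) set"
  have "x \<in> span ?B" for x
  proof -
    have "(fst x, 0) = (\<Sum>b\<in>onb. (fst x \<bullet> b) *\<^sub>R (b, 0 :: 'b))"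
      using onb_sum[of "fst x"] by (simp add: sum_prod)
    also have "\<dots> \<in> span ?B" by (intro span_sum span_scale span_base) auto
    finally have 1: "(fst x, 0) \<in> span ?B" .
    have "(0, snd x) = (\<Sum>b\<in>onb. (snd x \<bullet> b) *\<^sub>R (0 :: 'a, b))"
      using onb_sum[of "snd x"] by (simp add: sum_prod)
    also have "\<dots> \<in> span ?B" by (intro span_sum span_scale span_base) auto
    finally have 2: "(0, snd x) \<in> span ?B" .
    show ?thesis using span_add[OF 1 2] by simp
  qed
  moreover have "finite ?B" by simp
  ultimately show "\<exists>B::('a \<times> 'b) set. finite B \<and> (\<forall>x. \<exists>r. x = (\<Sum>b\<in>B. r b *\<^sub>R b))"
    using span_finite[of ?B] by (intro exI[of _ ?B] conjI allI) (simp_all add: set_eq_iff image_iff)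
qed

text \<open>A closed ball is a closed subset of a coordinate box over \<open>onb\<close>, and a box
  is compact as an iterated sum of segments. This makes the supports of bump functions
  compact.\<close>

lemma compact_cball_fin_dim: "compact (cball (x::'a::fin_dim) r)"
proof -
  have *: "compact {\<Sum>b\<in>B. c b *\<^sub>R b | c. \<forall>b\<in>B. \<bar>c b\<bar> \<le> C}" if "finite B" for B :: "'a set" and C
    using that
  proof (induction B rule: finite_induct)
    case empty
    then show ?case by simp
  next
    case (insert a B)
    let ?K = "{\<Sum>b\<in>B. c b *\<^sub>R b | c. \<forall>b\<in>B. \<bar>c b\<bar> \<le> C}" and ?L = "(\<lambda>t. t *\<^sub>R a) ` {-C..C}"
    have "compact ?L" by (intro compact_continuous_image continuous_intros) auto
    then have "compact {x + y | x y. x \<in> ?L \<and> y \<in> ?K}" using insert by (intro compact_sums)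
    moreover have "{x + y | x y. x \<in> ?L \<and> y \<in> ?K} =
       {\<Sum>b\<in>insert a B. c b *\<^sub>R b | c. \<forall>b\<in>insert a B. \<bar>c b\<bar> \<le> C}" (is "?X = ?Y")
    proof (intro antisym subsetI)
      fix z assume "z \<in> ?X"
      then obtain t c where t: "z = t *\<^sub>R a + (\<Sum>b\<in>B. c b *\<^sub>R b)" "\<bar>t\<bar> \<le> C" "\<forall>b\<in>B. \<bar>c b\<bar> \<le> C"
        by (auto simp: abs_le_iff)
      have "(\<Sum>b\<in>B. (c(a := t)) b *\<^sub>R b) = (\<Sum>b\<in>B. c b *\<^sub>R b)"
        using insert by (intro sum.cong) auto
      then have "z = (\<Sum>b\<in>insert a B. (c(a := t)) b *\<^sub>R b)" using insert t by simp
      moreover have "\<forall>b\<in>insert a B. \<bar>(c(a := t)) b\<bar> \<le> C" using t by simp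
      ultimately show "z \<in> ?Y" by blast
    next
      fix z assume "z \<in> ?Y"
      then obtain c where "z = (\<Sum>b\<in>insert a B. c b *\<^sub>R b)" "\<forall>b\<in>insert a B. \<bar>c b\<bar> \<le> C" by auto
      then have "z = c a *\<^sub>R a + (\<Sum>b\<in>B. c b *\<^sub>R b)" "c a \<in> {-C..C}" "\<forall>b\<in>B. \<bar>c b\<bar> \<le> C"
        using insert by (auto simp: abs_le_iff)
      then show "z \<in> ?X" by blast
    qed
    ultimately show ?case by simp
  qed
  have "cball (0::'a) r \<subseteq> {\<Sum>b\<in>onb. c b *\<^sub>R b | c. \<forall>b\<in>onb. \<bar>c b\<bar> \<le> r}"
  proof
    fix y :: 'a assume y: "y \<in> cball 0 r"
    have "\<bar>y \<bullet> b\<bar> \<le> r" if "b \<in> onb" for b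
      using Cauchy_Schwarz_ineq2[of y b] y that onb_props(3)[of b b] by (simp add: norm_eq_sqrt_inner[of b])
    then show "y \<in> {\<Sum>b\<in>onb. c b *\<^sub>R b | c. \<forall>b\<in>onb. \<bar>c b\<bar> \<le> r}"
      using onb_sum[of y] by (auto intro!: exI[of _ "\<lambda>b. y \<bullet> b"])
  qed
  then have "compact (cball (0::'a) r)"
    using compact_Int_closed[OF *[OF finite_onb, of r] closed_cball[of 0 r]] by (simp add: Int_absorb1)
  then have "compact ((+) x ` cball 0 r)" by (rule compact_translation)
  then show ?thesis by simp
qed

section \<open>Calculus of smooth functions\<close>

lemma Ck_on_mono: "Ck_on (Suc k) S f \<Longrightarrow> Ck_on k S f"
proof (induction k arbitrary: f)
  case 0
  then show ?case
    by (auto intro!: continuous_at_imp_continuous_on differentiable_imp_continuous_within)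
next
  case (Suc k)
  then show ?case by (metis Ck_on.simps(2))
qed

lemma Ck_on_subset: "Ck_on k S f \<Longrightarrow> T \<subseteq> S \<Longrightarrow> Ck_on k T f"
  by (induction k arbitrary: f) (simp_all add: continuous_on_subset subset_iff)

lemma Ck_on_cong:
  assumes "open S" "\<And>x. x \<in> S \<Longrightarrow> f x = g x" "Ck_on k S f"
  shows "Ck_on k S g"
  using assms(2,3)
proof (induction k arbitrary: f g)
  case 0
  then show ?case by (simp cong: continuous_on_cong)
next
  case (Suc k)
  have d: "(g has_derivative frechet_derivative f (at x)) (at x)" if "x \<in> S" for x
  proof (rule has_derivative_transform_within_open[OF _ assms(1) that])
    show "(f has_derivative frechet_derivative f (at x)) (at x)"
      using Suc.prems that by (simp add: frechet_derivative_works[symmetric])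
  qed (use Suc in auto)
  have "Ck_on k S (\<lambda>x. frechet_derivative g (at x) v)" for v
    by (rule Suc.IH[of "\<lambda>x. frechet_derivative f (at x) v"])
       (use Suc.prems d in \<open>auto simp: frechet_derivative_at[OF d, symmetric]\<close>)
  then show ?case using d by (auto simp: differentiable_def)
qed

lemma Ck_on_SucI:
  assumes "open S" "\<And>x. x \<in> S \<Longrightarrow> (f has_derivative f' x) (at x)"
    "\<And>v. Ck_on k S (\<lambda>x. f' x v)"
  shows "Ck_on (Suc k) S f"
proof -
  have "Ck_on k S (\<lambda>x. frechet_derivative f (at x) v)" for v
    by (rule Ck_on_cong[OF assms(1) _ assms(3)[of v]])
       (simp add: frechet_derivative_at[OF assms(2), symmetric])
  then show ?thesis using assms(2) by (auto simp: differentiable_def)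
qed

lemma Ck_on_SucD:
  assumes "Ck_on (Suc k) S f"
  shows "x \<in> S \<Longrightarrow> (f has_derivative frechet_derivative f (at x)) (at x)"
    "Ck_on k S (\<lambda>x. frechet_derivative f (at x) v)"
  using assms by (auto simp: frechet_derivative_works[symmetric])

lemma Ck_on_local:
  assumes "\<And>x. x \<in> S \<Longrightarrow> \<exists>U. open U \<and> x \<in> U \<and> Ck_on k U f"
  shows "Ck_on k S f"
  using assms
proof (induction k arbitrary: f)
  case 0
  show ?case unfolding Ck_on.simps
  proof (intro continuous_at_imp_continuous_on ballI)
    fix x assume "x \<in> S"
    then obtain U where "open U" "x \<in> U" "continuous_on U f" using 0 by auto
    then show "isCont f x" by (simp add: continuous_on_eq_continuous_at)
  qed
next
  case (Suc k)
  have "f differentiable at x" if "x \<in> S" for x using Suc.prems[OF that] by auto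
  moreover have "Ck_on k S (\<lambda>x. frechet_derivative f (at x) v)" for v
  proof (rule Suc.IH)
    fix x assume "x \<in> S"
    then obtain U where "open U" "x \<in> U" "Ck_on (Suc k) U f" using Suc.prems by blast
    then show "\<exists>U. open U \<and> x \<in> U \<and> Ck_on k U (\<lambda>x. frechet_derivative f (at x) v)"
      by (intro exI[of _ U]) simp
  qed
  ultimately show ?case by simp
qed

lemma Ck_on_const: "open S \<Longrightarrow> Ck_on k S (\<lambda>x. c)"
proof (induction k arbitrary: c)
  case (Suc k)
  show ?case by (rule Ck_on_SucI[where f' = "\<lambda>_ _. 0"]) (use Suc in simp_all)
qed simp

lemma Ck_on_add: "open S \<Longrightarrow> Ck_on k S f \<Longrightarrow> Ck_on k S g \<Longrightarrow> Ck_on k S (\<lambda>x. f x + g x)"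
proof (induction k arbitrary: f g)
  case (Suc k)
  show ?case
  proof (rule Ck_on_SucI[where f' = "\<lambda>x v. frechet_derivative f (at x) v + frechet_derivative g (at x) v"])
    fix x assume "x \<in> S"
    then show "((\<lambda>x. f x + g x) has_derivative (\<lambda>v. frechet_derivative f (at x) v + frechet_derivative g
        (at x) v)) (at x)"
      by (intro has_derivative_add Ck_on_SucD(1)[OF Suc.prems(2)] Ck_on_SucD(1)[OF Suc.prems(3)])
  qed (intro Suc.IH Ck_on_SucD(2) Suc.prems)+
qed (simp add: continuous_on_add)

lemma Ck_on_bounded_linear:
  "open S \<Longrightarrow> bounded_linear L \<Longrightarrow> Ck_on k S f \<Longrightarrow> Ck_on k S (\<lambda>x. L (f x))"
proof (induction k arbitrary: f)
  case 0
  then show ?case by (simp add: bounded_linear.continuous_on)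
next
  case (Suc k)
  show ?case
  proof (rule Ck_on_SucI[where f' = "\<lambda>x v. L (frechet_derivative f (at x) v)"])
    fix x assume "x \<in> S"
    then show "((\<lambda>x. L (f x)) has_derivative (\<lambda>v. L (frechet_derivative f (at x) v))) (at x)"
      by (intro bounded_linear.has_derivative[OF Suc.prems(2)] Ck_on_SucD(1)[OF Suc.prems(3)])
  qed (intro Suc.IH Ck_on_SucD(2) Suc.prems)+
qed

lemma Ck_on_linear: "open S \<Longrightarrow> bounded_linear L \<Longrightarrow> Ck_on k S L"
proof (cases k)
  case (Suc l)
  assume "open S" "bounded_linear L"
  then show ?thesis unfolding Suc
    by (intro Ck_on_SucI[where f' = "\<lambda>_. L"]) (auto intro: bounded_linear_imp_has_derivative Ck_on_const)
qed (auto simp: linear_continuous_on)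

lemma Ck_on_bilinear:
  assumes B: "bounded_bilinear B" and S: "open S"
  shows "Ck_on k S f \<Longrightarrow> Ck_on k S g \<Longrightarrow> Ck_on k S (\<lambda>x. B (f x) (g x))"
proof (induction k arbitrary: f g)
  case 0
  then show ?case by (simp add: bounded_bilinear.continuous_on[OF B])
next
  case (Suc k)
  show ?case
  proof (rule Ck_on_SucI[where f' = "\<lambda>x v. B (f x) (frechet_derivative g (at x) v) + B
      (frechet_derivative f (at x) v) (g x)"])
    fix x assume "x \<in> S"
    then show "((\<lambda>x. B (f x) (g x)) has_derivative 
      (\<lambda>v. B (f x) (frechet_derivative g (at x) v) + B (frechet_derivative f (at x) v) (g x))) (at x)"
      using Suc.prems by (intro bounded_bilinear.FDERIV[OF B] Ck_on_SucD(1)) auto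
  next
    fix v
    show "Ck_on k S (\<lambda>x. B (f x) (frechet_derivative g (at x) v) + B (frechet_derivative f (at x) v) (g x))"
      by (intro Ck_on_add Suc.IH S Ck_on_SucD(2) Suc.prems Ck_on_mono[OF Suc.prems(1)]
          Ck_on_mono[OF Suc.prems(2)])
  qed (rule S)
qed

lemma Ck_on_sum:
  assumes "open S" "\<And>i. i \<in> I \<Longrightarrow> Ck_on k S (f i)"
  shows "Ck_on k S (\<lambda>x. \<Sum>i\<in>I. f i x)"
  using assms(2)
  by (induction I rule: infinite_finite_induct) (simp_all add: Ck_on_const Ck_on_add assms(1))

text \<open>\<open>Ck_on\<close> speaks of derivatives in fixed directions, but the chain rule
  differentiates \<open>g\<close> in the moving direction \<open>?Df x v\<close>. Expanding that
  direction in \<open>onb\<close> leaves fixed directions with coefficients of class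
  \<open>Ck_on k\<close>; this is where the finite dimension of the intermediate space
  enters.\<close>

lemma Ck_on_comp:
  fixes f :: "'a::real_normed_vector \<Rightarrow> 'b::fin_dim" and g :: "'b \<Rightarrow> 'c::real_normed_vector"
  assumes "open S" "f ` S \<subseteq> T"
  shows "Ck_on k S f \<Longrightarrow> Ck_on k T g \<Longrightarrow> Ck_on k S (\<lambda>x. g (f x))"
proof (induction k arbitrary: g)
  case 0
  then show ?case using assms continuous_on_compose2[of T g S f] by simp
next
  case (Suc k)
  let ?Dg = "\<lambda>y. frechet_derivative g (at y)" and ?Df = "\<lambda>x. frechet_derivative f (at x)"
  have Dg: "(g has_derivative ?Dg (f x)) (at (f x))" if "x \<in> S" for x
    using Ck_on_SucD(1)[OF Suc.prems(2)] assms that by auto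
  show ?case
  proof (rule Ck_on_SucI[where f' = "\<lambda>x v. \<Sum>b\<in>onb. (?Df x v \<bullet> b) *\<^sub>R ?Dg (f x) b"])
    fix x assume x: "x \<in> S"
    have "((\<lambda>x. g (f x)) has_derivative (\<lambda>v. ?Dg (f x) (?Df x v))) (at x)"
      using diff_chain_at[OF Ck_on_SucD(1)[OF Suc.prems(1) x] Dg[OF x]] by (simp add: o_def)
    then show "((\<lambda>x. g (f x)) has_derivative (\<lambda>v. \<Sum>b\<in>onb. (?Df x v \<bullet> b) *\<^sub>R ?Dg (f x) b)) (at x)"
      by (simp only: linear_onb_sum[OF has_derivative_linear[OF Dg[OF x]], of "?Df x _"])
  next
    fix v
    show "Ck_on k S (\<lambda>x. \<Sum>b\<in>onb. (?Df x v \<bullet> b) *\<^sub>R ?Dg (f x) b)"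
    proof (intro Ck_on_sum assms Ck_on_bilinear[OF bounded_bilinear_scaleR])
      fix b :: 'b
      show "Ck_on k S (\<lambda>x. ?Df x v \<bullet> b)"
        by (intro Ck_on_bounded_linear[OF _ bounded_linear_inner_left] assms Ck_on_SucD(2) Suc.prems)
      show "Ck_on k S (\<lambda>x. ?Dg (f x) b)"
        by (rule Suc.IH[OF Ck_on_mono[OF Suc.prems(1)] Ck_on_SucD(2)[OF Suc.prems(2)]])
    qed
  qed (rule assms)
qed

lemma Ck_on_inverse: "Ck_on k {0<..} (inverse :: real \<Rightarrow> real)"
proof (induction k)
  case 0
  have "continuous_on {0<..} (\<lambda>x::real. inverse x)"
    by (rule continuous_on_inverse[OF continuous_on_id]) simp
  then show ?case by (simp only: Ck_on.simps)
next
  case (Suc k)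
  show ?case
  proof (rule Ck_on_SucI[where f' = "\<lambda>x v. - (inverse x * v * inverse x)"])
    show "Ck_on k {0<..} (\<lambda>x::real. - (inverse x * v * inverse x))" for v
    proof (rule Ck_on_bounded_linear[OF _ bounded_linear_minus[OF bounded_linear_ident]])
      show "Ck_on k {0<..} (\<lambda>x::real. inverse x * v * inverse x)"
        using Suc by (intro Ck_on_bilinear[OF bounded_bilinear_mult] Ck_on_const) auto
    qed simp
    fix x :: real assume "x \<in> {0<..}"
    then show "(inverse has_derivative (\<lambda>v. - (inverse x * v * inverse x))) (at x)"
      by (intro has_derivative_inverse') simp
  qed simp
qed

section \<open>The calculus rules for smooth functions\<close>

lemma smooth_on_subset: "smooth_on S f \<Longrightarrow> T \<subseteq> S \<Longrightarrow> smooth_on T f"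
  unfolding smooth_on_def using Ck_on_subset by blast

lemma smooth_on_cong: "open S \<Longrightarrow> (\<And>x. x \<in> S \<Longrightarrow> f x = g x) \<Longrightarrow> smooth_on S f \<Longrightarrow> smooth_on S g"
  unfolding smooth_on_def using Ck_on_cong by blast

lemma smooth_on_local:
  "(\<And>x. x \<in> S \<Longrightarrow> \<exists>U. open U \<and> x \<in> U \<and> smooth_on U f) \<Longrightarrow> smooth_on S f"
  unfolding smooth_on_def by (intro allI Ck_on_local) blast

lemma smooth_on_const: "open S \<Longrightarrow> smooth_on S (\<lambda>x. c)"
  unfolding smooth_on_def by (simp add: Ck_on_const)

lemma smooth_on_add: "open S \<Longrightarrow> smooth_on S f \<Longrightarrow> smooth_on S g \<Longrightarrow> smooth_on S (\<lambda>x. f x + g x)"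
  unfolding smooth_on_def by (simp add: Ck_on_add)

lemma smooth_on_linear: "open S \<Longrightarrow> bounded_linear L \<Longrightarrow> smooth_on S L"
  unfolding smooth_on_def by (simp add: Ck_on_linear)

lemma smooth_on_bounded_linear: "open S \<Longrightarrow> bounded_linear L \<Longrightarrow> smooth_on S f \<Longrightarrow> smooth_on S (\<lambda>x. L (f x))"
  unfolding smooth_on_def by (simp add: Ck_on_bounded_linear)

lemma smooth_on_bilinear:
  "bounded_bilinear B \<Longrightarrow> open S \<Longrightarrow> smooth_on S f \<Longrightarrow> smooth_on S g \<Longrightarrow> smooth_on S (\<lambda>x. B (f x) (g x))"
  unfolding smooth_on_def by (simp add: Ck_on_bilinear)

lemmas smooth_on_scaleR = smooth_on_bilinear[OF bounded_bilinear_scaleR]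
lemmas smooth_on_mult = smooth_on_bilinear[OF bounded_bilinear_mult]
lemmas smooth_on_inner = smooth_on_bilinear[OF bounded_bilinear_inner]

lemma smooth_on_sum: "open S \<Longrightarrow> (\<And>i. i \<in> I \<Longrightarrow> smooth_on S (f i)) \<Longrightarrow> smooth_on S (\<lambda>x. \<Sum>i\<in>I. f i x)"
  unfolding smooth_on_def by (simp add: Ck_on_sum)

lemma smooth_on_comp:
  fixes f :: "'a::real_normed_vector \<Rightarrow> 'b::fin_dim" and g :: "'b \<Rightarrow> 'c::real_normed_vector"
  shows "open S \<Longrightarrow> f ` S \<subseteq> T \<Longrightarrow> smooth_on S f \<Longrightarrow> smooth_on T g \<Longrightarrow> smooth_on S (\<lambda>x. g (f x))"
  unfolding smooth_on_def by (simp add: Ck_on_comp)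

lemma smooth_on_imp_continuous_on: "smooth_on S f \<Longrightarrow> continuous_on S f"
  unfolding smooth_on_def by (metis Ck_on.simps(1))

lemma smooth_on_imp_differentiable: "smooth_on S f \<Longrightarrow> x \<in> S \<Longrightarrow> f differentiable (at x)"
  unfolding smooth_on_def by (metis Ck_on.simps(2))

lemma smooth_on_has_derivative:
  "smooth_on S f \<Longrightarrow> x \<in> S \<Longrightarrow> (f has_derivative frechet_derivative f (at x)) (at x)"
  using smooth_on_imp_differentiable frechet_derivative_works by blast

lemma smooth_on_deriv: "smooth_on S f \<Longrightarrow> smooth_on S (\<lambda>x. frechet_derivative f (at x) v)"
  unfolding smooth_on_def by (metis Ck_on.simps(2))

text \<open>Base point and direction both vary, as they do when a function is differentiated along a
  vector field; as in the chain rule, the direction is expanded in \<open>onb\<close>.\<close>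

lemma smooth_on_deriv_comp:
  fixes u w :: "'a::real_normed_vector \<Rightarrow> 'b::fin_dim"
  assumes "open S" "u ` S \<subseteq> T" "smooth_on S u" "smooth_on S w" "smooth_on T f"
  shows "smooth_on S (\<lambda>x. frechet_derivative f (at (u x)) (w x))"
proof (rule smooth_on_cong[OF assms(1)])
  show "smooth_on S (\<lambda>x. \<Sum>b\<in>onb. (w x \<bullet> b) *\<^sub>R frechet_derivative f (at (u x)) b)"
    by (intro smooth_on_sum smooth_on_scaleR assms smooth_on_bounded_linear[OF _ bounded_linear_inner_left]
         smooth_on_comp[of S u T, OF _ _ _ smooth_on_deriv])
  fix x assume "x \<in> S"
  then have "linear (frechet_derivative f (at (u x)))"
    using assms by (intro has_derivative_linear[OF smooth_on_has_derivative]) auto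
  then show "(\<Sum>b\<in>onb. (w x \<bullet> b) *\<^sub>R frechet_derivative f (at (u x)) b) =
      frechet_derivative f (at (u x)) (w x)"
    using linear_onb_sum by metis
qed

lemma smooth_on_Pair:
  assumes "open S" "smooth_on S f" "smooth_on S g"
  shows "smooth_on S (\<lambda>x. (f x, g x))"
proof -
  have "smooth_on S (\<lambda>x. (f x, 0) + (0, g x))"
    by (intro smooth_on_add assms smooth_on_bounded_linear[of _ "\<lambda>x. (x, 0)"] smooth_on_bounded_linear[of _
        "\<lambda>x. (0, x)"]
       bounded_linear_Pair bounded_linear_ident bounded_linear_zero)
  then show ?thesis by simp
qed

text \<open>Up to linear combinations, the family \<open>flat n\<close> is closed under differentiation, so
  continuity of all its members at 0 yields smoothness.\<close>

definition flat :: "nat \<Rightarrow> real \<Rightarrow> real" where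
  "flat n t = (if t > 0 then inverse t ^ n * exp (- inverse t) else 0)"

lemma flat_tendsto_0: "(flat n \<longlongrightarrow> 0) (at 0)"
proof (rule filterlim_split_at)
  have "eventually (\<lambda>t::real. t < 0) (at_left 0)" by (simp add: eventually_at_filter)
  then have "eventually (\<lambda>t. 0 = flat n t) (at_left 0)" by eventually_elim (simp add: flat_def)
  then show "(flat n \<longlongrightarrow> 0) (at_left 0)" by (rule Lim_transform_eventually[OF tendsto_const])
  have "((\<lambda>t. inverse t ^ n / exp (inverse t)) \<longlongrightarrow> 0) (at_right (0::real))"
    by (rule filterlim_compose[OF tendsto_power_div_exp_0 filterlim_inverse_at_top_right])
  moreover have "eventually (\<lambda>t. inverse t ^ n / exp (inverse t) = flat n t) (at_right (0::real))"
    using eventually_at_right_less[of "0::real"]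
    by eventually_elim (simp add: flat_def exp_minus divide_inverse)
  ultimately show "(flat n \<longlongrightarrow> 0) (at_right 0)" by (rule Lim_transform_eventually)
qed

lemma flat_DERIV: "(flat n has_real_derivative (- real n * flat (n + 1) t + flat (n + 2) t)) (at t)"
proof -
  consider "t > 0" | "t < 0" | "t = 0" by linarith
  then show ?thesis
  proof cases
    case 1
    have "((\<lambda>t. inverse t ^ n * exp (- inverse t)) has_real_derivative
        (- real n * flat (n + 1) t + flat (n + 2) t)) (at t)"
      using 1 by (cases n) (auto intro!: derivative_eq_intros simp: flat_def power2_eq_square algebra_simps,
          metis power_eq_if One_nat_def)
    then show ?thesis
      by (rule has_field_derivative_transform_within_open[where S = "{0<..}"])
          (use 1 in \<open>auto simp: flat_def\<close>)
  next
    case 2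
    have "((\<lambda>t. 0) has_real_derivative (- real n * flat (n + 1) t + flat (n + 2) t)) (at t)"
      using 2 by (simp add: flat_def)
    then show ?thesis
      by (rule has_field_derivative_transform_within_open[where S = "{..<0}"])
          (use 2 in \<open>auto simp: flat_def\<close>)
  next
    case 3
    \<comment> \<open>Dividing by \<open>h\<close> raises the power of \<open>inverse h\<close> by
      one, so the difference quotient of \<open>flat n\<close> at 0 is \<open>flat (n + 1)\<close>
      itself.\<close>
    have "((\<lambda>h. (flat n (0 + h) - flat n 0) / h) \<longlongrightarrow> 0) (at 0)"
    proof (rule Lim_transform_eventually[OF flat_tendsto_0[of "n + 1"]])
      show "\<forall>\<^sub>F h in at 0. flat (n + 1) h = (flat n (0 + h) - flat n 0) / h"
        by (rule always_eventually) (simp add: flat_def divide_inverse mult_ac)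
    qed
    then show ?thesis unfolding 3 DERIV_def by (simp add: flat_def)
  qed
qed

lemma Ck_on_flat: "Ck_on k UNIV (flat n)"
proof (induction k arbitrary: n)
  case 0
  show ?case
    using flat_DERIV by (auto intro!: continuous_at_imp_continuous_on DERIV_isCont)
next
  case (Suc k)
  show ?case
  proof (rule Ck_on_SucI[where f' = "\<lambda>t v. (- real n * flat (n + 1) t + flat (n + 2) t) * v"])
    show "Ck_on k UNIV (\<lambda>t. (- real n * flat (n + 1) t + flat (n + 2) t) * v)" for v
      using Suc by (intro Ck_on_bilinear[OF bounded_bilinear_mult] Ck_on_add Ck_on_const) auto
    show "(flat n has_derivative (\<lambda>v. (- real n * flat (n + 1) t + flat (n + 2) t) * v)) (at t)" for t
      using flat_DERIV[of n t] by (simp add: has_field_derivative_def)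
  qed simp
qed

section \<open>Smooth step and bump functions\<close>

lemma smooth_step:
  obtains s :: "real \<Rightarrow> real" where "smooth_on UNIV s" "\<And>t. t \<le> 1 \<Longrightarrow> s t = 1" "\<And>t. t \<ge> 2 \<Longrightarrow> s t = 0"
proof
  \<comment> \<open>\<open>?a\<close> is positive exactly for \<open>t < 2\<close> and
    \<open>?b\<close> exactly for \<open>t > 1\<close>, so their sum has no zero, and the quotient
    \<open>?s\<close> is 1 where \<open>?b\<close> vanishes and 0 where \<open>?a\<close> does. The
    arguments are written as sums so that the rules for sums and linear maps apply.\<close>
  let ?a = "\<lambda>t::real. flat 0 (2 + - 1 * t)" and ?b = "\<lambda>t::real. flat 0 (t + (- 1))"
  let ?s = "\<lambda>t. ?a t * inverse (?a t + ?b t)"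
  have fl: "smooth_on UNIV (flat 0)" by (simp add: smooth_on_def Ck_on_flat)
  have bl: "bounded_linear ((*) (-1::real))" by (rule bounded_linear_mult_right)
  have aff: "smooth_on UNIV (\<lambda>t::real. 2 + - 1 * t)" "smooth_on UNIV (\<lambda>t::real. t + (- 1))"
    by (rule smooth_on_add[OF open_UNIV smooth_on_const[OF open_UNIV] smooth_on_linear[OF open_UNIV bl]],
      rule smooth_on_add[OF open_UNIV smooth_on_linear[OF open_UNIV bounded_linear_ident]
          smooth_on_const[OF open_UNIV]])
  have a: "smooth_on UNIV ?a" and b: "smooth_on UNIV ?b"
    using smooth_on_comp[OF open_UNIV subset_UNIV aff(1) fl] smooth_on_comp[OF open_UNIV subset_UNIV aff(2)
        fl]
    by simp_all
  have pos: "?a t + ?b t > 0" for t by (auto simp: flat_def intro: add_pos_pos)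
  show "smooth_on UNIV ?s"
  proof (rule smooth_on_mult[OF open_UNIV a smooth_on_comp[where T = "{0<..}"
    and g = inverse, OF open_UNIV _ smooth_on_add[OF open_UNIV a b]]])
    show "smooth_on {0<..} (inverse :: real \<Rightarrow> real)" by (simp add: smooth_on_def Ck_on_inverse)
    show "range (\<lambda>t. ?a t + ?b t) \<subseteq> {0<..}" using pos by blast
  qed
  show "?s t = 1" if "t \<le> 1" for t using that by (simp add: flat_def)
  show "?s t = 0" if "t \<ge> 2" for t using that by (simp add: flat_def)
qed

lemma smooth_bump:
  fixes x :: "'a::fin_dim"
  assumes "r > 0"
  obtains \<beta> :: "'a \<Rightarrow> real" where "smooth_on UNIV \<beta>" "\<And>y. y \<in> ball x r \<Longrightarrow> \<beta> y = 1"
    "\<And>y. y \<notin> cball x (2 * r) \<Longrightarrow> \<beta> y = 0"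
proof -
  obtain s :: "real \<Rightarrow> real" where s: "smooth_on UNIV s" "\<And>t. t \<le> 1 \<Longrightarrow> s t = 1" "\<And>t. t \<ge> 2 \<Longrightarrow> s t = 0"
    by (rule smooth_step, rule that)
  \<comment> \<open>The squared distance is smooth at \<open>x\<close> as well, where the norm is
    not. After scaling, it is at most 1 on the ball of radius \<open>r\<close> and at least 4
    outside the ball of radius \<open>2 * r\<close>, which is beyond the end 2 of the step.\<close>
  define q where "q y = inverse (r\<^sup>2) * ((y + (- x)) \<bullet> (y + (- x)))" for y
  have "smooth_on UNIV (\<lambda>y. y + (- x))"
    using smooth_on_linear[OF open_UNIV bounded_linear_ident]
    by (intro smooth_on_add smooth_on_const) simp_all
  then have "smooth_on UNIV q"
    unfolding q_def by (intro smooth_on_mult smooth_on_inner smooth_on_const) simp_all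
  then have 1: "smooth_on UNIV (\<lambda>y. s (q y))" by (intro smooth_on_comp[OF _ _ _ s(1)]) simp_all
  have q: "q y = (dist x y / r)\<^sup>2" for y
    by (simp add: q_def power2_norm_eq_inner[symmetric] dist_norm norm_minus_commute divide_inverse
          power_mult_distrib power_inverse mult.commute)
  have 2: "s (q y) = 1" if "y \<in> ball x r" for y
  proof (rule s(2))
    have "dist x y / r \<le> 1" using that assms by simp
    moreover have "0 \<le> dist x y / r" using assms by simp
    ultimately show "q y \<le> 1" unfolding q by (simp add: power_le_one)
  qed
  have 3: "s (q y) = 0" if "y \<notin> cball x (2 * r)" for y
  proof (rule s(3))
    have "2 \<le> dist x y / r" using that assms by (simp add: field_simps)
    then have "2\<^sup>2 \<le> (dist x y / r)\<^sup>2" by (intro power_mono) auto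
    then show "q y \<ge> 2" unfolding q by simp
  qed
  show ?thesis using that[OF 1 2 3] .
qed

section \<open>Symmetry of second derivatives\<close>

lemma DERIV_along_line:
  fixes f :: "'a::real_normed_vector \<Rightarrow> real"
  assumes "(f has_derivative D) (at (y + s *\<^sub>R u))"
  shows "((\<lambda>s. f (y + s *\<^sub>R u)) has_real_derivative D u) (at s)"
proof -
  have "((\<lambda>s. y + s *\<^sub>R u) has_derivative (\<lambda>t. t *\<^sub>R u)) (at s)"
    by (auto intro!: derivative_eq_intros)
  from diff_chain_at[OF this assms] have "((\<lambda>s. f (y + s *\<^sub>R u)) has_derivative (\<lambda>t. D (t *\<^sub>R u))) (at s)"
    by (simp add: o_def)
  moreover have "D (t *\<^sub>R u) = D u * t" for t
    using linear_scale[OF has_derivative_linear[OF assms]] by simp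
  ultimately show ?thesis by (simp add: has_field_derivative_def)
qed

text \<open>The mean value theorem applied twice: to the increment in direction \<open>v\<close> as
  a function of the position along \<open>u\<close>, then to the resulting derivative along
  \<open>v\<close>. The left side of the equation is symmetric in \<open>u\<close> and
  \<open>v\<close>, and that is its use.\<close>

lemma second_difference:
  fixes f :: "'a::real_normed_vector \<Rightarrow> real"
  assumes S: "smooth_on S f" and h: "h > 0"
    and sub: "\<And>s t. 0 \<le> s \<Longrightarrow> s \<le> h \<Longrightarrow> 0 \<le> t \<Longrightarrow> t \<le> h \<Longrightarrow> x + s *\<^sub>R u + t *\<^sub>R v \<in> S"
  shows "\<exists>s t. 0 \<le> s \<and> s \<le> h \<and> 0 \<le> t \<and> t \<le> h \<and>
    f (x + h *\<^sub>R u + h *\<^sub>R v) - f (x + h *\<^sub>R u) - f (x + h *\<^sub>R v) + f x =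
    h * h * frechet_derivative (\<lambda>y. frechet_derivative f (at y) u) (at (x + s *\<^sub>R u + t *\<^sub>R v)) v"
proof -
  let ?D = "\<lambda>y. frechet_derivative f (at y)"
  let ?A = "\<lambda>y. frechet_derivative (\<lambda>y. ?D y u) (at y) v"
  define G where "G s = f (x + s *\<^sub>R u + h *\<^sub>R v) - f (x + s *\<^sub>R u)" for s
  have G: "(G has_real_derivative (?D (x + s *\<^sub>R u + h *\<^sub>R v) u - ?D (x + s *\<^sub>R u) u)) (at s)"
    if "0 \<le> s" "s \<le> h" for s
  proof -
    have 1: "((\<lambda>s. f ((x + h *\<^sub>R v) + s *\<^sub>R u)) has_real_derivative ?D ((x + h *\<^sub>R v) + s *\<^sub>R u) u) (at s)"
      using sub[of s h] that h
      by (intro DERIV_along_line smooth_on_has_derivative[OF S]) (simp add: ac_simps)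
    have 2: "((\<lambda>s. f (x + s *\<^sub>R u)) has_real_derivative ?D (x + s *\<^sub>R u) u) (at s)"
      using sub[of s 0] that h by (intro DERIV_along_line smooth_on_has_derivative[OF S]) simp
    show ?thesis using DERIV_diff[OF 1 2] by (simp add: G_def[abs_def] ac_simps)
  qed
  obtain s where s: "0 < s" "s < h" "G h - G 0 =
      (h - 0) * (?D (x + s *\<^sub>R u + h *\<^sub>R v) u - ?D (x + s *\<^sub>R u) u)"
    using MVT2[OF h, of G "\<lambda>s. ?D (x + s *\<^sub>R u + h *\<^sub>R v) u - ?D (x + s *\<^sub>R u) u"] G by blast
  have H: "((\<lambda>t. ?D (x + s *\<^sub>R u + t *\<^sub>R v) u) has_real_derivative ?A (x + s *\<^sub>R u + t *\<^sub>R v)) (at t)"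
    if "0 \<le> t" "t \<le> h" for t
    using sub[of s t] that s
    by (intro DERIV_along_line smooth_on_has_derivative[OF smooth_on_deriv[OF S]]) simp
  obtain t where t: "0 < t" "t < h"
    "?D (x + s *\<^sub>R u + h *\<^sub>R v) u - ?D (x + s *\<^sub>R u + 0 *\<^sub>R v) u = (h - 0) * ?A (x + s *\<^sub>R u + t *\<^sub>R v)"
    using MVT2[OF h, of "\<lambda>t. ?D (x + s *\<^sub>R u + t *\<^sub>R v) u" "\<lambda>t. ?A (x + s *\<^sub>R u + t *\<^sub>R v)"] H by blast
  have "G h - G 0 = h * h * ?A (x + s *\<^sub>R u + t *\<^sub>R v)" using s t by simp
  then show ?thesis using s t by (intro exI[of _ s] exI[of _ t]) (simp add: G_def)
qed

text \<open>Evaluating the symmetric second difference in both orders shows that the two mixed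
  derivatives agree at two points which may differ but both lie close to \<open>x\<close>;
  continuity then excludes a gap at \<open>x\<close>.\<close>

lemma second_derivative_symmetric_real:
  fixes f :: "'a::real_normed_vector \<Rightarrow> real"
  assumes S: "open S" "smooth_on S f" "x \<in> S"
  shows "frechet_derivative (\<lambda>y. frechet_derivative f (at y) u) (at x) v =
         frechet_derivative (\<lambda>y. frechet_derivative f (at y) v) (at x) u"
proof (rule ccontr)
  let ?A = "\<lambda>u v y. frechet_derivative (\<lambda>y. frechet_derivative f (at y) u) (at y) v"
  assume "?A u v x \<noteq> ?A v u x"
  \<comment> \<open>Half the gap: two errors below \<open>e\<close> cannot bridge it.\<close>
  define e where "e = \<bar>?A u v x - ?A v u x\<bar> / 2"
  have e: "e > 0" using \<open>?A u v x \<noteq> ?A v u x\<close> by (simp add: e_def)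
  have "\<exists>d>0. \<forall>y. dist y x < d \<longrightarrow> \<bar>?A u v y - ?A u v x\<bar> < e" for u v
  proof -
    have "continuous_on S (?A u v)"
      by (intro smooth_on_imp_continuous_on smooth_on_deriv S)
    then have "isCont (?A u v) x" using S by (simp add: continuous_on_eq_continuous_at)
    then show ?thesis using e unfolding continuous_at by (auto simp: LIM_def dist_real_def) 
        (metis abs_zero cancel_comm_monoid_add_class.diff_cancel e)
  qed
  then obtain d1 d2 where d: "d1 > 0" "d2 > 0"
    "\<And>y. dist y x < d1 \<Longrightarrow> \<bar>?A u v y - ?A u v x\<bar> < e"
    "\<And>y. dist y x < d2 \<Longrightarrow> \<bar>?A v u y - ?A v u x\<bar> < e" by metis
  obtain d3 where d3: "d3 > 0" "ball x d3 \<subseteq> S" using S by (auto simp: open_contains_ball)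
  define d where "d = min (min d1 d2) d3"
  \<comment> \<open>The parallelogram with sides \<open>h *\<^sub>R u\<close> and
    \<open>h *\<^sub>R v\<close> then stays within distance \<open>d\<close> of \<open>x\<close>;
    the summand 1 covers the case \<open>u = v = 0\<close>.\<close>
  define h where "h = d / (2 * (norm u + norm v + 1))"
  have dpos: "d > 0" using d d3 by (simp add: d_def)
  have h: "h > 0" unfolding h_def using dpos by (simp add: add_nonneg_pos)
  have near: "dist (x + s *\<^sub>R u + t *\<^sub>R v) x < d" if "0 \<le> s" "s \<le> h" "0 \<le> t" "t \<le> h" for s t
  proof -
    have "dist (x + s *\<^sub>R u + t *\<^sub>R v) x \<le> s * norm u + t * norm v"
      using norm_triangle_ineq[of "s *\<^sub>R u" "t *\<^sub>R v"] that by (simp add: dist_norm add.assoc)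
    also have "\<dots> \<le> h * norm u + h * norm v" using that by (intro add_mono mult_right_mono) auto
    also have "\<dots> = h * (norm u + norm v)" by (simp add: algebra_simps)
    also have "\<dots> < h * (2 * (norm u + norm v + 1))" using h
      by (intro mult_strict_left_mono) (auto intro: add_nonneg_pos add_nonneg_nonneg, smt (verit)
        norm_ge_zero)
    also have "\<dots> = d" unfolding h_def using norm_ge_zero[of u] norm_ge_zero[of v]
      by (simp add: field_simps add_nonneg_eq_0_iff) 
    finally show ?thesis .
  qed
  have near': "dist (x + s *\<^sub>R v + t *\<^sub>R u) x < d" if "0 \<le> s" "s \<le> h" "0 \<le> t" "t \<le> h" for s t
    using near[of t s] that by (simp add: ac_simps)
  obtain s t where st: "0 \<le> s" "s \<le> h" "0 \<le> t" "t \<le> h"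
    "f (x + h *\<^sub>R u + h *\<^sub>R v) - f (x + h *\<^sub>R u) - f (x + h *\<^sub>R v) + f x =
        h * h * ?A u v (x + s *\<^sub>R u + t *\<^sub>R v)"
    using second_difference[OF S(2) h, of x u v] near d3 by (auto simp: d_def dist_commute subset_iff)
  obtain s' t' where st': "0 \<le> s'" "s' \<le> h" "0 \<le> t'" "t' \<le> h"
    "f (x + h *\<^sub>R v + h *\<^sub>R u) - f (x + h *\<^sub>R v) - f (x + h *\<^sub>R u) + f x =
        h * h * ?A v u (x + s' *\<^sub>R v + t' *\<^sub>R u)"
    using second_difference[OF S(2) h, of x v u] near' d3 by (auto simp: d_def dist_commute subset_iff)
  have "h * h * ?A u v (x + s *\<^sub>R u + t *\<^sub>R v) = h * h * ?A v u (x + s' *\<^sub>R v + t' *\<^sub>R u)"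
    using st(5) st'(5) by (simp add: algebra_simps)
  then have "?A u v (x + s *\<^sub>R u + t *\<^sub>R v) = ?A v u (x + s' *\<^sub>R v + t' *\<^sub>R u)" using h by simp
  moreover have "\<bar>?A u v (x + s *\<^sub>R u + t *\<^sub>R v) - ?A u v x\<bar> < e"
    using near[OF st(1-4)] by (intro d) (simp add: d_def)
  moreover have "\<bar>?A v u (x + s' *\<^sub>R v + t' *\<^sub>R u) - ?A v u x\<bar> < e"
    using near'[OF st'(1-4)] by (intro d) (simp add: d_def)
  ultimately have "\<bar>?A u v x - ?A v u x\<bar> < 2 * e" by linarith
  then show False by (simp add: e_def)
qed

lemma second_derivative_symmetric:
  fixes f :: "'a::real_normed_vector \<Rightarrow> 'b::fin_dim"
  assumes S: "open S" "smooth_on S f" "x \<in> S"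
  shows "frechet_derivative (\<lambda>y. frechet_derivative f (at y) u) (at x) v =
         frechet_derivative (\<lambda>y. frechet_derivative f (at y) v) (at x) u"
proof -
  let ?D = "\<lambda>y. frechet_derivative f (at y)"
  have *: "frechet_derivative (\<lambda>y. frechet_derivative (\<lambda>z. f z \<bullet> w) (at y) u) (at x) v = 
      frechet_derivative (\<lambda>y. ?D y u) (at x) v \<bullet> w" for u v w
  proof -
    have 1: "frechet_derivative (\<lambda>z. f z \<bullet> w) (at y) = (\<lambda>u. ?D y u \<bullet> w)" if "y \<in> S" for y
      using smooth_on_has_derivative[OF S(2) that]
      by (intro frechet_derivative_at[symmetric]
          bounded_linear.has_derivative[OF bounded_linear_inner_left])
    have "((\<lambda>y. ?D y u \<bullet> w) has_derivative (\<lambda>v. frechet_derivative (\<lambda>y. ?D y u) (at x) v \<bullet> w)) (at x)"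
      by (intro bounded_linear.has_derivative[OF bounded_linear_inner_left]
          smooth_on_has_derivative[OF smooth_on_deriv[OF S(2)]] S)
    then have "((\<lambda>y. frechet_derivative (\<lambda>z. f z \<bullet> w) (at y) u) has_derivative
        (\<lambda>v. frechet_derivative (\<lambda>y. ?D y u) (at x) v \<bullet> w)) (at x)"
      by (rule has_derivative_transform_within_open[OF _ S(1) S(3)]) (simp add: 1)
    then show ?thesis by (simp add: frechet_derivative_at[symmetric])
  qed
  have "smooth_on S (\<lambda>z. f z \<bullet> w)" for w
    by (intro smooth_on_bounded_linear[OF _ bounded_linear_inner_left] S)
  then have "frechet_derivative (\<lambda>y. ?D y u) (at x) v \<bullet> w = frechet_derivative (\<lambda>y. ?D y v) (at x) u \<bullet> w"
    for w
    using second_derivative_symmetric_real[OF S(1) _ S(3), of "\<lambda>z. f z \<bullet> w"] by (simp only: *)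
  then show ?thesis by (metis vector_eq_rdot)
qed

section \<open>Germs of smooth functions\<close>

text \<open>Working with germs absorbs the domains of charts, maps and composites into unspecified
  neighbourhoods.\<close>

definition smooth_at :: "'a::real_normed_vector \<Rightarrow> ('a \<Rightarrow> 'b::real_normed_vector) \<Rightarrow> bool" where
  "smooth_at x f \<longleftrightarrow> (\<exists>V. open V \<and> x \<in> V \<and> smooth_on V f)"

lemma smooth_atI: "open V \<Longrightarrow> x \<in> V \<Longrightarrow> smooth_on V f \<Longrightarrow> smooth_at x f"
  unfolding smooth_at_def by blast

lemma smooth_on_iff_smooth_at: "open S \<Longrightarrow> smooth_on S f \<longleftrightarrow> (\<forall>x\<in>S. smooth_at x f)"
  unfolding smooth_at_def by (meson smooth_on_local)

lemma smooth_at_cong: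
  assumes "\<forall>\<^sub>F y in nhds x. f y = g y" "smooth_at x f"
  shows "smooth_at x g"
proof -
  obtain U where U: "open U" "x \<in> U" "\<And>y. y \<in> U \<Longrightarrow> f y = g y"
    using assms(1) by (auto simp: eventually_nhds)
  obtain V where V: "open V" "x \<in> V" "smooth_on V f" using assms(2) by (auto simp: smooth_at_def)
  have "smooth_on (V \<inter> U) g"
    by (rule smooth_on_cong[OF _ _ smooth_on_subset[OF V(3)]]) (use U V in auto)
  then show ?thesis using U V by (intro smooth_atI[of "V \<inter> U"]) auto
qed

lemma smooth_at_2:
  assumes "smooth_at x f" "smooth_at x g"
  obtains V where "open V" "x \<in> V" "smooth_on V f" "smooth_on V g"
proof -
  obtain U where U: "open U" "x \<in> U" "smooth_on U f" using assms(1) by (auto simp: smooth_at_def)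
  obtain V where V: "open V" "x \<in> V" "smooth_on V g" using assms(2) by (auto simp: smooth_at_def)
  show ?thesis
    by (rule that[of "U \<inter> V"]) (use U V in \<open>auto intro: smooth_on_subset\<close>)
qed

lemma smooth_at_const: "smooth_at x (\<lambda>x. c)"
  by (rule smooth_atI[OF open_UNIV _ smooth_on_const]) auto

lemma smooth_at_linear: "bounded_linear L \<Longrightarrow> smooth_at x L"
  by (rule smooth_atI[OF open_UNIV _ smooth_on_linear]) auto

lemma smooth_at_add: "smooth_at x f \<Longrightarrow> smooth_at x g \<Longrightarrow> smooth_at x (\<lambda>x. f x + g x)"
  by (erule smooth_at_2, assumption) (rule smooth_atI, auto intro: smooth_on_add)

lemma smooth_at_bounded_linear: "bounded_linear L \<Longrightarrow> smooth_at x f \<Longrightarrow> smooth_at x (\<lambda>x. L (f x))"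
  unfolding smooth_at_def using smooth_on_bounded_linear by blast

lemma smooth_at_bilinear:
  "bounded_bilinear B \<Longrightarrow> smooth_at x f \<Longrightarrow> smooth_at x g \<Longrightarrow> smooth_at x (\<lambda>x. B (f x) (g x))"
  by (erule smooth_at_2, assumption) (rule smooth_atI, auto intro: smooth_on_bilinear)

lemma smooth_at_Pair: "smooth_at x f \<Longrightarrow> smooth_at x g \<Longrightarrow> smooth_at x (\<lambda>x. (f x, g x))"
  by (erule smooth_at_2, assumption) (rule smooth_atI, auto intro: smooth_on_Pair)

lemma smooth_at_imp_differentiable: "smooth_at x f \<Longrightarrow> f differentiable (at x)"
  unfolding smooth_at_def using smooth_on_imp_differentiable by blast

lemma smooth_at_eventually: "smooth_at x f \<Longrightarrow> \<forall>\<^sub>F y in nhds x. smooth_at y f"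
  unfolding smooth_at_def eventually_nhds by blast

lemma smooth_at_comp_set:
  fixes f :: "'a::real_normed_vector \<Rightarrow> 'b::real_normed_vector"
  assumes "smooth_at x f" "open W" "f x \<in> W"
  obtains V where "open V" "x \<in> V" "smooth_on V f" "f ` V \<subseteq> W"
proof -
  obtain V where V: "open V" "x \<in> V" "smooth_on V f" using assms(1) by (auto simp: smooth_at_def)
  have "open (V \<inter> f -` W)"
    using smooth_on_imp_continuous_on[OF V(3)] V(1) assms(2) by (rule continuous_open_preimage)
  then show ?thesis
    by (rule that) (use V assms in \<open>auto intro: smooth_on_subset\<close>)
qed

lemma smooth_at_comp:
  fixes f :: "'a::real_normed_vector \<Rightarrow> 'b::fin_dim" and g :: "'b \<Rightarrow> 'c::real_normed_vector"
  assumes "smooth_at x f" "smooth_at (f x) g"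
  shows "smooth_at x (\<lambda>y. g (f y))"
proof -
  obtain W where W: "open W" "f x \<in> W" "smooth_on W g" using assms(2) by (auto simp: smooth_at_def)
  from smooth_at_comp_set[OF assms(1) W(1,2)] obtain V where
    V: "open V" "x \<in> V" "smooth_on V f" "f ` V \<subseteq> W" .
  show ?thesis by (rule smooth_atI[OF V(1,2) smooth_on_comp[OF V(1,4,3) W(3)]])
qed

lemma smooth_at_deriv_comp:
  fixes u w :: "'a::real_normed_vector \<Rightarrow> 'b::fin_dim"
  assumes "smooth_at x u" "smooth_at x w" "smooth_at (u x) f"
  shows "smooth_at x (\<lambda>x. frechet_derivative f (at (u x)) (w x))"
proof -
  obtain W where W: "open W" "u x \<in> W" "smooth_on W f" using assms(3) by (auto simp: smooth_at_def)
  from smooth_at_comp_set[OF assms(1) W(1,2)] obtain V where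
    V: "open V" "x \<in> V" "smooth_on V u" "u ` V \<subseteq> W" .
  obtain V' where V': "open V'" "x \<in> V'" "smooth_on V' w" using assms(2) by (auto simp: smooth_at_def)
  have "smooth_on (V \<inter> V') (\<lambda>x. frechet_derivative f (at (u x)) (w x))"
    by (rule smooth_on_deriv_comp[OF _ _ smooth_on_subset[OF V(3)] smooth_on_subset[OF V'(3)] W(3)])
       (use V V' in auto)
  then show ?thesis using V V' by (intro smooth_atI[of "V \<inter> V'"]) auto
qed

section \<open>Charts\<close>

lemma chartD:
  assumes "smooth_manifold A" "c \<in> A"
  shows "open (fst c)" "open (snd c ` fst c)" "continuous_on (fst c) (snd c)"
    "continuous_on (snd c ` fst c) (chart_inv c)"
    "p \<in> fst c \<Longrightarrow> chart_inv c (snd c p) = p"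
    "x \<in> snd c ` fst c \<Longrightarrow> snd c (chart_inv c x) = x"
    "x \<in> snd c ` fst c \<Longrightarrow> chart_inv c x \<in> fst c"
proof -
  have "open (fst c) \<and> open (snd c ` fst c) \<and> homeomorphism (fst c) (snd c ` fst c) (snd c) (chart_inv c)"
    using assms by (auto simp: smooth_manifold_def)
  then show "open (fst c)" "open (snd c ` fst c)" "continuous_on (fst c) (snd c)"
    "continuous_on (snd c ` fst c) (chart_inv c)"
    "p \<in> fst c \<Longrightarrow> chart_inv c (snd c p) = p"
    "x \<in> snd c ` fst c \<Longrightarrow> snd c (chart_inv c x) = x"
    "x \<in> snd c ` fst c \<Longrightarrow> chart_inv c x \<in> fst c"
    by (auto simp: homeomorphism_def)
qed

lemma chart_at_props:
  assumes "smooth_manifold A"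
  shows "chart_at A p \<in> A" "p \<in> fst (chart_at A p)"
proof -
  have "p \<in> (\<Union>c\<in>A. fst c)" using assms by (simp add: smooth_manifold_def)
  then have "\<exists>c. c \<in> A \<and> p \<in> fst c" by blast
  from someI_ex[OF this] show "chart_at A p \<in> A" "p \<in> fst (chart_at A p)"
    by (auto simp: chart_at_def)
qed

lemma chart_eventually:
  assumes "smooth_manifold A" "c \<in> A" "p \<in> fst c"
  shows "\<forall>\<^sub>F q in nhds p. q \<in> fst c"
    "\<forall>\<^sub>F x in nhds (snd c p). x \<in> snd c ` fst c"
    "(\<forall>\<^sub>F q in nhds p. Q q) \<Longrightarrow> (\<forall>\<^sub>F x in nhds (snd c p). Q (chart_inv c x))"
    "(\<forall>\<^sub>F x in nhds (snd c p). R x) \<Longrightarrow> (\<forall>\<^sub>F q in nhds p. R (snd c q))"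
    "(\<forall>\<^sub>F x in nhds (snd c p). Q (chart_inv c x)) \<Longrightarrow> (\<forall>\<^sub>F q in nhds p. Q q)"
proof -
  note c = chartD[OF assms(1,2)]
  show in_c: "\<forall>\<^sub>F q in nhds p. q \<in> fst c" using c(1) assms(3) by (auto intro: eventually_nhds_in_open)
  show "\<forall>\<^sub>F x in nhds (snd c p). x \<in> snd c ` fst c"
    using c(2) assms(3) by (auto intro: eventually_nhds_in_open)
  have "isCont (snd c) p" using c(1,3) assms(3) by (simp add: continuous_on_eq_continuous_at)
  then have 1: "filterlim (snd c) (nhds (snd c p)) (nhds p)"
    by (simp add: isCont_def tendsto_at_iff_tendsto_nhds)
  have "isCont (chart_inv c) (snd c p)" using c(2,4) assms(3) by (simp add: continuous_on_eq_continuous_at)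
  then have 2: "filterlim (chart_inv c) (nhds p) (nhds (snd c p))"
    using c(5)[OF assms(3)] tendsto_at_iff_tendsto_nhds[of "chart_inv c" "snd c p"]
    by (simp add: isCont_def)
  show "(\<forall>\<^sub>F q in nhds p. Q q) \<Longrightarrow> (\<forall>\<^sub>F x in nhds (snd c p). Q (chart_inv c x))"
    using 2 by (simp add: filterlim_iff)
  show 3: "(\<forall>\<^sub>F x in nhds (snd c p). R x) \<Longrightarrow> (\<forall>\<^sub>F q in nhds p. R (snd c q))" for R
    using 1 by (simp add: filterlim_iff)
  assume "\<forall>\<^sub>F x in nhds (snd c p). Q (chart_inv c x)"
  from 3[OF this] in_c show "\<forall>\<^sub>F q in nhds p. Q q"
    by eventually_elim (simp add: c)
qed

lemma open_chart_image:
  assumes "smooth_manifold A" "c \<in> A" "open U" "U \<subseteq> fst c"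
  shows "open (snd c ` U)"
proof -
  note c = chartD[OF assms(1,2)]
  have "snd c ` U = snd c ` fst c \<inter> chart_inv c -` U"
  proof (intro antisym subsetI)
    fix x assume "x \<in> snd c ` U"
    then show "x \<in> snd c ` fst c \<inter> chart_inv c -` U" using assms(4) c(5) by auto
  next
    fix x assume "x \<in> snd c ` fst c \<inter> chart_inv c -` U"
    then have "snd c (chart_inv c x) = x" "chart_inv c x \<in> U" using c(6) by auto
    then show "x \<in> snd c ` U" by (metis imageI)
  qed
  then show ?thesis using c assms(3) by (simp add: continuous_open_preimage)
qed

lemma transition_smooth_at:
  assumes "smooth_manifold A" "c \<in> A" "d \<in> A" "p \<in> fst c" "p \<in> fst d"
  shows "smooth_at (snd c p) (snd d \<circ> chart_inv c)"
proof (rule smooth_atI)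
  show "smooth_on (snd c ` (fst c \<inter> fst d)) (snd d \<circ> chart_inv c)"
    using assms by (auto simp: smooth_manifold_def)
  show "open (snd c ` (fst c \<inter> fst d))"
    using chartD(1)[OF assms(1,2)] chartD(1)[OF assms(1,3)] by (intro open_chart_image[OF assms(1,2)]) auto
  show "snd c p \<in> snd c ` (fst c \<inter> fst d)" using assms by auto
qed

lemma change_chart_eventually:
  assumes "smooth_manifold A" "c \<in> A" "d \<in> A" "p \<in> fst c" "p \<in> fst d"
  shows "\<forall>\<^sub>F x in nhds (snd d p). (f \<circ> chart_inv c) ((snd c \<circ> chart_inv d) x) = (f \<circ> chart_inv d) x"
proof -
  have "\<forall>\<^sub>F q in nhds p. q \<in> fst c" by (rule chart_eventually[OF assms(1,2,4)])
  from chart_eventually(3)[OF assms(1,3,5) this] show ?thesis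
    by eventually_elim (simp add: chartD(5)[OF assms(1,2)])
qed

section \<open>Functions on manifolds\<close>

definition mdiff :: "('a, 'e::real_normed_vector) chart set \<Rightarrow> 'a \<Rightarrow> ('a \<Rightarrow> 'v::real_normed_vector) \<Rightarrow> bool"
    where
  "mdiff A p f \<longleftrightarrow> (\<forall>c\<in>A. p \<in> fst c \<longrightarrow> (f \<circ> chart_inv c) differentiable (at (snd c p)))"

definition msmooth :: "('a, 'e::real_normed_vector) chart set \<Rightarrow> 'a \<Rightarrow> ('a \<Rightarrow> 'v::real_normed_vector) \<Rightarrow> bool"
    where
  "msmooth A p f \<longleftrightarrow> (\<forall>c\<in>A. p \<in> fst c \<longrightarrow> smooth_at (snd c p) (f \<circ> chart_inv c))"

lemma has_derivative_cong_nhds: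
  assumes "(f has_derivative L) (at x)" "\<forall>\<^sub>F y in nhds x. f y = g y"
  shows "(g has_derivative L) (at x)"
proof -
  obtain U where U: "open U" "x \<in> U" "\<And>y. y \<in> U \<Longrightarrow> f y = g y"
    using assms(2) by (auto simp: eventually_nhds)
  show ?thesis by (rule has_derivative_transform_within_open[OF assms(1) U])
qed

text \<open>The chain rule for the transition map. It lets \<open>mdiffI\<close> test a single chart
  and underlies the chart independence of \<open>dir_deriv\<close>.\<close>

lemma change_chart_derivative:
  assumes "smooth_manifold A" "c \<in> A" "d \<in> A" "p \<in> fst c" "p \<in> fst d"
    and "((f \<circ> chart_inv c) has_derivative L) (at (snd c p))"
  shows "((f \<circ> chart_inv d) has_derivative
     (\<lambda>w. L (frechet_derivative (snd c \<circ> chart_inv d) (at (snd d p)) w))) (at (snd d p))"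
proof -
  have "(snd c \<circ> chart_inv d) differentiable (at (snd d p))"
    by (rule smooth_at_imp_differentiable[OF transition_smooth_at[OF assms(1,3,2,5,4)]])
  then have 1: "((snd c \<circ> chart_inv d) has_derivative frechet_derivative (snd c \<circ> chart_inv d)
      (at (snd d p))) (at (snd d p))"
    by (simp add: frechet_derivative_works[symmetric])
  have "(snd c \<circ> chart_inv d) (snd d p) = snd c p" using chartD(5)[OF assms(1,3,5)] by simp
  then have "((f \<circ> chart_inv c) has_derivative L) (at ((snd c \<circ> chart_inv d) (snd d p)))"
    using assms(6) by simp
  from diff_chain_at[OF 1 this] have
    "((\<lambda>x. (f \<circ> chart_inv c) ((snd c \<circ> chart_inv d) x)) has_derivative
     (\<lambda>w. L (frechet_derivative (snd c \<circ> chart_inv d) (at (snd d p)) w))) (at (snd d p))"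
    by (simp add: o_def)
  from has_derivative_cong_nhds[OF this change_chart_eventually[OF assms(1-5)]] show ?thesis .
qed

lemma mdiffI:
  assumes "smooth_manifold A" "c \<in> A" "p \<in> fst c" "(f \<circ> chart_inv c) differentiable (at (snd c p))"
  shows "mdiff A p f"
  unfolding mdiff_def
proof (intro ballI impI)
  fix d assume d: "d \<in> A" "p \<in> fst d"
  obtain L where "((f \<circ> chart_inv c) has_derivative L) (at (snd c p))"
    using assms(4) by (auto simp: differentiable_def)
  from change_chart_derivative[OF assms(1,2) d(1) assms(3) d(2) this]
  show "(f \<circ> chart_inv d) differentiable (at (snd d p))" by (auto simp: differentiable_def)
qed

lemma msmoothI:
  assumes "smooth_manifold A" "c \<in> A" "p \<in> fst c" "smooth_at (snd c p) (f \<circ> chart_inv c)"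
  shows "msmooth A p f"
  unfolding msmooth_def
proof (intro ballI impI)
  fix d assume d: "d \<in> A" "p \<in> fst d"
  have "(snd c \<circ> chart_inv d) (snd d p) = snd c p" using chartD(5)[OF assms(1) d] by simp
  then have "smooth_at (snd d p) (\<lambda>x. (f \<circ> chart_inv c) ((snd c \<circ> chart_inv d) x))"
    by (intro smooth_at_comp[OF transition_smooth_at[OF assms(1) d(1) assms(2) d(2) assms(3)]])
        (simp only: assms(4))
  from smooth_at_cong[OF change_chart_eventually[OF assms(1,2) d(1) assms(3) d(2)] this]
  show "smooth_at (snd d p) (f \<circ> chart_inv d)" .
qed

lemma msmooth_imp_mdiff: "msmooth A p f \<Longrightarrow> mdiff A p f"
  by (simp add: msmooth_def mdiff_def smooth_at_imp_differentiable)

lemma mdiffD: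
  assumes "mdiff A p f" "c \<in> A" "p \<in> fst c"
  shows "((f \<circ> chart_inv c) has_derivative frechet_derivative (f \<circ> chart_inv c) (at (snd c p)))
      (at (snd c p))"
  using assms by (simp add: mdiff_def frechet_derivative_works[symmetric])

lemma msmooth_eventually:
  assumes "smooth_manifold A" "msmooth A p f"
  shows "\<forall>\<^sub>F q in nhds p. msmooth A q f"
proof -
  let ?c = "chart_at A p"
  note c = chart_at_props[OF assms(1), of p]
  have "smooth_at (snd ?c p) (f \<circ> chart_inv ?c)" using assms(2) c by (simp add: msmooth_def)
  from chart_eventually(4)[OF assms(1) c smooth_at_eventually[OF this]] chart_eventually(1)[OF assms(1) c]
  show ?thesis by eventually_elim (rule msmoothI[OF assms(1) c(1)])
qed

lemma chart_cong:
  assumes "smooth_manifold A" "c \<in> A" "p \<in> fst c" "\<forall>\<^sub>F q in nhds p. f q = g q"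
  shows "\<forall>\<^sub>F x in nhds (snd c p). (f \<circ> chart_inv c) x = (g \<circ> chart_inv c) x"
  using chart_eventually(3)[OF assms] by simp

lemma msmooth_cong:
  assumes "smooth_manifold A" "\<forall>\<^sub>F q in nhds p. f q = g q" "msmooth A p f"
  shows "msmooth A p g"
  unfolding msmooth_def
proof (intro ballI impI)
  fix c assume c: "c \<in> A" "p \<in> fst c"
  then show "smooth_at (snd c p) (g \<circ> chart_inv c)"
    using smooth_at_cong[OF chart_cong[OF assms(1) c assms(2)]] assms(3) unfolding msmooth_def by blast
qed

lemma mdiff_cong:
  assumes "smooth_manifold A" "\<forall>\<^sub>F q in nhds p. f q = g q" "mdiff A p f"
  shows "mdiff A p g"
  unfolding mdiff_def
proof (intro ballI impI)
  fix c assume c: "c \<in> A" "p \<in> fst c"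
  show "(g \<circ> chart_inv c) differentiable (at (snd c p))"
    unfolding differentiable_def
    by (rule exI, rule has_derivative_cong_nhds[OF mdiffD[OF assms(3) c]
        chart_cong[OF assms(1) c assms(2)]])
qed

lemma msmooth_const: "msmooth A p (\<lambda>q. c)"
  by (simp add: msmooth_def o_def smooth_at_const)

lemma msmooth_add: "msmooth A p f \<Longrightarrow> msmooth A p g \<Longrightarrow> msmooth A p (\<lambda>q. f q + g q)"
  by (simp add: msmooth_def o_def smooth_at_add)

lemma msmooth_bilinear:
  "bounded_bilinear B \<Longrightarrow> msmooth A p f \<Longrightarrow> msmooth A p g \<Longrightarrow> msmooth A p (\<lambda>q. B (f q) (g q))"
  by (simp add: msmooth_def o_def smooth_at_bilinear[of B])

lemmas msmooth_scaleR = msmooth_bilinear[OF bounded_bilinear_scaleR]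
lemma msmooth_bounded_linear: "bounded_linear L \<Longrightarrow> msmooth A p f \<Longrightarrow> msmooth A p (\<lambda>q. L (f q))"
  by (simp add: msmooth_def o_def smooth_at_bounded_linear[of L])

lemmas msmooth_inner_left = msmooth_bounded_linear[OF bounded_linear_inner_left]

lemma msmooth_outer:
  fixes f :: "'a::{t2_space, second_countable_topology} \<Rightarrow> 'b::fin_dim"
  assumes "smooth_manifold A" "msmooth A p f" "smooth_at (f p) g"
  shows "msmooth A p (\<lambda>q. g (f q))"
  unfolding msmooth_def o_def
proof (intro ballI impI)
  fix c assume "c \<in> A" "p \<in> fst c"
  then show "smooth_at (snd c p) (\<lambda>x. g (f (chart_inv c x)))"
    using assms chartD(5)[OF assms(1)]
    by (intro smooth_at_comp[of _ "\<lambda>x. f (chart_inv c x)" g]) (simp_all add: msmooth_def o_def)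
qed

lemma msmooth_Pair: "msmooth A p f \<Longrightarrow> msmooth A p g \<Longrightarrow> msmooth A p (\<lambda>x. (f x, g x))"
  by (simp add: msmooth_def o_def smooth_at_Pair)

lemma smooth_on_chart_iff:
  assumes "smooth_manifold A" "c \<in> A" "open U" "U \<subseteq> fst c"
  shows "smooth_on (snd c ` U) (f \<circ> chart_inv c) \<longleftrightarrow> (\<forall>p\<in>U. msmooth A p f)"
proof -
  have "open (snd c ` U)" by (rule open_chart_image[OF assms])
  then show ?thesis
    using msmoothI[OF assms(1,2), of _ f] assms(2,4)
    by (auto simp: smooth_on_iff_smooth_at msmooth_def subset_iff)
qed

lemma smooth_fun_iff:
  assumes "smooth_manifold A"
  shows "smooth_fun A f \<longleftrightarrow> (\<forall>p. msmooth A p f)"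
proof -
  have "smooth_fun A f \<longleftrightarrow> (\<forall>c\<in>A. \<forall>p\<in>fst c. msmooth A p f)"
    unfolding smooth_fun_def using smooth_on_chart_iff[OF assms _ chartD(1)[OF assms] order_refl] by blast
  also have "\<dots> \<longleftrightarrow> (\<forall>p. msmooth A p f)" using chart_at_props[OF assms] by blast
  finally show ?thesis .
qed

lemma msmooth_chart: "smooth_manifold A \<Longrightarrow> c \<in> A \<Longrightarrow> p \<in> fst c \<Longrightarrow> msmooth A p (snd c)"
  unfolding msmooth_def using transition_smooth_at[of A _ c p] by blast

lemma mdiff_const: "mdiff A p (\<lambda>q. c)"
  by (simp add: mdiff_def o_def)

lemma mdiff_add: "mdiff A p f \<Longrightarrow> mdiff A p g \<Longrightarrow> mdiff A p (\<lambda>q. f q + g q)"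
  by (simp add: mdiff_def o_def)

lemma mdiff_scaleR: "mdiff A p f \<Longrightarrow> mdiff A p g \<Longrightarrow> mdiff A p (\<lambda>q. f q *\<^sub>R g q)"
  by (simp add: mdiff_def o_def)

lemma mdiff_bounded_linear: "bounded_linear L \<Longrightarrow> mdiff A p f \<Longrightarrow> mdiff A p (\<lambda>q. L (f q))"
  unfolding mdiff_def o_def differentiable_def using bounded_linear.has_derivative[of L] by blast

lemma mdiff_sum: "(\<And>i. i \<in> I \<Longrightarrow> mdiff A p (f i)) \<Longrightarrow> mdiff A p (\<lambda>q. \<Sum>i\<in>I. f i q)"
  by (induction I rule: infinite_finite_induct) (simp_all add: mdiff_const mdiff_add)

section \<open>Directional derivatives\<close>

lemma dir_derivI:
  assumes "((f \<circ> chart_inv (chart_at A p)) has_derivative L) (at (snd (chart_at A p) p))"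
  shows "dir_deriv A p v f = L (v (chart_at A p))"
  using frechet_derivative_at[OF assms] by (simp add: dir_deriv_def Let_def)

lemma dir_derivD:
  assumes "smooth_manifold A" "mdiff A p f"
  shows "((f \<circ> chart_inv (chart_at A p)) has_derivative frechet_derivative (f \<circ> chart_inv (chart_at A p))
      (at (snd (chart_at A p) p)))
    (at (snd (chart_at A p) p))"
  by (rule mdiffD[OF assms(2) chart_at_props[OF assms(1)]])

lemma tangent_transition:
  assumes "v \<in> tangent_space A p" "c \<in> A" "d \<in> A" "p \<in> fst c" "p \<in> fst d"
  shows "v d = frechet_derivative (snd d \<circ> chart_inv c) (at (snd c p)) (v c)"
  using assms unfolding tangent_space_def by blast

lemma tangent_outside:
  assumes "v \<in> tangent_space A p" "c \<notin> A \<or> p \<notin> fst c"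
  shows "v c = 0"
  using assms unfolding tangent_space_def by blast

lemma tangent_spaceI:
  assumes "\<And>c d. c \<in> A \<Longrightarrow> d \<in> A \<Longrightarrow> p \<in> fst c \<Longrightarrow> p \<in> fst d \<Longrightarrow>
      v d = frechet_derivative (snd d \<circ> chart_inv c) (at (snd c p)) (v c)"
    and "\<And>c. c \<notin> A \<or> p \<notin> fst c \<Longrightarrow> v c = 0"
  shows "v \<in> tangent_space A p"
  using assms unfolding tangent_space_def by blast

text \<open>The transformation law of \<open>v\<close> compensates the change of the derivative on
  passing from the chosen chart \<open>chart_at A p\<close> to \<open>c\<close>. From here on any
  convenient chart may be used.\<close>

lemma dir_deriv_chart:
  assumes "smooth_manifold A" "mdiff A p f" "c \<in> A" "p \<in> fst c" "v \<in> tangent_space A p"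
  shows "dir_deriv A p v f = frechet_derivative (f \<circ> chart_inv c) (at (snd c p)) (v c)"
proof -
  let ?d = "chart_at A p"
  note d = chart_at_props[OF assms(1), of p]
  have "v c = frechet_derivative (snd c \<circ> chart_inv ?d) (at (snd ?d p)) (v ?d)"
    by (rule tangent_transition[OF assms(5) d(1) assms(3) d(2) assms(4)])
  with dir_derivI[OF change_chart_derivative[OF assms(1,3) d(1) assms(4) d(2) mdiffD[OF assms(2-4)]], of v]
  show ?thesis by (simp only:)
qed

lemma dir_deriv_const: "dir_deriv A p v (\<lambda>q. c) = 0"
  by (simp add: dir_deriv_def Let_def o_def)

lemma dir_deriv_add:
  assumes "smooth_manifold A" "mdiff A p f" "mdiff A p g"
  shows "dir_deriv A p v (\<lambda>q. f q + g q) = dir_deriv A p v f + dir_deriv A p v g"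
  using dir_derivI[of "\<lambda>q. f q + g q" A p _ v] 
    has_derivative_add[OF dir_derivD[OF assms(1,2)] dir_derivD[OF assms(1,3)]]
  by (simp add: o_def dir_deriv_def Let_def)

lemma dir_deriv_scaleR:
  assumes "smooth_manifold A" "mdiff A p f" "mdiff A p g"
  shows "dir_deriv A p v (\<lambda>q. f q *\<^sub>R g q) = dir_deriv A p v f *\<^sub>R g p + f p *\<^sub>R dir_deriv A p v g"
  using dir_derivI[of "\<lambda>q. f q *\<^sub>R g q" A p _ v] 
    has_derivative_scaleR[OF dir_derivD[OF assms(1,2)] dir_derivD[OF assms(1,3)]]
    chartD(5)[OF assms(1) chart_at_props[OF assms(1), of p]]
  by (simp add: o_def dir_deriv_def Let_def)

lemma dir_deriv_bounded_linear:
  assumes "smooth_manifold A" "mdiff A p f" "bounded_linear L"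
  shows "dir_deriv A p v (\<lambda>q. L (f q)) = L (dir_deriv A p v f)"
  using dir_derivI[of "\<lambda>q. L (f q)" A p _ v] 
    bounded_linear.has_derivative[OF assms(3) dir_derivD[OF assms(1,2)]]
  by (simp add: o_def dir_deriv_def Let_def)

lemma dir_deriv_sum:
  assumes "smooth_manifold A" "\<And>i. i \<in> I \<Longrightarrow> mdiff A p (f i)"
  shows "dir_deriv A p v (\<lambda>q. \<Sum>i\<in>I. f i q) = (\<Sum>i\<in>I. dir_deriv A p v (f i))"
  using assms(2)
  by (induction I rule: infinite_finite_induct) (simp_all add: dir_deriv_const dir_deriv_add[OF assms(1)]
      mdiff_sum)

lemma dir_deriv_cong:
  assumes "smooth_manifold A" "\<forall>\<^sub>F q in nhds p. f q = g q"
  shows "dir_deriv A p v f = dir_deriv A p v g"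
proof -
  let ?c = "chart_at A p"
  note 1 = chart_cong[OF assms(1) chart_at_props[OF assms(1)] assms(2)]
  have 2: "\<forall>\<^sub>F x in nhds (snd ?c p). (g \<circ> chart_inv ?c) x = (f \<circ> chart_inv ?c) x"
    using 1 by eventually_elim simp
  have "((f \<circ> chart_inv ?c) has_derivative L) (at (snd ?c p)) \<longleftrightarrow>
      ((g \<circ> chart_inv ?c) has_derivative L) (at (snd ?c p))" for L
    using has_derivative_cong_nhds[OF _ 1] has_derivative_cong_nhds[OF _ 2] by blast
  then show ?thesis by (simp add: dir_deriv_def Let_def frechet_derivative_def)
qed

lemma dir_deriv_outer:
  assumes "smooth_manifold A" "mdiff A p f" "(g has_derivative L) (at (f p))"
  shows "mdiff A p (\<lambda>q. g (f q))" "dir_deriv A p v (\<lambda>q. g (f q)) = L (dir_deriv A p v f)"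
proof -
  let ?c = "chart_at A p"
  note c = chart_at_props[OF assms(1), of p]
  have "(g has_derivative L) (at ((f \<circ> chart_inv ?c) (snd ?c p)))"
    using assms(3) chartD(5)[OF assms(1) c] by simp
  from diff_chain_at[OF dir_derivD[OF assms(1,2)] this]
  have *: "((\<lambda>q. g (f q)) \<circ> chart_inv ?c has_derivative
      (\<lambda>w. L (frechet_derivative (f \<circ> chart_inv ?c) (at (snd ?c p)) w))) (at (snd ?c p))"
    by (simp add: o_def)
  from dir_derivI[OF this] show "dir_deriv A p v (\<lambda>q. g (f q)) = L (dir_deriv A p v f)"
    by (simp add: dir_deriv_def Let_def)
  show "mdiff A p (\<lambda>q. g (f q))" by (rule mdiffI[OF assms(1) c]) (use * in \<open>auto simp: differentiable_def\<close>)
qed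

lemma dir_deriv_vec_add:
  assumes "smooth_manifold A" "mdiff A p f"
  shows "dir_deriv A p (u + v) f = dir_deriv A p u f + dir_deriv A p v f"
  using linear_add[OF has_derivative_linear[OF dir_derivD[OF assms]]] by (simp add: dir_deriv_def Let_def)

lemma dir_deriv_vec_scale:
  assumes "smooth_manifold A" "mdiff A p f"
  shows "dir_deriv A p (r *\<^sub>R u) f = r *\<^sub>R dir_deriv A p u f"
  using linear_scale[OF has_derivative_linear[OF dir_derivD[OF assms]]]
  by (simp add: dir_deriv_def Let_def scaleR_fun_def)

lemma msmooth_dir_deriv:
  assumes A: "smooth_manifold A" and f: "msmooth A p f" and c: "c \<in> A" "p \<in> fst c"
    and Y: "msmooth A p (\<lambda>q. Y q c)" "\<forall>\<^sub>F q in nhds p. Y q \<in> tangent_space A q"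
  shows "msmooth A p (\<lambda>q. dir_deriv A q (Y q) f)"
proof (rule msmoothI[OF A c])
  have 1: "smooth_at (snd c p) (\<lambda>x. frechet_derivative (f \<circ> chart_inv c) (at ((\<lambda>x. x) x))
      (Y (chart_inv c x) c))"
    by (rule smooth_at_deriv_comp[OF smooth_at_linear[OF bounded_linear_ident]])
       (use f Y(1) c in \<open>simp_all add: msmooth_def o_def\<close>)
  have "\<forall>\<^sub>F x in nhds (snd c p). frechet_derivative (f \<circ> chart_inv c) (at x) (Y (chart_inv c x) c) =
     dir_deriv A (chart_inv c x) (Y (chart_inv c x)) f"
    using chart_eventually(3)[OF A c msmooth_eventually[OF A f]] chart_eventually(3)[OF A c Y(2)]
      chart_eventually(2)[OF A c]
  proof eventually_elim
    case (elim x)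
    show ?case
      using dir_deriv_chart[OF A msmooth_imp_mdiff[OF elim(1)] c(1) chartD(7)[OF A c(1) elim(3)] elim(2)]
      by (simp only: chartD(6)[OF A c(1) elim(3)])
  qed
  from smooth_at_cong[OF this] 1
  show "smooth_at (snd c p) ((\<lambda>q. dir_deriv A q (Y q) f) \<circ> chart_inv c)" by (simp add: o_def)
qed

section \<open>Tangent spaces\<close>

text \<open>The inverse of the coordinate map that evaluates a tangent vector at \<open>c\<close>;
  it identifies the model space with the tangent space.\<close>

definition tangent_of :: "('a, 'e::real_normed_vector) chart set \<Rightarrow> ('a, 'e) chart \<Rightarrow> 'a \<Rightarrow> 'e \<Rightarrow> ('a, 'e) tvec"
    where
  "tangent_of A c p w = (\<lambda>d. if d \<in> A \<and> p \<in> fst d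
     then frechet_derivative (snd d \<circ> chart_inv c) (at (snd c p)) w else 0)"

lemma transition_derivative_id:
  assumes "smooth_manifold A" "c \<in> A" "p \<in> fst c"
  shows "frechet_derivative (snd c \<circ> chart_inv c) (at (snd c p)) w = w"
proof -
  have "\<forall>\<^sub>F x in nhds (snd c p). x = (snd c \<circ> chart_inv c) x"
    using chart_eventually(2)[OF assms] by eventually_elim (simp add: chartD(6)[OF assms(1,2)])
  note has_derivative_cong_nhds[OF has_derivative_ident this]
  from frechet_derivative_at[OF this] show ?thesis by metis
qed

lemma tangent_of:
  assumes "smooth_manifold A" "c \<in> A" "p \<in> fst c"
  shows "tangent_of A c p w \<in> tangent_space A p" "tangent_of A c p w c = w"
proof -
  show "tangent_of A c p w c = w"
    using transition_derivative_id[OF assms] assms by (simp add: tangent_of_def)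
  have *: "frechet_derivative (snd e \<circ> chart_inv c) (at (snd c p)) w =
     frechet_derivative (snd e \<circ> chart_inv d) (at (snd d p)) (frechet_derivative (snd d \<circ> chart_inv c)
         (at (snd c p)) w)"
    if "d \<in> A" "e \<in> A" "p \<in> fst d" "p \<in> fst e" for d e
  proof -
    have "((snd e \<circ> chart_inv d) has_derivative frechet_derivative (snd e \<circ> chart_inv d) (at (snd d p)))
        (at (snd d p))"
      using smooth_at_imp_differentiable[OF transition_smooth_at[OF assms(1) that]]
      by (simp add: frechet_derivative_works[symmetric])
    from frechet_derivative_at[OF change_chart_derivative[OF assms(1) that(1) assms(2) that(3) assms(3)
        this]]
    show ?thesis by metis
  qed
  show "tangent_of A c p w \<in> tangent_space A p"
  proof (rule tangent_spaceI)
    fix d e assume de: "d \<in> A" "e \<in> A" "p \<in> fst d" "p \<in> fst e"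
    then have "tangent_of A c p w d = frechet_derivative (snd d \<circ> chart_inv c) (at (snd c p)) w"
      "tangent_of A c p w e = frechet_derivative (snd e \<circ> chart_inv c) (at (snd c p)) w"
      by (simp_all add: tangent_of_def)
    then show "tangent_of A c p w e = frechet_derivative (snd e \<circ> chart_inv d) (at (snd d p))
        (tangent_of A c p w d)"
      by (simp only: *[OF de])
  qed (auto simp: tangent_of_def)
qed

lemma tangent_eq_tangent_of:
  assumes "v \<in> tangent_space A p" "c \<in> A" "p \<in> fst c"
  shows "v = tangent_of A c p (v c)"
  using tangent_transition[OF assms(1,2) _ assms(3)] tangent_outside[OF assms(1)]
  by (auto simp: tangent_of_def fun_eq_iff)

lemma linear_transition:
  assumes "smooth_manifold A" "c \<in> A" "d \<in> A" "p \<in> fst c" "p \<in> fst d"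
  shows "linear (frechet_derivative (snd d \<circ> chart_inv c) (at (snd c p)))"
  by (rule has_derivative_linear[OF frechet_derivative_works[THEN iffD1, 
     OF smooth_at_imp_differentiable[OF transition_smooth_at[OF assms]]]])

lemma sum_fun_apply: "(\<Sum>i\<in>I. f i) x = (\<Sum>i\<in>I. f i x)" for f :: "'i \<Rightarrow> 'b \<Rightarrow> 'c::comm_monoid_add"
  by (induction I rule: infinite_finite_induct) auto

lemma subspace_tangent_space:
  assumes "smooth_manifold A"
  shows "subspace (tangent_space A p)"
  unfolding subspace_def
proof (intro conjI ballI allI)
  note lin = linear_transition[OF assms]
  show "0 \<in> tangent_space A p"
    by (rule tangent_spaceI) (simp_all add: linear_0[OF lin])
  fix u v assume uv: "u \<in> tangent_space A p" "v \<in> tangent_space A p"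
  show "u + v \<in> tangent_space A p"
    by (rule tangent_spaceI) (simp_all add: linear_add[OF lin] tangent_transition[OF uv(1), symmetric]
      tangent_transition[OF uv(2), symmetric] tangent_outside[OF uv(1)] tangent_outside[OF uv(2)])
next
  note lin = linear_transition[OF assms]
  fix r u assume u: "u \<in> tangent_space A p"
  show "r *\<^sub>R u \<in> tangent_space A p"
    by (rule tangent_spaceI) (simp_all add: linear_scale[OF lin] tangent_transition[OF u, symmetric]
      tangent_outside[OF u] scaleR_fun_def)
qed

lemma linear_tangent_of:
  assumes "smooth_manifold A" "c \<in> A" "p \<in> fst c"
  shows "linear (tangent_of A c p)"
  using linear_transition[OF assms(1,2) _ assms(3)]
  by (auto simp: linear_iff tangent_of_def fun_eq_iff scaleR_fun_def)

lemma tangent_space_spanned: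
  assumes "smooth_manifold A"
  shows "\<exists>S. finite S \<and> S \<subseteq> tangent_space A p \<and> span S = tangent_space A p"
proof -
  let ?c = "chart_at A p"
  note c = chart_at_props[OF assms, of p]
  let ?S = "tangent_of A ?c p ` onb"
  have "?S \<subseteq> tangent_space A p" using tangent_of(1)[OF assms c] by auto
  moreover have "span ?S = tangent_space A p"
  proof
    show "span ?S \<subseteq> tangent_space A p"
      by (rule span_minimal[OF \<open>?S \<subseteq> _\<close> subspace_tangent_space[OF assms]])
    show "tangent_space A p \<subseteq> span ?S"
    proof
      fix v assume v: "v \<in> tangent_space A p"
      have "v = (\<Sum>b\<in>onb. (v ?c \<bullet> b) *\<^sub>R tangent_of A ?c p b)"
        using tangent_eq_tangent_of[OF v c] linear_onb_sum[OF linear_tangent_of[OF assms c]] by metis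
      moreover have "\<dots> \<in> span ?S" by (intro span_sum span_scale span_base) auto
      ultimately show "v \<in> span ?S" by metis
    qed
  qed
  ultimately show ?thesis by (intro exI[of _ ?S]) auto
qed

section \<open>Differentials\<close>

text \<open>Continuity is demanded separately because \<open>snd d (F q)\<close> carries information
  only while \<open>F q\<close> stays in the domain of \<open>d\<close>.\<close>

definition map_smooth_at ::
  "('a::topological_space, 'e::real_normed_vector) chart set \<Rightarrow>
   ('b::topological_space, 'f::real_normed_vector) chart set \<Rightarrow> 'a \<Rightarrow> ('a \<Rightarrow> 'b) \<Rightarrow> bool" where
  "map_smooth_at A B p F \<longleftrightarrow> filterlim F (nhds (F p)) (nhds p) \<and>
     (\<forall>d\<in>B. F p \<in> fst d \<longrightarrow> msmooth A p (\<lambda>q. snd d (F q)))"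

lemma map_smooth_atD:
  assumes "map_smooth_at A B p F"
  shows "(\<forall>\<^sub>F r in nhds (F p). Q r) \<Longrightarrow> \<forall>\<^sub>F q in nhds p. Q (F q)"
    "d \<in> B \<Longrightarrow> F p \<in> fst d \<Longrightarrow> msmooth A p (\<lambda>q. snd d (F q))"
  using assms by (auto simp: map_smooth_at_def filterlim_iff)

lemma comp_chart_eventually:
  assumes "smooth_manifold B" "map_smooth_at A B p F" "d \<in> B" "F p \<in> fst d"
  shows "\<forall>\<^sub>F q in nhds p. (f \<circ> chart_inv d) (snd d (F q)) = f (F q)"
  using map_smooth_atD(1)[OF assms(2) chart_eventually(1)[OF assms(1,3,4)]]
  by eventually_elim (simp add: chartD(5)[OF assms(1,3)])

lemma msmooth_comp:
  assumes "smooth_manifold A" "smooth_manifold B" "map_smooth_at A B p F" "msmooth B (F p) f"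
  shows "msmooth A p (\<lambda>q. f (F q))"
proof -
  let ?d = "chart_at B (F p)"
  note d = chart_at_props[OF assms(2), of "F p"]
  have "smooth_at (snd ?d (F p)) (f \<circ> chart_inv ?d)"
    using assms(4) d unfolding msmooth_def by blast
  from msmooth_outer[OF assms(1) map_smooth_atD(2)[OF assms(3) d] this]
  show ?thesis by (rule msmooth_cong[OF assms(1) comp_chart_eventually[OF assms(2,3) d]])
qed

text \<open>\<open>differential\<close> is defined by coordinates; this shows that it pushes
  derivations forward, from which functoriality follows by taking \<open>f\<close> to be a
  chart.\<close>

lemma dir_deriv_comp:
  assumes "smooth_manifold A" "smooth_manifold B" "map_smooth_at A B p F" "mdiff B (F p) f"
  shows "dir_deriv A p v (\<lambda>q. f (F q)) = dir_deriv B (F p) (differential A B F p v) f"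
    "mdiff A p (\<lambda>q. f (F q))"
proof -
  let ?d = "chart_at B (F p)"
  note d = chart_at_props[OF assms(2), of "F p"]
  note ev = comp_chart_eventually[OF assms(2,3) d, of f]
  note outer = dir_deriv_outer[OF assms(1) msmooth_imp_mdiff[OF map_smooth_atD(2)[OF assms(3) d]]
      mdiffD[OF assms(4) d]]
  show "mdiff A p (\<lambda>q. f (F q))" by (rule mdiff_cong[OF assms(1) ev outer(1)])
  have "dir_deriv A p v (\<lambda>q. f (F q)) = dir_deriv A p v (\<lambda>q. (f \<circ> chart_inv ?d) (snd ?d (F q)))"
    by (rule dir_deriv_cong[OF assms(1) ev, symmetric])
  also have "\<dots> = frechet_derivative (f \<circ> chart_inv ?d) (at (snd ?d (F p)))
      (dir_deriv A p v (\<lambda>q. snd ?d (F q)))"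
    by (rule outer(2))
  also have "\<dots> = dir_deriv B (F p) (differential A B F p v) f"
    using d by (simp add: dir_deriv_def[of B] Let_def differential_def o_def)
  finally show "dir_deriv A p v (\<lambda>q. f (F q)) = dir_deriv B (F p) (differential A B F p v) f" .
qed

lemma differential_apply:
  "d \<in> B \<Longrightarrow> F p \<in> fst d \<Longrightarrow> differential A B F p v d = dir_deriv A p v (\<lambda>q. snd d (F q))"
  "d \<notin> B \<or> F p \<notin> fst d \<Longrightarrow> differential A B F p v d = 0"
  by (auto simp: differential_def o_def)

lemma differential_tangent:
  assumes "smooth_manifold A" "smooth_manifold B" "map_smooth_at A B p F"
  shows "differential A B F p v \<in> tangent_space B (F p)"
proof (rule tangent_spaceI)
  fix d e assume de: "d \<in> B" "e \<in> B" "F p \<in> fst d" "F p \<in> fst e"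
  have "mdiff A p (\<lambda>q. snd d (F q))"
    by (rule msmooth_imp_mdiff[OF map_smooth_atD(2)[OF assms(3) de(1,3)]])
  moreover have "(snd e \<circ> chart_inv d has_derivative frechet_derivative (snd e \<circ> chart_inv d)
      (at (snd d (F p)))) (at (snd d (F p)))"
    by (rule frechet_derivative_works[THEN iffD1,
        OF smooth_at_imp_differentiable[OF transition_smooth_at[OF assms(2) de]]])
  ultimately have "dir_deriv A p v (\<lambda>q. (snd e \<circ> chart_inv d) (snd d (F q))) =
     frechet_derivative (snd e \<circ> chart_inv d) (at (snd d (F p))) (dir_deriv A p v (\<lambda>q. snd d (F q)))"
    by (rule dir_deriv_outer(2)[OF assms(1)])
  moreover have "dir_deriv A p v (\<lambda>q. (snd e \<circ> chart_inv d) (snd d (F q))) =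
      dir_deriv A p v (\<lambda>q. snd e (F q))"
    by (rule dir_deriv_cong[OF assms(1) comp_chart_eventually[OF assms(2,3) de(1,3)]])
  ultimately show "differential A B F p v e =
      frechet_derivative (snd e \<circ> chart_inv d) (at (snd d (F p))) (differential A B F p v d)"
    using de by (simp only: differential_apply)
qed (simp add: differential_apply)

lemma differential_add:
  assumes "smooth_manifold A" "map_smooth_at A B p F"
  shows "differential A B F p (u + v) = differential A B F p u + differential A B F p v"
proof
  fix d
  show "differential A B F p (u + v) d = (differential A B F p u + differential A B F p v) d"
    using dir_deriv_vec_add[OF assms(1) msmooth_imp_mdiff[OF map_smooth_atD(2)[OF assms(2)]]]
    by (cases "d \<in> B \<and> F p \<in> fst d") (auto simp: differential_apply)
qed

lemma differential_scale:
  assumes "smooth_manifold A" "map_smooth_at A B p F"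
  shows "differential A B F p (r *\<^sub>R u) = r *\<^sub>R differential A B F p u"
proof
  fix d
  show "differential A B F p (r *\<^sub>R u) d = (r *\<^sub>R differential A B F p u) d"
    using dir_deriv_vec_scale[OF assms(1) msmooth_imp_mdiff[OF map_smooth_atD(2)[OF assms(2)]]]
    by (cases "d \<in> B \<and> F p \<in> fst d") (auto simp: differential_apply scaleR_fun_def)
qed

lemma linear_differential:
  assumes "smooth_manifold A" "map_smooth_at A B p F"
  shows "linear (differential A B F p)"
  by (rule linearI) (simp_all add: differential_add[OF assms] differential_scale[OF assms])

lemma differential_comp:
  assumes "smooth_manifold A" "smooth_manifold B" "map_smooth_at A B p F" "map_smooth_at B C (F p) G"
  shows "differential A C (\<lambda>q. G (F q)) p v = differential B C G (F p) (differential A B F p v)"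
proof
  fix d
  show "differential A C (\<lambda>q. G (F q)) p v d = differential B C G (F p) (differential A B F p v) d"
    using dir_deriv_comp(1)[OF assms(1-3) msmooth_imp_mdiff[OF map_smooth_atD(2)[OF assms(4)]]]
    by (cases "d \<in> C \<and> G (F p) \<in> fst d") (auto simp: differential_apply)
qed

lemma map_smooth_at_comp:
  assumes "smooth_manifold A" "smooth_manifold B" "map_smooth_at A B p F" "map_smooth_at B C (F p) G"
  shows "map_smooth_at A C p (\<lambda>q. G (F q))"
  unfolding map_smooth_at_def
proof (intro conjI ballI impI)
  show "filterlim (\<lambda>q. G (F q)) (nhds (G (F p))) (nhds p)"
    using assms(3,4) by (auto simp: map_smooth_at_def intro: filterlim_compose)
  fix d assume "d \<in> C" "G (F p) \<in> fst d"
  then show "msmooth A p (\<lambda>q. snd d (G (F q)))"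
    by (rule msmooth_comp[OF assms(1-3) map_smooth_atD(2)[OF assms(4)]])
qed

lemma differential_cong:
  fixes B :: "('b, 'f::real_normed_vector) chart set"
  assumes "smooth_manifold A" "\<forall>\<^sub>F q in nhds p. F q = G q"
  shows "differential A B F p v = differential A B G p v"
proof
  fix d :: "('b, 'f) chart"
  have "F p = G p" using eventually_nhds_x_imp_x[OF assms(2)] .
  moreover have "dir_deriv A p v (\<lambda>q. snd d (F q)) = dir_deriv A p v (\<lambda>q. snd d (G q))"
    by (rule dir_deriv_cong[OF assms(1)]) (use assms(2) in \<open>eventually_elim, simp\<close>)
  ultimately show "differential A B F p v d = differential A B G p v d"
    by (simp add: differential_def o_def)
qed

lemma differential_const: "differential A B (\<lambda>q. x) p v = 0"
  by (rule ext) (simp add: differential_def o_def dir_deriv_const)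

lemma dir_deriv_chart_self:
  assumes "smooth_manifold A" "v \<in> tangent_space A p" "c \<in> A" "p \<in> fst c"
  shows "dir_deriv A p v (snd c) = v c"
  using dir_deriv_chart[OF assms(1) msmooth_imp_mdiff[OF msmooth_chart[OF assms(1,3,4)]] assms(3,4,2)]
    transition_derivative_id[OF assms(1,3,4)] by simp

lemma differential_id:
  assumes "smooth_manifold A" "v \<in> tangent_space A p"
  shows "differential A A (\<lambda>q. q) p v = v"
proof
  fix d
  show "differential A A (\<lambda>q. q) p v d = v d"
    using dir_deriv_chart_self[OF assms] tangent_outside[OF assms(2)]
    by (cases "d \<in> A \<and> p \<in> fst d") (auto simp: differential_apply)
qed

lemma map_smooth_at_id: "smooth_manifold A \<Longrightarrow> map_smooth_at A A p (\<lambda>q. q)"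
  by (simp add: map_smooth_at_def msmooth_chart filterlim_ident)

lemma smooth_map_on_at:
  assumes "smooth_manifold A" "smooth_manifold B" "smooth_map_on A B S F" "open S" "p \<in> S"
  shows "map_smooth_at A B p F"
  unfolding map_smooth_at_def
proof (intro conjI ballI impI)
  have cont: "continuous_on S F" using assms(3) by (simp add: smooth_map_on_def)
  then have "isCont F p" using assms(4,5) by (simp add: continuous_on_eq_continuous_at)
  then show "filterlim F (nhds (F p)) (nhds p)"
    using tendsto_at_iff_tendsto_nhds[of F p] by (simp add: isCont_def)
  fix d assume d: "d \<in> B" "F p \<in> fst d"
  let ?c = "chart_at A p"
  note c = chart_at_props[OF assms(1), of p]
  let ?U = "S \<inter> fst ?c \<inter> F -` fst d"
  have "open (S \<inter> F -` fst d)"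
    by (rule continuous_open_preimage[OF cont assms(4) chartD(1)[OF assms(2) d(1)]])
  moreover have "?U = (S \<inter> F -` fst d) \<inter> fst ?c" by auto
  ultimately have U: "open ?U" using chartD(1)[OF assms(1) c(1)] by (simp only: open_Int)
  have "smooth_on (snd ?c ` ?U) ((snd d \<circ> F) \<circ> chart_inv ?c)"
    using assms(3) c d by (auto simp: smooth_map_on_def)
  moreover have "?U \<subseteq> fst ?c" by auto
  ultimately have "\<forall>q\<in>?U. msmooth A q (snd d \<circ> F)"
    using smooth_on_chart_iff[OF assms(1) c(1) U] by blast
  then show "msmooth A p (\<lambda>q. snd d (F q))" using c d assms(5) by (auto simp: o_def)
qed

section \<open>Vector fields\<close>

text \<open>One chart around each point is enough, because the coordinates of \<open>X\<close> in
  another chart \<open>d\<close> are the derivatives of the function \<open>snd d\<close> along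
  \<open>X\<close>.\<close>

lemma vector_fieldI:
  assumes A: "smooth_manifold A" and X: "\<And>p. X p \<in> tangent_space A p"
    and loc: "\<And>p. \<exists>c\<in>A. p \<in> fst c \<and> msmooth A p (\<lambda>q. X q c)"
  shows "vector_field A X"
  unfolding vector_field_def
proof (intro conjI allI ballI X)
  fix d assume d: "d \<in> A"
  have "msmooth A p (\<lambda>q. X q d)" if p: "p \<in> fst d" for p
  proof -
    obtain c where c: "c \<in> A" "p \<in> fst c" "msmooth A p (\<lambda>q. X q c)" using loc by blast
    have "msmooth A p (\<lambda>q. dir_deriv A q (X q) (snd d))"
      by (rule msmooth_dir_deriv[OF A msmooth_chart[OF A d p] c(1,2), where Y = X]) (simp_all add: X c(3))
    moreover have "\<forall>\<^sub>F q in nhds p. dir_deriv A q (X q) (snd d) = X q d"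
      using chart_eventually(1)[OF A d p] by eventually_elim (rule dir_deriv_chart_self[OF A X d])
    ultimately show ?thesis by (rule msmooth_cong[OF A, rotated])
  qed
  then show "smooth_on (snd d ` fst d) (\<lambda>x. X (chart_inv d x) d)"
    using smooth_on_chart_iff[OF A d chartD(1)[OF A d] order_refl, of "\<lambda>q. X q d"] by (simp add: o_def)
qed

lemma vector_fieldD:
  assumes A: "smooth_manifold A" and X: "vector_field A X"
  shows "X p \<in> tangent_space A p" "c \<in> A \<Longrightarrow> p \<in> fst c \<Longrightarrow> msmooth A p (\<lambda>q. X q c)"
proof -
  show "X p \<in> tangent_space A p" using X by (simp add: vector_field_def)
  assume c: "c \<in> A" "p \<in> fst c"
  have "smooth_on (snd c ` fst c) (\<lambda>x. X (chart_inv c x) c)" using X c(1) by (simp add: vector_field_def)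
  then show "msmooth A p (\<lambda>q. X q c)"
    using smooth_on_chart_iff[OF A c(1) chartD(1)[OF A c(1)] order_refl, of "\<lambda>q. X q c"] c(2)
    by (simp add: o_def)
qed

lemma vector_field_add:
  assumes A: "smooth_manifold A" and "vector_field A X" "vector_field A Y"
  shows "vector_field A (\<lambda>p. X p + Y p)"
proof (rule vector_fieldI[OF A])
  fix p
  note c = chart_at_props[OF A, of p]
  show "X p + Y p \<in> tangent_space A p"
    by (intro subspace_add[OF subspace_tangent_space[OF A]] vector_fieldD(1)[OF A] assms)
  show "\<exists>c\<in>A. p \<in> fst c \<and> msmooth A p (\<lambda>q. (X q + Y q) c)"
    using msmooth_add[OF vector_fieldD(2)[OF A assms(2) c] vector_fieldD(2)[OF A assms(3) c]] c by auto
qed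

lemma vector_field_scale:
  assumes A: "smooth_manifold A" and "smooth_fun A f" "vector_field A X"
  shows "vector_field A (\<lambda>p. f p *\<^sub>R X p)"
proof (rule vector_fieldI[OF A])
  fix p
  note c = chart_at_props[OF A, of p]
  show "f p *\<^sub>R X p \<in> tangent_space A p"
    by (intro subspace_scale[OF subspace_tangent_space[OF A]] vector_fieldD(1)[OF A] assms)
  have "msmooth A p f" using assms(2) by (simp add: smooth_fun_iff[OF A])
  from msmooth_scaleR[OF this vector_fieldD(2)[OF A assms(3) c]] 
  show "\<exists>c\<in>A. p \<in> fst c \<and> msmooth A p (\<lambda>q. (f q *\<^sub>R X q) c)"
    using c by (auto simp: scaleR_fun_def)
qed

lemma smooth_fun_const: "smooth_manifold A \<Longrightarrow> smooth_fun A (\<lambda>q. c)"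
  by (simp add: smooth_fun_iff msmooth_const)

lemma vector_field_zero: "smooth_manifold A \<Longrightarrow> vector_field A (\<lambda>p. 0)"
  by (rule vector_fieldI) (auto simp: subspace_0 subspace_tangent_space msmooth_const intro: chart_at_props)

lemma vector_field_diff:
  assumes A: "smooth_manifold A" and "vector_field A X" "vector_field A Y"
  shows "vector_field A (\<lambda>p. X p - Y p)"
  using vector_field_add[OF A assms(2) vector_field_scale[OF A smooth_fun_const[OF A, of "-1"] assms(3)]]
  by simp

lemma vector_field_sum:
  assumes A: "smooth_manifold A" and "\<And>i. i \<in> I \<Longrightarrow> vector_field A (X i)"
  shows "vector_field A (\<lambda>p. \<Sum>i\<in>I. X i p)"
  using assms(2) by (induction I rule: infinite_finite_induct) (simp_all add: vector_field_zero
      vector_field_add A)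

lemma vector_field_local:
  assumes A: "smooth_manifold A" and loc: "\<And>p. \<exists>Y. vector_field A Y \<and> (\<forall>\<^sub>F q in nhds p. Y q = X q)"
  shows "vector_field A X"
proof (rule vector_fieldI[OF A])
  fix p
  note c = chart_at_props[OF A, of p]
  obtain Y where Y: "vector_field A Y" "\<forall>\<^sub>F q in nhds p. Y q = X q" using loc by blast
  show "X p \<in> tangent_space A p"
    using vector_fieldD(1)[OF A Y(1), of p] eventually_nhds_x_imp_x[OF Y(2)] by simp
  have "\<forall>\<^sub>F q in nhds p. Y q (chart_at A p) = X q (chart_at A p)" using Y(2) by eventually_elim simp
  from msmooth_cong[OF A this vector_fieldD(2)[OF A Y(1) c]]
  show "\<exists>c\<in>A. p \<in> fst c \<and> msmooth A p (\<lambda>q. X q c)" using c by blast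
qed

lemma dir_deriv_smooth_fun:
  assumes A: "smooth_manifold A" and "vector_field A X" "msmooth A p f"
  shows "msmooth A p (\<lambda>q. dir_deriv A q (X q) f)"
  by (rule msmooth_dir_deriv[OF A assms(3) chart_at_props[OF A], where Y = X])
     (simp_all add: vector_fieldD[OF A assms(2)] chart_at_props[OF A])

section \<open>Extension of germs\<close>

text \<open>The closed set \<open>K\<close> is part of the result because a product with an object
  that is smooth on \<open>U\<close> only is smooth everywhere: points outside \<open>U\<close> lie
  in the open complement of \<open>K\<close>, where the product is zero.\<close>

lemma bump_function:
  assumes A: "smooth_manifold A" and U: "open U" "p \<in> U"
  obtains \<beta> :: "'a::{t2_space, second_countable_topology} \<Rightarrow> real" and K
  where "smooth_fun A \<beta>" "\<forall>\<^sub>F q in nhds p. \<beta> q = 1" "closed K" "K \<subseteq> U" "\<And>q. q \<notin> K \<Longrightarrow> \<beta> q = 0"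
proof -
  let ?c = "chart_at A p"
  note c = chart_at_props[OF A, of p]
  note cD = chartD[OF A c(1)]
  have "open (snd ?c ` (U \<inter> fst ?c))" using U cD(1) by (intro open_chart_image[OF A c(1)]) auto
  moreover have "snd ?c p \<in> snd ?c ` (U \<inter> fst ?c)" using U c by auto
  ultimately obtain e where e: "e > 0" "cball (snd ?c p) e \<subseteq> snd ?c ` (U \<inter> fst ?c)"
    using open_contains_cball by blast
  \<comment> \<open>\<open>smooth_bump\<close> is known to vanish only outside twice its
    radius.\<close>
  define r where "r = e / 2"
  have r: "r > 0" "2 * r = e" using e(1) by (auto simp: r_def)
  obtain b where b: "smooth_on UNIV b" "\<And>y. y \<in> ball (snd ?c p) r \<Longrightarrow> b y = 1"
    "\<And>y. y \<notin> cball (snd ?c p) (2 * r) \<Longrightarrow> b y = (0::real)"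
    using smooth_bump[OF r(1), of "snd ?c p"] by metis
  define \<beta> where "\<beta> q = (if q \<in> fst ?c then b (snd ?c q) else 0)" for q
  define K where "K = chart_inv ?c ` cball (snd ?c p) e"
  have sub: "cball (snd ?c p) e \<subseteq> snd ?c ` fst ?c" using e(2) by auto
  have "continuous_on (cball (snd ?c p) e) (chart_inv ?c)"
    by (rule continuous_on_subset[OF cD(4) sub])
  \<comment> \<open>That the ball is closed in the model space would not make its image
    \<open>K\<close> closed in the manifold; compactness does, since the manifold is
    Hausdorff.\<close>
  then have "compact K" unfolding K_def by (rule compact_continuous_image[OF _ compact_cball_fin_dim])
  then have clK: "closed K" by (rule compact_imp_closed)
  have KU: "K \<subseteq> U \<inter> fst ?c"
  proof
    fix q assume "q \<in> K"
    then obtain y where y: "y \<in> cball (snd ?c p) e" "q = chart_inv ?c y" by (auto simp: K_def)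
    then obtain q' where "q' \<in> U \<inter> fst ?c" "y = snd ?c q'" using e(2) by blast
    then show "q \<in> U \<inter> fst ?c" using y cD(5) by auto
  qed
  have zero: "\<beta> q = 0" if "q \<notin> K" for q
  proof (cases "q \<in> fst ?c")
    case True
    then have "snd ?c q \<notin> cball (snd ?c p) e" using that cD(5)[OF True] unfolding K_def by (metis imageI)
    then show ?thesis using b(3) r by (simp add: \<beta>_def)
  qed (simp add: \<beta>_def)
  have "msmooth A q \<beta>" for q
  proof (cases "q \<in> fst ?c")
    case True
    have "smooth_at (snd ?c q) b" using b(1) by (auto intro: smooth_atI[OF open_UNIV])
    from msmooth_outer[OF A msmooth_chart[OF A c(1) True] this]
    have "msmooth A q (\<lambda>q. b (snd ?c q))" .
    moreover have "\<forall>\<^sub>F q' in nhds q. b (snd ?c q') = \<beta> q'"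
      using chart_eventually(1)[OF A c(1) True] by eventually_elim (simp add: \<beta>_def)
    ultimately show ?thesis by (rule msmooth_cong[OF A, rotated])
  next
    case False
    then have "q \<in> - K" using KU by auto
    then have "\<forall>\<^sub>F q' in nhds q. q' \<in> - K" using clK by (intro eventually_nhds_in_open) auto
    then have "\<forall>\<^sub>F q' in nhds q. 0 = \<beta> q'" by eventually_elim (simp add: zero)
    then show ?thesis by (rule msmooth_cong[OF A _ msmooth_const])
  qed
  then have 1: "smooth_fun A \<beta>" by (simp add: smooth_fun_iff[OF A])
  have "\<forall>\<^sub>F x in nhds (snd ?c p). x \<in> ball (snd ?c p) r"
    using r(1) by (intro eventually_nhds_in_open) auto
  from chart_eventually(4)[OF A c this] chart_eventually(1)[OF A c]
  have 2: "\<forall>\<^sub>F q in nhds p. \<beta> q = 1" by eventually_elim (simp add: \<beta>_def b(2))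
  show ?thesis using that[OF 1 2 clK _ zero] KU by blast
qed

lemma extend_function_germ:
  assumes A: "smooth_manifold A" and f: "msmooth A p f"
  obtains f' where "smooth_fun A f'" "\<forall>\<^sub>F q in nhds p. f' q = f q"
proof -
  obtain U where U: "open U" "p \<in> U" "\<And>q. q \<in> U \<Longrightarrow> msmooth A q f"
    using msmooth_eventually[OF A f] by (auto simp: eventually_nhds)
  obtain \<beta> :: "_ \<Rightarrow> real" and K
    where \<beta>: "smooth_fun A \<beta>" "\<forall>\<^sub>F q in nhds p. \<beta> q = 1" "closed K" "K \<subseteq> U" "\<And>q. q \<notin> K \<Longrightarrow> \<beta> q = 0"
    using bump_function[OF A U(1,2)] by metis
  have "msmooth A q (\<lambda>q. \<beta> q *\<^sub>R f q)" for q
  proof (cases "q \<in> U")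
    case True
    then show ?thesis using \<beta>(1) by (intro msmooth_scaleR U(3)) (simp add: smooth_fun_iff[OF A])
  next
    case False
    then have "\<forall>\<^sub>F q' in nhds q. q' \<in> - K" using \<beta>(3,4) by (intro eventually_nhds_in_open) auto
    then have "\<forall>\<^sub>F q' in nhds q. 0 = \<beta> q' *\<^sub>R f q'" by eventually_elim (simp add: \<beta>(5))
    then show ?thesis by (rule msmooth_cong[OF A _ msmooth_const])
  qed
  then have "smooth_fun A (\<lambda>q. \<beta> q *\<^sub>R f q)" by (simp add: smooth_fun_iff[OF A])
  moreover have "\<forall>\<^sub>F q in nhds p. \<beta> q *\<^sub>R f q = f q" using \<beta>(2) by eventually_elim simp
  ultimately show ?thesis by (rule that)
qed

lemma extend_field_germ:
  assumes A: "smooth_manifold A" and c: "c \<in> A" "p \<in> fst c"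
    and X: "msmooth A p (\<lambda>q. X q c)" "\<forall>\<^sub>F q in nhds p. X q \<in> tangent_space A q"
  obtains Y where "vector_field A Y" "\<forall>\<^sub>F q in nhds p. Y q = X q"
proof -
  have "\<forall>\<^sub>F q in nhds p. msmooth A q (\<lambda>q. X q c) \<and> q \<in> fst c \<and> X q \<in> tangent_space A q"
    using msmooth_eventually[OF A X(1)] chart_eventually(1)[OF A c] X(2) by eventually_elim simp
  then obtain U where U: "open U" "p \<in> U" "\<And>q. q \<in> U \<Longrightarrow> msmooth A q (\<lambda>q. X q c) \<and> q \<in> fst c \<and>
      X q \<in> tangent_space A q"
    by (auto simp: eventually_nhds)
  obtain \<beta> :: "_ \<Rightarrow> real" and K
    where \<beta>: "smooth_fun A \<beta>" "\<forall>\<^sub>F q in nhds p. \<beta> q = 1" "closed K" "K \<subseteq> U" "\<And>q. q \<notin> K \<Longrightarrow> \<beta> q = 0"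
    using bump_function[OF A U(1,2)] by metis
  have "vector_field A (\<lambda>q. \<beta> q *\<^sub>R X q)"
  proof (rule vector_fieldI[OF A])
    fix q
    show "\<beta> q *\<^sub>R X q \<in> tangent_space A q"
    proof (cases "q \<in> U")
      case True
      then show ?thesis using U by (intro subspace_scale[OF subspace_tangent_space[OF A]]) auto
    next
      case False
      then have "\<beta> q = 0" using \<beta> by auto
      then show ?thesis by (simp add: subspace_0[OF subspace_tangent_space[OF A]])
    qed
    show "\<exists>c\<in>A. q \<in> fst c \<and> msmooth A q (\<lambda>q. (\<beta> q *\<^sub>R X q) c)"
    proof (cases "q \<in> U")
      case True
      have "msmooth A q (\<lambda>q. \<beta> q *\<^sub>R X q c)"
        using True \<beta>(1) U by (intro msmooth_scaleR) (simp_all add: smooth_fun_iff[OF A])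
      then show ?thesis using True U c by (auto simp: scaleR_fun_def)
    next
      case False
      then have "\<forall>\<^sub>F q' in nhds q. q' \<in> - K" using \<beta>(3,4) by (intro eventually_nhds_in_open) auto
      then have "\<forall>\<^sub>F q' in nhds q. 0 = (\<beta> q' *\<^sub>R X q') (chart_at A q)" by eventually_elim (simp add: \<beta>(5))
      then have "msmooth A q (\<lambda>q'. (\<beta> q' *\<^sub>R X q') (chart_at A q))"
        by (rule msmooth_cong[OF A _ msmooth_const])
      then show ?thesis using chart_at_props[OF A, of q] by blast
    qed
  qed
  moreover have "\<forall>\<^sub>F q in nhds p. \<beta> q *\<^sub>R X q = X q" using \<beta>(2) by eventually_elim simp
  ultimately show ?thesis by (rule that)
qed

text \<open>The vectors with constant coordinates \<open>w\<close> form a smooth germ, which extends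
  to a global field, so the choice in \<open>coord_field\<close> is not void. Any choice has the
  same germ at \<open>p\<close>, since the coordinates in \<open>c\<close> determine a tangent
  vector.\<close>

lemma coord_field:
  assumes A: "smooth_manifold A" and c: "c \<in> A" "p \<in> fst c"
  shows "vector_field A (coord_field A c p w)"
    "\<forall>\<^sub>F q in nhds p. coord_field A c p w q c = w"
    "\<forall>\<^sub>F q in nhds p. coord_field A c p w q = tangent_of A c q w"
    "coord_field A c p w p = tangent_of A c p w"
proof -
  have ev: "\<forall>\<^sub>F q in nhds p. tangent_of A c q w c = w" "\<forall>\<^sub>F q in nhds p. tangent_of A c q w \<in> tangent_space
      A q"
    using chart_eventually(1)[OF A c] by (eventually_elim; simp add: tangent_of[OF A c(1)])+
  have "\<forall>\<^sub>F q in nhds p. w = tangent_of A c q w c" using ev(1) by eventually_elim simp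
  then have "msmooth A p (\<lambda>q. tangent_of A c q w c)" by (rule msmooth_cong[OF A _ msmooth_const])
  from extend_field_germ[OF A c this ev(2)] obtain Y where
    Y: "vector_field A Y" "\<forall>\<^sub>F q in nhds p. Y q = tangent_of A c q w" .
  have "\<forall>\<^sub>F q in nhds p. Y q c = w" using Y(2) ev(1) by eventually_elim simp
  then have "\<exists>X. vector_field A X \<and> (\<forall>\<^sub>F q in nhds p. X q c = w)" using Y(1) by blast
  from someI_ex[OF this, folded coord_field_def]
  have 1: "vector_field A (coord_field A c p w)" "\<forall>\<^sub>F q in nhds p. coord_field A c p w q c = w" by auto
  have 2: "\<forall>\<^sub>F q in nhds p. coord_field A c p w q = tangent_of A c q w"
    using 1(2) chart_eventually(1)[OF A c]
    by eventually_elim (metis tangent_eq_tangent_of vector_fieldD(1)[OF A 1(1)] c(1))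
  show "vector_field A (coord_field A c p w)" "\<forall>\<^sub>F q in nhds p. coord_field A c p w q c = w"
    "\<forall>\<^sub>F q in nhds p. coord_field A c p w q = tangent_of A c q w" 
    "coord_field A c p w p = tangent_of A c p w"
    using 1 2 eventually_nhds_x_imp_x[OF 2] by auto
qed

lemma extend:
  assumes A: "smooth_manifold A" and v: "v \<in> tangent_space A p"
  shows "vector_field A (extend A p v)" "extend A p v p = v"
proof -
  note c = chart_at_props[OF A, of p]
  have "coord_field A (chart_at A p) p (v (chart_at A p)) p = v"
    using coord_field(4)[OF A c] tangent_eq_tangent_of[OF v c] by metis
  then have "\<exists>X. vector_field A X \<and> X p = v" using coord_field(1)[OF A c] by blast
  from someI_ex[OF this, folded extend_def]
  show "vector_field A (extend A p v)" "extend A p v p = v" by auto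
qed

text \<open>The coefficients are the coordinates of \<open>Y\<close> in \<open>c\<close>, extended
  from germs to all of \<open>A\<close> because the axioms of a connection admit only globally
  smooth functions.\<close>

lemma local_frame:
  assumes A: "smooth_manifold A" and c: "c \<in> A" "p \<in> fst c" and Y: "vector_field A Y"
  obtains f where "\<And>b. smooth_fun A (f b)" "\<forall>\<^sub>F q in nhds p. \<forall>b. f b q = Y q c \<bullet> b"
    "\<forall>\<^sub>F q in nhds p. Y q = (\<Sum>b\<in>onb. f b q *\<^sub>R coord_field A c p b q)"
proof -
  obtain g where g: "smooth_fun A g" "\<forall>\<^sub>F q in nhds p. g q = Y q c"
    by (rule extend_function_germ[OF A vector_fieldD(2)[OF A Y c]])
  have 1: "smooth_fun A (\<lambda>q. g q \<bullet> b)" for b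
    using g(1) by (simp add: smooth_fun_iff[OF A] msmooth_inner_left)
  have 2: "\<forall>\<^sub>F q in nhds p. \<forall>b. g q \<bullet> b = Y q c \<bullet> b" using g(2) by eventually_elim simp
  have "\<forall>\<^sub>F q in nhds p. \<forall>b\<in>onb. coord_field A c p b q = tangent_of A c q b"
    by (simp add: eventually_ball_finite_distrib coord_field(3)[OF A c])
  with g(2) chart_eventually(1)[OF A c]
  have 3: "\<forall>\<^sub>F q in nhds p. Y q = (\<Sum>b\<in>onb. (g q \<bullet> b) *\<^sub>R coord_field A c p b q)"
  proof eventually_elim
    case (elim q)
    have "Y q = tangent_of A c q (Y q c)"
      by (rule tangent_eq_tangent_of[OF vector_fieldD(1)[OF A Y] c(1) elim(2)])
    also have "\<dots> = (\<Sum>b\<in>onb. (Y q c \<bullet> b) *\<^sub>R tangent_of A c q b)"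
      by (rule linear_onb_sum[OF linear_tangent_of[OF A c(1) elim(2)]])
    also have "\<dots> = (\<Sum>b\<in>onb. (g q \<bullet> b) *\<^sub>R coord_field A c p b q)"
      using elim by (intro sum.cong) auto
    finally show ?case .
  qed
  show ?thesis by (rule that[OF 1 2 3])
qed

lemma additive_operator_sum:
  fixes \<Phi> :: "('a::{t2_space, second_countable_topology}, 'e::fin_dim) field \<Rightarrow> 'w::comm_monoid_add"
  assumes A: "smooth_manifold A"
    and add: "\<And>Y Z. vector_field A Y \<Longrightarrow> vector_field A Z \<Longrightarrow> \<Phi> (\<lambda>q. Y q + Z q) = \<Phi> Y + \<Phi> Z"
    and zero: "\<Phi> (\<lambda>q. 0) = 0" and X: "\<And>i. vector_field A (X i)"
  shows "\<Phi> (\<lambda>q. \<Sum>i\<in>I. X i q) = (\<Sum>i\<in>I. \<Phi> (X i))"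
proof (induction I rule: infinite_finite_induct)
  case (insert i I)
  have "\<Phi> (\<lambda>q. X i q + (\<Sum>i\<in>I. X i q)) = \<Phi> (X i) + \<Phi> (\<lambda>q. \<Sum>i\<in>I. X i q)"
    by (rule add[OF X vector_field_sum[OF A X]])
  then show ?case by (simp only: sum.insert[OF insert.hyps] insert.IH)
qed (simp_all only: sum.infinite sum.empty zero not_False_eq_True)

text \<open>Multiplying both fields by a bump function supported where they agree makes them equal
  everywhere. The hypothesis \<open>loc\<close> is phrased so as to cover operators linear over
  functions and derivations alike: a derivative of \<open>f\<close> at \<open>p\<close> vanishes
  when \<open>f\<close> is 1 near \<open>p\<close>.\<close>

lemma local_operator:
  fixes \<Phi> :: "('a::{t2_space, second_countable_topology}, 'e::fin_dim) field \<Rightarrow> 'w"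
  assumes A: "smooth_manifold A"
    and loc: "\<And>f Y. smooth_fun A f \<Longrightarrow> vector_field A Y \<Longrightarrow> \<forall>\<^sub>F q in nhds p. f q = 1 \<Longrightarrow> \<Phi> (\<lambda>q. f q *\<^sub>R Y q) =
        \<Phi> Y"
    and Y: "vector_field A Y" "vector_field A Z" "\<forall>\<^sub>F q in nhds p. Y q = Z q"
  shows "\<Phi> Y = \<Phi> Z"
proof -
  obtain U where U: "open U" "p \<in> U" "\<And>q. q \<in> U \<Longrightarrow> Y q = Z q"
    using Y(3) by (auto simp: eventually_nhds)
  obtain \<beta> :: "_ \<Rightarrow> real" and K
    where \<beta>: "smooth_fun A \<beta>" "\<forall>\<^sub>F q in nhds p. \<beta> q = 1" "closed K" "K \<subseteq> U" "\<And>q. q \<notin> K \<Longrightarrow> \<beta> q = 0"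
    using bump_function[OF A U(1,2)] by metis
  have "(\<lambda>q. \<beta> q *\<^sub>R Y q) = (\<lambda>q. \<beta> q *\<^sub>R Z q)"
  proof
    fix q
    show "\<beta> q *\<^sub>R Y q = \<beta> q *\<^sub>R Z q" using \<beta>(4,5) U(3) by (cases "q \<in> K") auto
  qed
  then show ?thesis using loc[OF \<beta>(1) Y(1) \<beta>(2)] loc[OF \<beta>(1) Y(2) \<beta>(2)] by metis
qed

text \<open>After localization the field may be replaced by its expansion in a local frame;
  linearity over functions then leaves only the values of the coefficients at
  \<open>p\<close>.\<close>

lemma tensorial_operator:
  fixes \<Phi> :: "('a::{t2_space, second_countable_topology}, 'e::fin_dim) field \<Rightarrow> 'w::real_vector"
  assumes A: "smooth_manifold A"
    and add: "\<And>Y Z. vector_field A Y \<Longrightarrow> vector_field A Z \<Longrightarrow> \<Phi> (\<lambda>q. Y q + Z q) = \<Phi> Y + \<Phi> Z"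
    and scl: "\<And>f Y. smooth_fun A f \<Longrightarrow> vector_field A Y \<Longrightarrow> \<Phi> (\<lambda>q. f q *\<^sub>R Y q) = f p *\<^sub>R \<Phi> Y"
    and Y: "vector_field A Y" "vector_field A Z" "Y p = Z p"
  shows "\<Phi> Y = \<Phi> Z"
proof -
  let ?c = "chart_at A p"
  note c = chart_at_props[OF A, of p]
  have zero: "\<Phi> (\<lambda>q. 0) = 0"
    using scl[OF smooth_fun_const[OF A, of 0] vector_field_zero[OF A]] by simp
  have *: "\<Phi> Y = (\<Sum>b\<in>onb. (Y p ?c \<bullet> b) *\<^sub>R \<Phi> (coord_field A ?c p b))" if Y: "vector_field A Y" for Y
  proof -
    obtain f where f: "\<And>b. smooth_fun A (f b)" "\<forall>\<^sub>F q in nhds p. \<forall>b. f b q = Y q ?c \<bullet> b"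
      "\<forall>\<^sub>F q in nhds p. Y q = (\<Sum>b\<in>onb. f b q *\<^sub>R coord_field A ?c p b q)"
      by (rule local_frame[OF A c Y], rule that)
    have vf: "vector_field A (\<lambda>q. f b q *\<^sub>R coord_field A ?c p b q)" for b
      by (intro vector_field_scale A f coord_field c)
    have "\<Phi> Y = \<Phi> (\<lambda>q. \<Sum>b\<in>onb. f b q *\<^sub>R coord_field A ?c p b q)"
    proof (rule local_operator[OF A, where \<Phi> = \<Phi>])
      fix f Y assume "smooth_fun A f" "vector_field A Y" "\<forall>\<^sub>F q in nhds p. f q = (1::real)"
      then show "\<Phi> (\<lambda>q. f q *\<^sub>R Y q) = \<Phi> Y" using scl eventually_nhds_x_imp_x by fastforce
    qed (use Y f(3) in \<open>auto intro: vector_field_sum A vf\<close>)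
    also have "\<dots> = (\<Sum>b\<in>onb. \<Phi> (\<lambda>q. f b q *\<^sub>R coord_field A ?c p b q))"
      by (rule additive_operator_sum[OF A add zero vf])
    also have "\<dots> = (\<Sum>b\<in>onb. (Y p ?c \<bullet> b) *\<^sub>R \<Phi> (coord_field A ?c p b))"
      using eventually_nhds_x_imp_x[OF f(2)] by (simp add: scl f coord_field A c)
    finally show ?thesis .
  qed
  show ?thesis using *[OF Y(1)] *[OF Y(2)] Y(3) by simp
qed

section \<open>Connections\<close>

lemma connectionD:
  assumes "connection A D"
  shows "vector_field A X \<Longrightarrow> vector_field A Y \<Longrightarrow> vector_field A (D X Y)"
    "vector_field A X \<Longrightarrow> vector_field A X' \<Longrightarrow> vector_field A Y \<Longrightarrow>
      D (\<lambda>p. X p + X' p) Y = (\<lambda>p. D X Y p + D X' Y p)"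
    "smooth_fun A f \<Longrightarrow> vector_field A X \<Longrightarrow> vector_field A Y \<Longrightarrow>
      D (\<lambda>p. f p *\<^sub>R X p) Y = (\<lambda>p. f p *\<^sub>R D X Y p)"
    "vector_field A X \<Longrightarrow> vector_field A Y \<Longrightarrow> vector_field A Y' \<Longrightarrow>
      D X (\<lambda>p. Y p + Y' p) = (\<lambda>p. D X Y p + D X Y' p)"
    "smooth_fun A f \<Longrightarrow> vector_field A X \<Longrightarrow> vector_field A Y \<Longrightarrow>
      D X (\<lambda>p. f p *\<^sub>R Y p) = (\<lambda>p. dir_deriv A p (X p) f *\<^sub>R Y p + f p *\<^sub>R D X Y p)"
    "vector_field A X \<Longrightarrow> vector_field A Y \<Longrightarrow> (\<lambda>p. D X Y p - D Y X p) = lie_bracket A X Y"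
  using assms unfolding connection_def by blast+

lemma connection_cong_right:
  assumes A: "smooth_manifold A" and D: "connection A D" and X: "vector_field A X"
    and Y: "vector_field A Y" "vector_field A Z" "\<forall>\<^sub>F q in nhds p. Y q = Z q"
  shows "D X Y p = D X Z p"
proof (rule local_operator[OF A _ Y, where \<Phi> = "\<lambda>Y. D X Y p"])
  fix f Y assume f: "smooth_fun A f" "vector_field A Y" "\<forall>\<^sub>F q in nhds p. f q = (1::real)"
  have "dir_deriv A p (X p) f = 0"
    using dir_deriv_cong[OF A f(3)] by (simp add: dir_deriv_const)
  then show "D X (\<lambda>q. f q *\<^sub>R Y q) p = D X Y p"
    using connectionD(5)[OF D f(1) X f(2)] eventually_nhds_x_imp_x[OF f(3)] by simp
qed

lemma connection_cong_left:
  assumes A: "smooth_manifold A" and D: "connection A D" and Y: "vector_field A Y"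
    and X: "vector_field A X" "vector_field A X'" "X p = X' p"
  shows "D X Y p = D X' Y p"
  by (rule tensorial_operator[OF A _ _ X, where \<Phi> = "\<lambda>X. D X Y p"])
     (simp_all add: connectionD(2,3)[OF D _ _ Y])

lemma connection_sum_right:
  assumes A: "smooth_manifold A" and D: "connection A D" and X: "vector_field A X"
    and Y: "\<And>i. vector_field A (Y i)"
  shows "D X (\<lambda>q. \<Sum>i\<in>I. Y i q) p = (\<Sum>i\<in>I. D X (Y i) p)"
proof -
  have zero: "D X (\<lambda>q. 0) p = 0"
    using connectionD(5)[OF D smooth_fun_const[OF A, of 0] X vector_field_zero[OF A]]
    by (simp add: dir_deriv_const)
  show ?thesis
    by (rule additive_operator_sum[where \<Phi> = "\<lambda>Y. D X Y p", OF A _ zero Y])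
       (simp only: connectionD(4)[OF D X])
qed

text \<open>\<open>coord_field\<close> is chosen separately for each \<open>w\<close>, so linearity
  is not built in. It holds for the germs, which are those of \<open>tangent_of A c q w\<close>, and
  the connection sees only germs.\<close>

lemma linear_christoffel:
  assumes A: "smooth_manifold A" and D: "connection A D" and c: "c \<in> A" "p \<in> fst c"
    and u: "u \<in> tangent_space A p"
  shows "linear (christoffel A D c p u)"
proof (rule linearI)
  note E = coord_field[OF A c]
  note X = extend(1)[OF A u]
  fix w w' r
  have "D (extend A p u) (coord_field A c p (w + w')) p =
     D (extend A p u) (\<lambda>q. coord_field A c p w q + coord_field A c p w' q) p"
  proof (rule connection_cong_right[OF A D X E(1) vector_field_add[OF A E(1) E(1)]])
    show "\<forall>\<^sub>F q in nhds p. coord_field A c p (w + w') q = coord_field A c p w q + coord_field A c p w' q"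
      using E(3)[of w] E(3)[of w'] E(3)[of "w + w'"] chart_eventually(1)[OF A c]
      by eventually_elim (simp add: linear_add[OF linear_tangent_of[OF A c(1)]])
  qed
  then show "christoffel A D c p u (w + w') = christoffel A D c p u w + christoffel A D c p u w'"
    by (simp add: christoffel_def connectionD(4)[OF D X E(1) E(1)])
  have "D (extend A p u) (coord_field A c p (r *\<^sub>R w)) p =
     D (extend A p u) (\<lambda>q. r *\<^sub>R coord_field A c p w q) p"
  proof (rule connection_cong_right[OF A D X E(1) vector_field_scale[OF A smooth_fun_const[OF A] E(1)]])
    show "\<forall>\<^sub>F q in nhds p. coord_field A c p (r *\<^sub>R w) q = r *\<^sub>R coord_field A c p w q"
      using E(3)[of w] E(3)[of "r *\<^sub>R w"] chart_eventually(1)[OF A c]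
      by eventually_elim (simp add: linear_scale[OF linear_tangent_of[OF A c(1)]])
  qed
  also have "\<dots> = r *\<^sub>R D (extend A p u) (coord_field A c p w) p"
    by (simp add: connectionD(5)[OF D smooth_fun_const[OF A] X E(1)] dir_deriv_const)
  finally show "christoffel A D c p u (r *\<^sub>R w) = r *\<^sub>R christoffel A D c p u w"
    by (simp add: christoffel_def scaleR_fun_def)
qed

text \<open>This coordinate formula ties \<open>christoffel\<close>, and thereby the coordinate
  definition of \<open>pullback_deriv\<close>, back to the operator \<open>D\<close>.\<close>

lemma connection_christoffel:
  assumes A: "smooth_manifold A" and D: "connection A D" and c: "c \<in> A" "p \<in> fst c"
    and X: "vector_field A X" and Y: "vector_field A Y"
  shows "D X Y p c = dir_deriv A p (X p) (\<lambda>q. Y q c) + christoffel A D c p (X p) (Y p c)"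
proof -
  note E = coord_field[OF A c]
  note Xp = vector_fieldD(1)[OF A X]
  obtain f where f: "\<And>b. smooth_fun A (f b)" "\<forall>\<^sub>F q in nhds p. \<forall>b. f b q = Y q c \<bullet> b"
      "\<forall>\<^sub>F q in nhds p. Y q = (\<Sum>b\<in>onb. f b q *\<^sub>R coord_field A c p b q)"
    by (rule local_frame[OF A c Y], rule that)
  have fd: "mdiff A p (f b)" for b
    using f(1) by (simp add: smooth_fun_iff[OF A] msmooth_imp_mdiff)
  have vf: "vector_field A (\<lambda>q. f b q *\<^sub>R coord_field A c p b q)" for b
    by (rule vector_field_scale[OF A f(1) E(1)])
  have DE: "D X (coord_field A c p b) p c = christoffel A D c p (X p) b" for b
    unfolding christoffel_def
    by (subst connection_cong_left[OF A D E(1) X extend(1)[OF A Xp] extend(2)[OF A Xp, symmetric]])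
        (rule refl)
  have Ec: "coord_field A c p b p c = b" for b
    using eventually_nhds_x_imp_x[OF E(2)] .
  have "D X Y p = D X (\<lambda>q. \<Sum>b\<in>onb. f b q *\<^sub>R coord_field A c p b q) p"
    by (rule connection_cong_right[OF A D X Y vector_field_sum[OF A vf] f(3)])
  also have "\<dots> = (\<Sum>b\<in>onb. dir_deriv A p (X p) (f b) *\<^sub>R coord_field A c p b p +
      f b p *\<^sub>R D X (coord_field A c p b) p)"
    by (simp add: connection_sum_right[OF A D X vf] connectionD(5)[OF D f(1) X E(1)])
  finally have "D X Y p c = (\<Sum>b\<in>onb. dir_deriv A p (X p) (f b) *\<^sub>R b) +
      (\<Sum>b\<in>onb. f b p *\<^sub>R christoffel A D c p (X p) b)"
    by (simp add: sum_fun_apply scaleR_fun_def DE Ec sum.distrib)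
  moreover have "(\<Sum>b\<in>onb. f b p *\<^sub>R christoffel A D c p (X p) b) = christoffel A D c p (X p) (Y p c)"
    using eventually_nhds_x_imp_x[OF f(2)] linear_onb_sum[OF linear_christoffel[OF A D c Xp], of "Y p c"]
    by simp
  moreover have "dir_deriv A p (X p) (\<lambda>q. Y q c) = (\<Sum>b\<in>onb. dir_deriv A p (X p) (f b) *\<^sub>R b)"
  proof -
    have "\<forall>\<^sub>F q in nhds p. Y q c = (\<Sum>b\<in>onb. f b q *\<^sub>R b)"
      using f(2) by eventually_elim (simp add: onb_sum)
    then have "dir_deriv A p (X p) (\<lambda>q. Y q c) = dir_deriv A p (X p) (\<lambda>q. \<Sum>b\<in>onb. f b q *\<^sub>R b)"
      by (rule dir_deriv_cong[OF A])
    also have "\<dots> = (\<Sum>b\<in>onb. dir_deriv A p (X p) (f b) *\<^sub>R b)"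
      by (simp add: dir_deriv_sum[OF A] mdiff_scaleR[OF fd mdiff_const]
          dir_deriv_scaleR[OF A fd mdiff_const] dir_deriv_const)
    finally show ?thesis .
  qed
  ultimately show ?thesis by simp
qed

text \<open>Vanishing torsion: coordinate fields have locally constant coordinates, hence zero Lie
  bracket at \<open>p\<close>, so their covariant derivatives along each other coincide
  there.\<close>

lemma christoffel_symmetric:
  assumes A: "smooth_manifold A" and D: "connection A D" and c: "c \<in> A" "p \<in> fst c"
    and u: "u \<in> tangent_space A p" and v: "v \<in> tangent_space A p"
  shows "christoffel A D c p u (v c) = christoffel A D c p v (u c)"
proof -
  note E = coord_field[OF A c]
  let ?U = "coord_field A c p (u c)" and ?V = "coord_field A c p (v c)"
  have val: "?U p = u" "?V p = v"
    using E(4) tangent_eq_tangent_of[OF u c] tangent_eq_tangent_of[OF v c] by simp_all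
  have const: "dir_deriv A p w (\<lambda>q. coord_field A c p x q c) = 0" for w x
    using dir_deriv_cong[OF A E(2)] by (simp add: dir_deriv_const)
  have "D ?U ?V p c = christoffel A D c p u (v c)" "D ?V ?U p c = christoffel A D c p v (u c)"
    using connection_christoffel[OF A D c E(1) E(1), of "u c" "v c"]
      connection_christoffel[OF A D c E(1) E(1), of "v c" "u c"] by (simp_all add: const val)
  moreover have "D ?U ?V p - D ?V ?U p = lie_bracket A ?U ?V p"
    by (rule fun_cong[OF connectionD(6)[OF D E(1) E(1)]])
  moreover have "lie_bracket A ?U ?V p c = 0" by (simp add: lie_bracket_def const)
  ultimately show ?thesis by (metis eq_iff_diff_eq_0 minus_apply)
qed

section \<open>Covariant derivatives along maps\<close>

text \<open>Fields along \<open>F\<close> that are differentiable at the single point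
  \<open>q\<close>, the regularity under which \<open>pullback_deriv\<close> at \<open>q\<close> is
  additive and obeys the Leibniz rule.\<close>

definition section_diff ::
  "('a, 'e::real_normed_vector) chart set \<Rightarrow> ('b, 'f::real_normed_vector) chart set \<Rightarrow>
   ('a \<Rightarrow> 'b) \<Rightarrow> 'a \<Rightarrow> ('a \<Rightarrow> ('b, 'f) tvec) \<Rightarrow> bool" where
  "section_diff A B F q W \<longleftrightarrow> W q \<in> tangent_space B (F q) \<and>
     (\<forall>c\<in>B. F q \<in> fst c \<longrightarrow> mdiff A q (\<lambda>x. W x c))"

lemma section_diffD:
  assumes "section_diff A B F q W"
  shows "W q \<in> tangent_space B (F q)" "c \<in> B \<Longrightarrow> F q \<in> fst c \<Longrightarrow> mdiff A q (\<lambda>x. W x c)"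
  using assms by (auto simp: section_diff_def)

lemma section_diff_add:
  assumes "smooth_manifold B" "section_diff A B F q W" "section_diff A B F q V"
  shows "section_diff A B F q (\<lambda>x. W x + V x)"
  using assms subspace_add[OF subspace_tangent_space[OF assms(1)]]
  by (simp add: section_diff_def mdiff_add)

lemma section_diff_scale:
  assumes "smooth_manifold B" "mdiff A q f" "section_diff A B F q W"
  shows "section_diff A B F q (\<lambda>x. f x *\<^sub>R W x)"
  using assms subspace_scale[OF subspace_tangent_space[OF assms(1)]]
  by (simp add: section_diff_def scaleR_fun_def mdiff_scaleR)

lemma section_diff_sum:
  assumes "smooth_manifold B" "\<And>i. i \<in> I \<Longrightarrow> section_diff A B F q (W i)"
  shows "section_diff A B F q (\<lambda>x. \<Sum>i\<in>I. W i x)"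
  using assms(2) subspace_0[OF subspace_tangent_space[OF assms(1)]]
proof (induction I rule: infinite_finite_induct)
  case (insert i I)
  then have "section_diff A B F q (\<lambda>x. W i x + (\<Sum>i\<in>I. W i x))"
    by (intro section_diff_add[OF assms(1)]) auto
  then show ?case by (simp only: sum.insert[OF insert.hyps])
qed (simp_all add: section_diff_def mdiff_const)

lemma pullback_deriv_apply:
  "c \<in> B \<Longrightarrow> F q \<in> fst c \<Longrightarrow> pullback_deriv A B D F q v W c =
     dir_deriv A q v (\<lambda>x. W x c) + christoffel B D c (F q) (differential A B F q v) (W q c)"
  "c \<notin> B \<or> F q \<notin> fst c \<Longrightarrow> pullback_deriv A B D F q v W c = 0"
  by (auto simp: pullback_deriv_def)

lemma pullback_deriv_cong:
  assumes "smooth_manifold A" "\<forall>\<^sub>F x in nhds q. W x = V x"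
  shows "pullback_deriv A B D F q v W = pullback_deriv A B D F q v V"
proof
  fix c
  have "\<forall>\<^sub>F x in nhds q. W x c = V x c" using assms(2) by eventually_elim simp
  from dir_deriv_cong[OF assms(1) this] eventually_nhds_x_imp_x[OF this]
  show "pullback_deriv A B D F q v W c = pullback_deriv A B D F q v V c"
    by (simp add: pullback_deriv_def)
qed

context
  fixes A :: "('a::{t2_space, second_countable_topology}, 'e::fin_dim) chart set"
    and B :: "('b::{t2_space, second_countable_topology}, 'f::fin_dim) chart set"
    and D F q
  assumes A: "smooth_manifold A" and B: "smooth_manifold B" and D: "connection B D"
    and F: "map_smooth_at A B q F"
begin

lemma pullback_deriv_add:
  assumes "section_diff A B F q W" "section_diff A B F q V"
  shows "pullback_deriv A B D F q v (\<lambda>x. W x + V x) =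
    pullback_deriv A B D F q v W + pullback_deriv A B D F q v V"
proof
  fix c
  show "pullback_deriv A B D F q v (\<lambda>x. W x + V x) c =
    (pullback_deriv A B D F q v W + pullback_deriv A B D F q v V) c"
  proof (cases "c \<in> B \<and> F q \<in> fst c")
    case True
    then have c: "c \<in> B" "F q \<in> fst c" by auto
    show ?thesis
      using dir_deriv_add[OF A section_diffD(2)[OF assms(1) c] section_diffD(2)[OF assms(2) c]]
        linear_add[OF linear_christoffel[OF B D c differential_tangent[OF A B F]]]
      by (simp add: pullback_deriv_apply(1) c)
  qed (simp add: pullback_deriv_apply(2))
qed

lemma pullback_deriv_scale:
  assumes "mdiff A q f" "section_diff A B F q W"
  shows "pullback_deriv A B D F q v (\<lambda>x. f x *\<^sub>R W x) =
    dir_deriv A q v f *\<^sub>R W q + f q *\<^sub>R pullback_deriv A B D F q v W"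
proof
  fix c
  show "pullback_deriv A B D F q v (\<lambda>x. f x *\<^sub>R W x) c =
    (dir_deriv A q v f *\<^sub>R W q + f q *\<^sub>R pullback_deriv A B D F q v W) c"
  proof (cases "c \<in> B \<and> F q \<in> fst c")
    case True
    then have c: "c \<in> B" "F q \<in> fst c" by auto
    show ?thesis
      using dir_deriv_scaleR[OF A assms(1) section_diffD(2)[OF assms(2) c]]
        linear_scale[OF linear_christoffel[OF B D c differential_tangent[OF A B F]]]
      by (simp add: pullback_deriv_apply(1) c scaleR_fun_def scaleR_add_right)
  next
    case False
    then show ?thesis
      using tangent_outside[OF section_diffD(1)[OF assms(2)]]
      by (simp add: pullback_deriv_apply(2) scaleR_fun_def)
  qed
qed

lemma pullback_deriv_zero: "pullback_deriv A B D F q v (\<lambda>x. 0) = 0"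
proof
  fix c
  show "pullback_deriv A B D F q v (\<lambda>x. 0) c = 0 c"
    using linear_0[OF linear_christoffel[OF B D _ _ differential_tangent[OF A B F]]]
    by (cases "c \<in> B \<and> F q \<in> fst c") (simp_all add: pullback_deriv_apply dir_deriv_const)
qed

lemma pullback_deriv_sum:
  assumes "\<And>i. i \<in> I \<Longrightarrow> section_diff A B F q (W i)"
  shows "pullback_deriv A B D F q v (\<lambda>x. \<Sum>i\<in>I. W i x) = (\<Sum>i\<in>I. pullback_deriv A B D F q v (W i))"
  using assms
proof (induction I rule: infinite_finite_induct)
  case (insert i I)
  have "pullback_deriv A B D F q v (\<lambda>x. \<Sum>i\<in>insert i I. W i x) =
      pullback_deriv A B D F q v (\<lambda>x. W i x + (\<Sum>i\<in>I. W i x))"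
    by (simp only: sum.insert[OF insert.hyps])
  also have "\<dots> = pullback_deriv A B D F q v (W i) + pullback_deriv A B D F q v (\<lambda>x. \<Sum>i\<in>I. W i x)"
    by (intro pullback_deriv_add section_diff_sum[OF B] insert.prems) auto
  also have "\<dots> = (\<Sum>i\<in>insert i I. pullback_deriv A B D F q v (W i))"
    using insert.IH insert.prems by (simp only: sum.insert[OF insert.hyps]) auto
  finally show ?case .
qed (simp_all add: pullback_deriv_zero)

end

lemma pullback_deriv_comp:
  assumes A: "smooth_manifold A" and B: "smooth_manifold B" and C: "smooth_manifold C"
    and F: "map_smooth_at A B q F" and G: "map_smooth_at B C (F q) G" and S: "section_diff B C G (F q) S"
  shows "pullback_deriv A C D (\<lambda>x. G (F x)) q v (\<lambda>x. S (F x)) =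
    pullback_deriv B C D G (F q) (differential A B F q v) S"
proof
  fix c
  show "pullback_deriv A C D (\<lambda>x. G (F x)) q v (\<lambda>x. S (F x)) c =
    pullback_deriv B C D G (F q) (differential A B F q v) S c"
  proof (cases "c \<in> C \<and> G (F q) \<in> fst c")
    case True
    then have c: "c \<in> C" "G (F q) \<in> fst c" by auto
    show ?thesis
      using dir_deriv_comp(1)[OF A B F section_diffD(2)[OF S c]] differential_comp[OF A B F G]
      by (simp add: pullback_deriv_apply(1) c)
  qed (simp add: pullback_deriv_apply(2))
qed

lemma section_diff_comp:
  assumes A: "smooth_manifold A" and B: "smooth_manifold B"
    and F: "map_smooth_at A B q F" and S: "section_diff B C G (F q) S"
  shows "section_diff A C (\<lambda>x. G (F x)) q (\<lambda>x. S (F x))"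
  using section_diffD[OF S] dir_deriv_comp(2)[OF A B F, of "\<lambda>x. S x c" for c]
  by (simp add: section_diff_def)

lemma section_diff_field:
  assumes B: "smooth_manifold B" and E: "vector_field B E"
  shows "section_diff B B (\<lambda>x. x) p E"
  using vector_fieldD[OF B E] by (simp add: section_diff_def msmooth_imp_mdiff)

text \<open>\<open>pullback_deriv_comp\<close> reduces the claim to the identity map, where the
  coordinate formula of the pulled-back connection is that of \<open>D\<close>. The field
  \<open>X\<close> enters only through its value at \<open>F q\<close>.\<close>

lemma pullback_deriv_field:
  assumes A: "smooth_manifold A" and B: "smooth_manifold B" and D: "connection B D"
    and F: "map_smooth_at A B q F" and E: "vector_field B E" 
    and X: "vector_field B X" "X (F q) = differential A B F q v"
  shows "pullback_deriv A B D F q v (\<lambda>x. E (F x)) = D X E (F q)"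
proof -
  let ?u = "differential A B F q v"
  note u = differential_tangent[OF A B F, of v]
  have "pullback_deriv A B D F q v (\<lambda>x. E (F x)) = pullback_deriv B B D (\<lambda>x. x) (F q) ?u E"
    using pullback_deriv_comp[OF A B B F map_smooth_at_id[OF B] section_diff_field[OF B E]] .
  also have "\<dots> = D X E (F q)"
  proof
    fix c
    show "pullback_deriv B B D (\<lambda>x. x) (F q) ?u E c = D X E (F q) c"
    proof (cases "c \<in> B \<and> F q \<in> fst c")
      case True
      then have c: "c \<in> B" "F q \<in> fst c" by auto
      show ?thesis
        using connection_christoffel[OF B D c X(1) E] X(2) differential_id[OF B u]
        by (simp add: pullback_deriv_apply(1) c)
    next
      case False
      then show ?thesis
        using tangent_outside[OF vector_fieldD(1)[OF B connectionD(1)[OF D X(1) E]]]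
        by (simp add: pullback_deriv_apply(2))
    qed
  qed
  finally show ?thesis .
qed

section \<open>The second fundamental form\<close>

lemma msmooth_differential:
  assumes A: "smooth_manifold A" and B: "smooth_manifold B" and F: "map_smooth_at A B p F"
    and Z: "vector_field A Z" and c: "c \<in> B" "F p \<in> fst c"
  shows "msmooth A p (\<lambda>x. differential A B F x (Z x) c)"
proof -
  have "\<forall>\<^sub>F x in nhds p. F x \<in> fst c"
    by (rule map_smooth_atD(1)[OF F chart_eventually(1)[OF B c]])
  then have "\<forall>\<^sub>F x in nhds p. dir_deriv A x (Z x) (\<lambda>y. snd c (F y)) = differential A B F x (Z x) c"
    by eventually_elim (simp add: differential_apply c)
  then show ?thesis
    by (rule msmooth_cong[OF A _ dir_deriv_smooth_fun[OF A Z map_smooth_atD(2)[OF F c]]])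
qed

lemma section_diff_differential:
  assumes A: "smooth_manifold A" and B: "smooth_manifold B" and F: "map_smooth_at A B p F"
    and Z: "vector_field A Z"
  shows "section_diff A B F p (\<lambda>x. differential A B F x (Z x))"
  using differential_tangent[OF A B F] msmooth_differential[OF A B F Z]
  by (simp add: section_diff_def msmooth_imp_mdiff)

text \<open>\<open>lie_bracket\<close> is defined by coordinates; here it is identified with the
  commutator of derivations.\<close>

lemma dir_deriv_lie_bracket:
  fixes f :: "'a::{t2_space, second_countable_topology} \<Rightarrow> 'v::fin_dim"
    and A :: "('a, 'e::fin_dim) chart set"
  assumes A: "smooth_manifold A" and f: "msmooth A p f" and Y: "vector_field A Y" and Z: "vector_field A Z"
  shows "dir_deriv A p (Y p) (\<lambda>x. dir_deriv A x (Z x) f) - dir_deriv A p (Z p) (\<lambda>x. dir_deriv A x (Y x) f) =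
    dir_deriv A p (lie_bracket A Y Z p) f"
proof -
  let ?k = "chart_at A p"
  note k = chart_at_props[OF A, of p]
  define h where "h = f \<circ> chart_inv ?k"
  define x0 where "x0 = snd ?k p"
  \<comment> \<open>The derivative of \<open>f\<close> in the fixed coordinate direction
    \<open>b\<close>, as a function near \<open>p\<close> on the manifold.\<close>
  define d where "d b = (\<lambda>x. frechet_derivative h (at (snd ?k x)) b)" for b
  have h: "smooth_at x0 h" using f k by (simp add: msmooth_def h_def x0_def)
  obtain S where S: "open S" "x0 \<in> S" "smooth_on S h" using h by (auto simp: smooth_at_def)
  have lin: "linear (frechet_derivative h (at x0))"
    by (rule has_derivative_linear[OF smooth_on_has_derivative[OF S(3,2)]])
  have dh: "smooth_at x0 (\<lambda>x. frechet_derivative h (at x) b)" for b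
    by (rule smooth_atI[OF S(1,2) smooth_on_deriv[OF S(3)]])
  have d: "msmooth A p (d b)" for b
    unfolding d_def using msmooth_outer[OF A msmooth_chart[OF A k] dh[unfolded x0_def]] .
  have ddir: "dir_deriv A p v (d b) = frechet_derivative (\<lambda>x. frechet_derivative h (at x) b) (at x0) (v ?k)"
    if "v \<in> tangent_space A p" for v b
    using dir_deriv_outer(2)[OF A msmooth_imp_mdiff[OF msmooth_chart[OF A k]],
        OF frechet_derivative_works[THEN iffD1, OF smooth_at_imp_differentiable[OF dh[unfolded x0_def]]], of
            v b]
      dir_deriv_chart_self[OF A that k] by (simp add: d_def x0_def)
  have expand: "\<forall>\<^sub>F x in nhds p. dir_deriv A x (Z x) f = (\<Sum>b\<in>onb. (Z x ?k \<bullet> b) *\<^sub>R d b x)"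
    if Z: "vector_field A Z" for Z
    using msmooth_eventually[OF A f] chart_eventually(1)[OF A k]
  proof eventually_elim
    case (elim x)
    note mx = msmooth_imp_mdiff[OF elim(1)]
    have "dir_deriv A x (Z x) f = frechet_derivative h (at (snd ?k x)) (Z x ?k)"
      unfolding h_def by (rule dir_deriv_chart[OF A mx k(1) elim(2) vector_fieldD(1)[OF A Z]])
    also have "\<dots> = (\<Sum>b\<in>onb. (Z x ?k \<bullet> b) *\<^sub>R d b x)"
      unfolding d_def h_def
      by (rule linear_onb_sum[OF has_derivative_linear[OF mdiffD[OF mx k(1) elim(2)]]])
    finally show ?case .
  qed
  \<comment> \<open>The Leibniz rule splits the iterated derivative into the first derivative of
    \<open>h\<close> applied to the derivative of \<open>Z\<close>, and a second derivative of
    \<open>h\<close> in the directions of \<open>v\<close> and \<open>Z\<close>. The latter is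
    symmetric and cancels in the commutator.\<close>
  have main: "dir_deriv A p v (\<lambda>x. dir_deriv A x (Z x) f) =
      frechet_derivative h (at x0) (dir_deriv A p v (\<lambda>x. Z x ?k)) +
      frechet_derivative (\<lambda>x. frechet_derivative h (at x) (v ?k)) (at x0) (Z p ?k)"
    if v: "v \<in> tangent_space A p" and Z: "vector_field A Z" for v Z
  proof -
    note zk = msmooth_imp_mdiff[OF vector_fieldD(2)[OF A Z k]]
    note dk = msmooth_imp_mdiff[OF d]
    have zb: "mdiff A p (\<lambda>x. Z x ?k \<bullet> b)" for b
      by (rule mdiff_bounded_linear[OF bounded_linear_inner_left zk])
    have "dir_deriv A p v (\<lambda>x. dir_deriv A x (Z x) f) =
        dir_deriv A p v (\<lambda>x. \<Sum>b\<in>onb. (Z x ?k \<bullet> b) *\<^sub>R d b x)"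
      by (rule dir_deriv_cong[OF A expand[OF Z]])
    also have "\<dots> = (\<Sum>b\<in>onb. dir_deriv A p v (\<lambda>x. Z x ?k \<bullet> b) *\<^sub>R d b p + (Z p ?k \<bullet> b) *\<^sub>R dir_deriv A p v
        (d b))"
      by (simp add: dir_deriv_sum[OF A] mdiff_scaleR[OF zb dk] dir_deriv_scaleR[OF A zb dk])
    also have "\<dots> = (\<Sum>b\<in>onb. (dir_deriv A p v (\<lambda>x. Z x ?k) \<bullet> b) *\<^sub>R frechet_derivative h (at x0) b) +
       (\<Sum>b\<in>onb. (Z p ?k \<bullet> b) *\<^sub>R dir_deriv A p v (d b))"
      by (simp add: sum.distrib dir_deriv_bounded_linear[OF A zk bounded_linear_inner_left] d_def x0_def)
    also have "(\<Sum>b\<in>onb. (dir_deriv A p v (\<lambda>x. Z x ?k) \<bullet> b) *\<^sub>R frechet_derivative h (at x0) b) =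
        frechet_derivative h (at x0) (dir_deriv A p v (\<lambda>x. Z x ?k))"
      by (rule linear_onb_sum[OF lin, symmetric])
    also have "(\<Sum>b\<in>onb. (Z p ?k \<bullet> b) *\<^sub>R dir_deriv A p v (d b)) =
        (\<Sum>b\<in>onb. (Z p ?k \<bullet> b) *\<^sub>R frechet_derivative (\<lambda>x. frechet_derivative h (at x) (v ?k)) (at x0) b)"
      by (intro sum.cong refl) (simp add: ddir[OF v] second_derivative_symmetric[OF S(1,3,2), of _ "v ?k"])
    also have "\<dots> = frechet_derivative (\<lambda>x. frechet_derivative h (at x) (v ?k)) (at x0) (Z p ?k)"
      by (rule linear_onb_sum[OF has_derivative_linear[OF smooth_on_has_derivative[OF
          smooth_on_deriv[OF S(3)] S(2)]], symmetric])
    finally show ?thesis .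
  qed
  have "lie_bracket A Y Z p ?k = dir_deriv A p (Y p) (\<lambda>x. Z x ?k) - dir_deriv A p (Z p) (\<lambda>x. Y x ?k)"
    using k by (simp add: lie_bracket_def)
  then have "dir_deriv A p (lie_bracket A Y Z p) f =
     frechet_derivative h (at x0) (dir_deriv A p (Y p) (\<lambda>x. Z x ?k) - dir_deriv A p (Z p) (\<lambda>x. Y x ?k))"
    by (simp add: dir_deriv_def Let_def h_def x0_def)
  then show ?thesis
    using main[OF vector_fieldD(1)[OF A Y] Z] main[OF vector_fieldD(1)[OF A Z] Y]
      second_derivative_symmetric[OF S(1,3,2), of "Y p ?k" "Z p ?k"]
    by (simp add: linear_diff[OF lin])
qed

context
  fixes A :: "('a::{t2_space, second_countable_topology}, 'e::fin_dim) chart set"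
    and B :: "('b::{t2_space, second_countable_topology}, 'f::fin_dim) chart set"
    and DA DB F
  assumes A: "smooth_manifold A" and B: "smooth_manifold B"
    and DA: "connection A DA" and DB: "connection B DB"
    and F: "\<And>p. map_smooth_at A B p F"
begin

text \<open>In a chart of \<open>B\<close>, swapping \<open>Y\<close> and \<open>Z\<close> changes
  the iterated derivatives of \<open>F\<close> by the image of the Lie bracket, and the subtracted
  term by the same amount because \<open>DA\<close> has no torsion. The Christoffel terms agree
  because \<open>DB\<close> has none.\<close>

lemma second_fundamental_form_symmetric:
  assumes Y: "vector_field A Y" and Z: "vector_field A Z"
  shows "second_fundamental_form A DA B DB F Y Z p = second_fundamental_form A DA B DB F Z Y p"
proof
  fix c
  show "second_fundamental_form A DA B DB F Y Z p c = second_fundamental_form A DA B DB F Z Y p c"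
  proof (cases "c \<in> B \<and> F p \<in> fst c")
    case True
    then have c: "c \<in> B" "F p \<in> fst c" by auto
    have cong: "dir_deriv A p v (\<lambda>x. differential A B F x (Z x) c) =
        dir_deriv A p v (\<lambda>x. dir_deriv A x (Z x) (\<lambda>y. snd c (F y)))"
      for v Z
    proof (rule dir_deriv_cong[OF A])
      have "\<forall>\<^sub>F x in nhds p. F x \<in> fst c"
        by (rule map_smooth_atD(1)[OF F chart_eventually(1)[OF B c]])
      then show "\<forall>\<^sub>F x in nhds p. differential A B F x (Z x) c = dir_deriv A x (Z x) (\<lambda>y. snd c (F y))"
        by eventually_elim (simp add: differential_apply c)
    qed
    have "christoffel B DB c (F p) (differential A B F p (Y p)) (differential A B F p (Z p) c) =
       christoffel B DB c (F p) (differential A B F p (Z p)) (differential A B F p (Y p) c)"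
      by (intro christoffel_symmetric[OF B DB c] differential_tangent[OF A B F])
    moreover have "differential A B F p (DA Y Z p) c - differential A B F p (DA Z Y p) c =
        dir_deriv A p (lie_bracket A Y Z p) (\<lambda>y. snd c (F y))"
    proof -
      have "lie_bracket A Y Z p = DA Y Z p - DA Z Y p" using connectionD(6)[OF DA Y Z] by metis
      then have "differential A B F p (lie_bracket A Y Z p) = differential A B F p (DA Y Z p) - differential
          A B F p (DA Z Y p)"
        by (simp add: linear_diff[OF linear_differential[OF A F]])
      from fun_cong[OF this, of c] show ?thesis by (simp add: differential_apply c)
    qed
    ultimately show ?thesis
      using dir_deriv_lie_bracket[OF A map_smooth_atD(2)[OF F c] Y Z]
      by (simp add: second_fundamental_form_def pullback_deriv_apply c cong algebra_simps)
  qed (simp add: second_fundamental_form_def pullback_deriv_apply differential_apply)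
qed

lemma second_fundamental_form_cong_left:
  assumes Y: "vector_field A Y" "vector_field A Y'" "Y p = Y' p" and Z: "vector_field A Z"
  shows "second_fundamental_form A DA B DB F Y Z p = second_fundamental_form A DA B DB F Y' Z p"
  using connection_cong_left[OF A DA Z Y] Y(3) by (simp add: second_fundamental_form_def)

text \<open>The first slot involves the field only through its value; symmetry carries this over to
  the second slot.\<close>

lemma second_fundamental_form_cong:
  assumes Y: "vector_field A Y" "vector_field A Y'" "Y p = Y' p"
    and Z: "vector_field A Z" "vector_field A Z'" "Z p = Z' p"
  shows "second_fundamental_form A DA B DB F Y Z p = second_fundamental_form A DA B DB F Y' Z' p"
  using second_fundamental_form_cong_left[OF Y Z(1)] second_fundamental_form_cong_left[OF Z Y(2)]
    second_fundamental_form_symmetric[OF Y(2) Z(1)] second_fundamental_form_symmetric[OF Y(2) Z(2)] by simp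

lemma second_fundamental_form_add_right:
  assumes Y: "vector_field A Y" and Z: "vector_field A Z" "vector_field A Z'"
  shows "second_fundamental_form A DA B DB F Y (\<lambda>q. Z q + Z' q) p =
    second_fundamental_form A DA B DB F Y Z p + second_fundamental_form A DA B DB F Y Z' p"
proof -
  note s = section_diff_differential[OF A B F]
  show ?thesis
    using pullback_deriv_add[OF A B DB F s[OF Z(1)] s[OF Z(2)]]
    by (simp add: second_fundamental_form_def connectionD(4)[OF DA Y Z] differential_add[OF A F])
qed

lemma second_fundamental_form_add_left:
  assumes Y: "vector_field A Y" and Z: "vector_field A Z" "vector_field A Z'"
  shows "second_fundamental_form A DA B DB F (\<lambda>q. Z q + Z' q) Y p =
    second_fundamental_form A DA B DB F Z Y p + second_fundamental_form A DA B DB F Z' Y p"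
  using second_fundamental_form_add_right[OF assms] second_fundamental_form_symmetric[OF Y]
    vector_field_add[OF A Z] Z by simp

section \<open>Pushed-forward fields in a local frame of the target\<close>

lemma pushforward_frame:
  assumes Y: "vector_field A Y"
  obtains f :: "'f \<Rightarrow> 'a \<Rightarrow> real" and E where "\<And>b. msmooth A q (f b)" "\<And>b. vector_field B (E b)"
    "\<forall>\<^sub>F x in nhds q. differential A B F x (Y x) = (\<Sum>b\<in>onb. f b x *\<^sub>R E b (F x))"
proof -
  let ?d = "chart_at B (F q)"
  note d = chart_at_props[OF B, of "F q"]
  let ?f = "\<lambda>b x. differential A B F x (Y x) ?d \<bullet> b" and ?E = "coord_field B ?d (F q)"
  have 1: "msmooth A q (?f b)" for b
    by (rule msmooth_inner_left[OF msmooth_differential[OF A B F Y d]])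
  have "\<forall>\<^sub>F r in nhds (F q). r \<in> fst ?d \<and> (\<forall>b\<in>onb. ?E b r = tangent_of B ?d r b)"
    using chart_eventually(1)[OF B d] coord_field(3)[OF B d]
    by (simp add: eventually_conj_iff eventually_ball_finite_distrib)
  from map_smooth_atD(1)[OF F this]
  have 2: "\<forall>\<^sub>F x in nhds q. differential A B F x (Y x) = (\<Sum>b\<in>onb. ?f b x *\<^sub>R ?E b (F x))"
  proof eventually_elim
    case (elim x)
    have "differential A B F x (Y x) = tangent_of B ?d (F x) (differential A B F x (Y x) ?d)"
      using elim by (intro tangent_eq_tangent_of[OF differential_tangent[OF A B F] d(1)]) simp
    also have "\<dots> = (\<Sum>b\<in>onb. ?f b x *\<^sub>R tangent_of B ?d (F x) b)"
      using elim by (intro linear_onb_sum linear_tangent_of[OF B d(1)]) simp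
    also have "\<dots> = (\<Sum>b\<in>onb. ?f b x *\<^sub>R ?E b (F x))" using elim by (intro sum.cong) auto
    finally show ?case .
  qed
  show ?thesis by (rule that[OF 1 coord_field(1)[OF B d] 2])
qed

text \<open>Here the coordinate definition of the pulled-back connection is replaced by values of
  \<open>DB\<close> on global fields. The later comparisons of derivatives along \<open>F\<close>
  all start from this formula or its pattern.\<close>

lemma pullback_deriv_frame:
  assumes f: "\<And>b. msmooth A q (f b)" and E: "\<And>b. vector_field B (E b)"
    and W: "\<forall>\<^sub>F x in nhds q. W x = (\<Sum>b\<in>onb. f b x *\<^sub>R E b (F x))"
    and X: "vector_field B X" "X (F q) = differential A B F q v"
  shows "pullback_deriv A B DB F q v W =
    (\<Sum>b\<in>onb. dir_deriv A q v (f b) *\<^sub>R E b (F q) + f b q *\<^sub>R DB X (E b) (F q))"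
proof -
  have s: "section_diff A B F q (\<lambda>x. E b (F x))" for b
    using section_diff_comp[OF A B F section_diff_field[OF B E]] .
  note fd = msmooth_imp_mdiff[OF f]
  have "pullback_deriv A B DB F q v W = pullback_deriv A B DB F q v (\<lambda>x. \<Sum>b\<in>onb. f b x *\<^sub>R E b (F x))"
    by (rule pullback_deriv_cong[OF A W])
  also have "\<dots> = (\<Sum>b\<in>onb. pullback_deriv A B DB F q v (\<lambda>x. f b x *\<^sub>R E b (F x)))"
    by (intro pullback_deriv_sum[OF A B DB F] section_diff_scale[OF B fd s])
  also have "\<dots> = (\<Sum>b\<in>onb. dir_deriv A q v (f b) *\<^sub>R E b (F q) + f b q *\<^sub>R DB X (E b) (F q))"
    by (simp add: pullback_deriv_scale[OF A B DB F fd s] pullback_deriv_field[OF A B DB F E X])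
  finally show ?thesis .
qed

text \<open>The chartwise definition of \<open>pullback_deriv\<close> does not show that its values
  transform like a vector. The frame formula does, bypassing the transformation law of the
  Christoffel symbols.\<close>

lemma pullback_deriv_differential_tangent:
  assumes Y: "vector_field A Y"
  shows "pullback_deriv A B DB F q v (\<lambda>x. differential A B F x (Y x)) \<in> tangent_space B (F q)"
proof -
  obtain f :: "'f \<Rightarrow> 'a \<Rightarrow> real" and E where fE: "\<And>b. msmooth A q (f b)" "\<And>b. vector_field B (E b)"
    "\<forall>\<^sub>F x in nhds q. differential A B F x (Y x) = (\<Sum>b\<in>onb. f b x *\<^sub>R E b (F x))"
    by (rule pushforward_frame[OF Y], rule that)
  note X = extend[OF B differential_tangent[OF A B F, of q v]]
  show ?thesis
    unfolding pullback_deriv_frame[OF fE X]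
    by (intro subspace_sum[OF subspace_tangent_space[OF B]] subspace_add[OF subspace_tangent_space[OF B]]
        subspace_scale[OF subspace_tangent_space[OF B]] vector_fieldD(1)[OF B] fE connectionD(1)[OF DB] X)
qed

lemma second_fundamental_form_tangent:
  assumes Y: "vector_field A Y" and Z: "vector_field A Z"
  shows "second_fundamental_form A DA B DB F Y Z q \<in> tangent_space B (F q)"
  unfolding second_fundamental_form_def
  by (intro subspace_diff[OF subspace_tangent_space[OF B]] pullback_deriv_differential_tangent Z
      differential_tangent[OF A B F])

end

section \<open>Maps on products\<close>

lemma chart_inv_prod:
  assumes "smooth_manifold A" "smooth_manifold B" "a \<in> A" "b \<in> B"
    and "x \<in> snd a ` fst a" "y \<in> snd b ` fst b"
  shows "chart_inv (fst a \<times> fst b, map_prod (snd a) (snd b)) (x, y) = (chart_inv a x, chart_inv b y)"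
proof -
  have inj: "inj_on (snd a) (fst a)" "inj_on (snd b) (fst b)"
    using chartD(5)[OF assms(1,3)] chartD(5)[OF assms(2,4)] by (metis inj_onI)+
  have "inj_on (map_prod (snd a) (snd b)) (fst a \<times> fst b)" using map_prod_inj_on[OF inj] .
  moreover have "(chart_inv a x, chart_inv b y) \<in> fst a \<times> fst b"
    using chartD(7)[OF assms(1,3,5)] chartD(7)[OF assms(2,4,6)] by simp
  moreover have "map_prod (snd a) (snd b) (chart_inv a x, chart_inv b y) = (x, y)"
    using chartD(6)[OF assms(1,3,5)] chartD(6)[OF assms(2,4,6)] by simp
  ultimately show ?thesis unfolding chart_inv_def[of "(_, _)"] fst_conv snd_conv by (rule inv_into_f_eq)
qed

text \<open>Extracts the group component \<open>\<tau>\<close> of a local trivialization. As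
  \<open>prod_atlas B C\<close> consists of product charts, the chart \<open>d\<close> of
  \<open>C\<close> is completed by some chart of \<open>B\<close> around the first
  component.\<close>

lemma smooth_map_on_snd:
  fixes A :: "('a::{t2_space, second_countable_topology}, 'e::fin_dim) chart set"
    and B :: "('b::{t2_space, second_countable_topology}, 'f::fin_dim) chart set"
    and C :: "('c::{t2_space, second_countable_topology}, 'g::fin_dim) chart set"
  assumes A: "smooth_manifold A" and B: "smooth_manifold B" and C: "smooth_manifold C"
    and F: "smooth_map_on A (prod_atlas B C) S F" and S: "open S" "p \<in> S"
  shows "map_smooth_at A C p (\<lambda>x. snd (F x))"
  unfolding map_smooth_at_def
proof (intro conjI ballI impI)
  have cont: "continuous_on S F" using F by (simp add: smooth_map_on_def)
  then have "isCont F p" using S by (simp add: continuous_on_eq_continuous_at)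
  then have "isCont (\<lambda>x. snd (F x)) p" by (rule continuous_snd)
  then show "filterlim (\<lambda>x. snd (F x)) (nhds (snd (F p))) (nhds p)"
    using tendsto_at_iff_tendsto_nhds[of "\<lambda>x. snd (F x)" p] by (simp add: isCont_def)
  fix d assume d: "d \<in> C" "snd (F p) \<in> fst d"
  let ?c = "chart_at A p" and ?b = "chart_at B (fst (F p))"
  note c = chart_at_props[OF A, of p] and b = chart_at_props[OF B, of "fst (F p)"]
  let ?e = "(fst ?b \<times> fst d, map_prod (snd ?b) (snd d))"
  have e: "?e \<in> prod_atlas B C" unfolding prod_atlas_def using b(1) d(1) by blast
  let ?U = "S \<inter> fst ?c \<inter> F -` fst ?e"
  have "open (S \<inter> F -` fst ?e)"
    using chartD(1)[OF B b(1)] chartD(1)[OF C d(1)]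
    by (intro continuous_open_preimage[OF cont S(1)]) (simp add: open_Times)
  moreover have "?U = (S \<inter> F -` fst ?e) \<inter> fst ?c" by auto
  ultimately have U: "open ?U" using chartD(1)[OF A c(1)] by (simp only: open_Int)
  have "smooth_on (snd ?c ` ?U) (snd ?e \<circ> F \<circ> chart_inv ?c)"
    using F c(1) e unfolding smooth_map_on_def by blast
  moreover have "?U \<subseteq> fst ?c" by auto
  ultimately have "\<forall>q\<in>?U. msmooth A q (snd ?e \<circ> F)"
    using smooth_on_chart_iff[OF A c(1) U] by blast
  moreover have "p \<in> ?U" using S c b d by (cases "F p") auto
  ultimately have "msmooth A p (snd ?e \<circ> F)" by blast
  from msmooth_bounded_linear[OF bounded_linear_snd this]
  show "msmooth A p (\<lambda>x. snd d (snd (F x)))" by (simp add: o_def)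
qed

lemma map_smooth_at_const: "map_smooth_at X Y p (\<lambda>_. y)"
  by (simp add: map_smooth_at_def msmooth_const tendsto_const)

text \<open>Covers the group action and the multiplication, with \<open>S = UNIV\<close>, and the
  inverse of a local trivialization, with \<open>S = U \<times> UNIV\<close>. Derivatives go through
  the coordinate expression \<open>rep\<close>, so that only tangent spaces of the factors
  occur.\<close>

locale smooth_product_map =
  fixes A :: "('a::{t2_space, second_countable_topology}, 'e::fin_dim) chart set"
    and B :: "('b::{t2_space, second_countable_topology}, 'f::fin_dim) chart set"
    and C :: "('c::{t2_space, second_countable_topology}, 'g::fin_dim) chart set"
    and S :: "('a \<times> 'b) set" and F :: "'a \<times> 'b \<Rightarrow> 'c"
  assumes A: "smooth_manifold A" and B: "smooth_manifold B" and C: "smooth_manifold C"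
    and F: "smooth_map_on (prod_atlas A B) C S F" and S: "open S"
begin

definition rep :: "('a, 'e) chart \<Rightarrow> ('b, 'f) chart \<Rightarrow> ('c, 'g) chart \<Rightarrow> 'e \<times> 'f \<Rightarrow> 'g" where
  "rep a b c z = snd c (F (chart_inv a (fst z), chart_inv b (snd z)))"

lemma tendsto_F: "(p, q) \<in> S \<Longrightarrow> filterlim F (nhds (F (p, q))) (nhds (p, q))"
  using F S tendsto_at_iff_tendsto_nhds[of F "(p, q)"] 
  by (simp add: smooth_map_on_def continuous_on_eq_continuous_at isCont_def)

lemma rep_smooth:
  assumes pq: "(p, q) \<in> S" and a: "a \<in> A" "p \<in> fst a" and b: "b \<in> B" "q \<in> fst b"
    and c: "c \<in> C" "F (p, q) \<in> fst c"
  shows "smooth_at (snd a p, snd b q) (rep a b c)"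
proof -
  let ?e = "(fst a \<times> fst b, map_prod (snd a) (snd b))"
  note aD = chartD[OF A a(1)] and bD = chartD[OF B b(1)]
  have e: "?e \<in> prod_atlas A B" unfolding prod_atlas_def using a(1) b(1) by blast
  have cont: "continuous_on S F" using F by (simp add: smooth_map_on_def)
  let ?O = "S \<inter> F -` fst c" and ?D = "snd a ` fst a \<times> snd b ` fst b"
  let ?i = "\<lambda>z. (chart_inv a (fst z), chart_inv b (snd z))"
  let ?V = "?D \<inter> ?i -` ?O"
  have O: "open ?O" by (rule continuous_open_preimage[OF cont S chartD(1)[OF C c(1)]])
  have D: "open ?D" using aD(2) bD(2) by (rule open_Times)
  have "continuous_on ?D ?i"
    by (intro continuous_on_Pair continuous_on_compose2[OF aD(4)] continuous_on_compose2[OF bD(4)]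
        continuous_on_fst continuous_on_snd continuous_on_id) auto
  then have V: "open ?V" by (rule continuous_open_preimage[OF _ D O])
  have eq: "(snd c \<circ> F \<circ> chart_inv ?e) z = rep a b c z" if "z \<in> ?V" for z
    using chart_inv_prod[OF A B a(1) b(1)] that by (cases z) (auto simp: rep_def)
  have "?V \<subseteq> snd ?e ` (S \<inter> fst ?e \<inter> F -` fst c)"
  proof
    fix z assume z: "z \<in> ?V"
    then have "snd ?e (?i z) = z" "?i z \<in> fst ?e"
      using aD(6,7) bD(6,7) by (auto simp: mem_Times_iff prod_eq_iff)
    moreover have "?i z \<in> S \<inter> F -` fst c" using z by auto
    ultimately show "z \<in> snd ?e ` (S \<inter> fst ?e \<inter> F -` fst c)" by (metis IntE IntI imageI)
  qed
  moreover have "smooth_on (snd ?e ` (S \<inter> fst ?e \<inter> F -` fst c)) (snd c \<circ> F \<circ> chart_inv ?e)"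
    using F e c(1) unfolding smooth_map_on_def by blast
  ultimately have "smooth_on ?V (snd c \<circ> F \<circ> chart_inv ?e)" by (rule smooth_on_subset[rotated])
  from smooth_on_cong[OF V eq this] have "smooth_on ?V (rep a b c)" .
  moreover have "(snd a p, snd b q) \<in> ?V" using pq a b c aD(5) bD(5) by auto
  ultimately show ?thesis using V by (intro smooth_atI)
qed

lemma rep_has_derivative:
  assumes pq: "(p, q) \<in> S" and a: "a \<in> A" "p \<in> fst a" and b: "b \<in> B" "q \<in> fst b"
    and c: "c \<in> C" "F (p, q) \<in> fst c"
  shows "(rep a b c has_derivative frechet_derivative (rep a b c) (at (snd a p, snd b q)))
      (at (snd a p, snd b q))"
  by (rule frechet_derivative_works[THEN iffD1, OF smooth_at_imp_differentiable[OF rep_smooth[OF assms]]])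

context
  fixes X :: "('x::{t2_space, second_countable_topology}, 'h::fin_dim) chart set" and x u w
  assumes X: "smooth_manifold X" and u: "map_smooth_at X A x u" and w: "map_smooth_at X B x w"
    and xS: "(u x, w x) \<in> S"
begin

lemma tendsto_pair: "filterlim (\<lambda>z. F (u z, w z)) (nhds (F (u x, w x))) (nhds x)"
proof -
  have "filterlim (\<lambda>z. (u z, w z)) (nhds (u x, w x)) (nhds x)"
    using u w by (simp add: map_smooth_at_def tendsto_Pair)
  from filterlim_compose[OF tendsto_F[OF xS] this] show ?thesis .
qed

lemma rep_eventually:
  assumes a: "a \<in> A" "u x \<in> fst a" and b: "b \<in> B" "w x \<in> fst b" and c: "c \<in> C" "F (u x, w x) \<in> fst c"
  shows "\<forall>\<^sub>F z in nhds x. u z \<in> fst a \<and> w z \<in> fst b \<and> (u z, w z) \<in> S \<and> F (u z, w z) \<in> fst c"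
    "\<forall>\<^sub>F z in nhds x. rep a b c (snd a (u z), snd b (w z)) = snd c (F (u z, w z))"
proof -
  have 1: "\<forall>\<^sub>F z in nhds x. u z \<in> fst a"
    by (rule map_smooth_atD(1)[OF u chart_eventually(1)[OF A a]])
  have 2: "\<forall>\<^sub>F z in nhds x. w z \<in> fst b"
    by (rule map_smooth_atD(1)[OF w chart_eventually(1)[OF B b]])
  have "filterlim (\<lambda>z. (u z, w z)) (nhds (u x, w x)) (nhds x)"
    using u w by (simp add: map_smooth_at_def tendsto_Pair)
  moreover have "\<forall>\<^sub>F s in nhds (u x, w x). s \<in> S" using S xS by (intro eventually_nhds_in_open)
  ultimately have 3: "\<forall>\<^sub>F z in nhds x. (u z, w z) \<in> S" unfolding filterlim_iff by blast
  have "\<forall>\<^sub>F r in nhds (F (u x, w x)). r \<in> fst c" by (rule chart_eventually(1)[OF C c])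
  then have 4: "\<forall>\<^sub>F z in nhds x. F (u z, w z) \<in> fst c" using tendsto_pair unfolding filterlim_iff by blast
  show 5: "\<forall>\<^sub>F z in nhds x. u z \<in> fst a \<and> w z \<in> fst b \<and> (u z, w z) \<in> S \<and> F (u z, w z) \<in> fst c"
    using 1 2 3 4 by eventually_elim simp
  then show "\<forall>\<^sub>F z in nhds x. rep a b c (snd a (u z), snd b (w z)) = snd c (F (u z, w z))"
    by eventually_elim (simp add: rep_def chartD(5)[OF A a(1)] chartD(5)[OF B b(1)])
qed

lemma map_smooth_at_pair: "map_smooth_at X C x (\<lambda>z. F (u z, w z))"
  unfolding map_smooth_at_def
proof (intro conjI ballI impI tendsto_pair)
  fix c assume c: "c \<in> C" "F (u x, w x) \<in> fst c"
  note a = chart_at_props[OF A, of "u x"] and b = chart_at_props[OF B, of "w x"]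
  have "msmooth X x (\<lambda>z. (snd (chart_at A (u x)) (u z), snd (chart_at B (w x)) (w z)))"
    by (intro msmooth_Pair map_smooth_atD(2)[OF u a] map_smooth_atD(2)[OF w b])
  from msmooth_outer[OF X this rep_smooth[OF xS a b c]]
  show "msmooth X x (\<lambda>z. snd c (F (u z, w z)))"
    by (rule msmooth_cong[OF X rep_eventually(2)[OF a b c]])
qed

lemma dir_deriv_pair:
  assumes a: "a \<in> A" "u x \<in> fst a" and b: "b \<in> B" "w x \<in> fst b" and c: "c \<in> C" "F (u x, w x) \<in> fst c"
  shows "dir_deriv X x v (\<lambda>z. snd c (F (u z, w z))) =
    frechet_derivative (rep a b c) (at (snd a (u x), snd b (w x)))
      (differential X A u x v a, differential X B w x v b)"
proof -
  let ?f = "\<lambda>z. (snd a (u z), snd b (w z))"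
  let ?k = "chart_at X x"
  have ua: "mdiff X x (\<lambda>z. snd a (u z))" and wb: "mdiff X x (\<lambda>z. snd b (w z))"
    by (rule msmooth_imp_mdiff, rule map_smooth_atD(2)[OF u a] map_smooth_atD(2)[OF w b])+
  have f: "mdiff X x ?f"
    by (intro msmooth_imp_mdiff msmooth_Pair map_smooth_atD(2)[OF u a] map_smooth_atD(2)[OF w b])
  have "dir_deriv X x v ?f = (dir_deriv X x v (\<lambda>z. snd a (u z)), dir_deriv X x v (\<lambda>z. snd b (w z)))"
    using dir_derivI[of ?f X x _ v] has_derivative_Pair[OF dir_derivD[OF X ua] dir_derivD[OF X wb]]
    by (simp add: o_def dir_deriv_def Let_def)
  then have "dir_deriv X x v (\<lambda>z. rep a b c (?f z)) =
     frechet_derivative (rep a b c) (at (?f x)) (differential X A u x v a, differential X B w x v b)"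
    by (subst dir_deriv_outer(2)[OF X f rep_has_derivative[OF xS a b c]]) (simp add: differential_apply a b)
  then show ?thesis using dir_deriv_cong[OF X rep_eventually(2)[OF a b c]] by simp
qed

end

lemma dir_deriv_slices:
  assumes pq: "(p, q) \<in> S" and a: "a \<in> A" "p \<in> fst a" and b: "b \<in> B" "q \<in> fst b"
    and c: "c \<in> C" "F (p, q) \<in> fst c"
  shows "v \<in> tangent_space A p \<Longrightarrow> dir_deriv A p v (\<lambda>x. snd c (F (x, q))) =
      frechet_derivative (rep a b c) (at (snd a p, snd b q)) (v a, 0)"
    "v' \<in> tangent_space B q \<Longrightarrow> dir_deriv B q v' (\<lambda>y. snd c (F (p, y))) =
      frechet_derivative (rep a b c) (at (snd a p, snd b q)) (0, v' b)"
  using dir_deriv_pair[OF A map_smooth_at_id[OF A] map_smooth_at_const, of p q a b c v]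
    dir_deriv_pair[OF B map_smooth_at_const map_smooth_at_id[OF B], of p q a b c v'] assms
  by (simp_all add: differential_const differential_id A B)

lemma map_smooth_at_slices:
  assumes "(p, q) \<in> S"
  shows "map_smooth_at A C p (\<lambda>x. F (x, q))" "map_smooth_at B C q (\<lambda>y. F (p, y))"
  using map_smooth_at_pair[OF A map_smooth_at_id[OF A] map_smooth_at_const, of p q]
    map_smooth_at_pair[OF B map_smooth_at_const map_smooth_at_id[OF B], of p q] assms by simp_all

text \<open>The derivative of \<open>rep\<close> is linear, so on \<open>(s, t)\<close> it is the
  sum of its values on \<open>(s, 0)\<close> and \<open>(0, t)\<close>, which are the derivatives of
  the two slices.\<close>

lemma differential_pair:
  assumes X: "smooth_manifold X" and u: "map_smooth_at X A x u" and w: "map_smooth_at X B x w"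
    and xS: "(u x, w x) \<in> S"
  shows "differential X C (\<lambda>z. F (u z, w z)) x v =
    differential A C (\<lambda>y. F (y, w x)) (u x) (differential X A u x v) +
    differential B C (\<lambda>y. F (u x, y)) (w x) (differential X B w x v)"
proof
  fix c
  note a = chart_at_props[OF A, of "u x"] and b = chart_at_props[OF B, of "w x"]
  show "differential X C (\<lambda>z. F (u z, w z)) x v c =
    (differential A C (\<lambda>y. F (y, w x)) (u x) (differential X A u x v) +
    differential B C (\<lambda>y. F (u x, y)) (w x) (differential X B w x v)) c"
  proof (cases "c \<in> C \<and> F (u x, w x) \<in> fst c")
    case True
    then have c: "c \<in> C" "F (u x, w x) \<in> fst c" by auto
    let ?L = "frechet_derivative (rep (chart_at A (u x)) (chart_at B (w x)) c)
        (at (snd (chart_at A (u x)) (u x), snd (chart_at B (w x)) (w x)))"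
    have lin: "?L (s, t) = ?L (s, 0) + ?L (0, t)" for s t
      using linear_add[OF has_derivative_linear[OF rep_has_derivative[OF xS a b c]], of "(s, 0)" "(0, t)"]
      by simp
    let ?s = "differential X A u x v (chart_at A (u x))"
      and ?t = "differential X B w x v (chart_at B (w x))"
    have "differential X C (\<lambda>z. F (u z, w z)) x v c = ?L (?s, ?t)"
      using dir_deriv_pair[OF X u w xS a b c, of v] by (simp only: differential_apply c)
    moreover have "differential A C (\<lambda>y. F (y, w x)) (u x) (differential X A u x v) c = ?L (?s, 0)"
      using dir_deriv_slices(1)[OF xS a b c differential_tangent[OF X A u]]
      by (simp only: differential_apply c)
    moreover have "differential B C (\<lambda>y. F (u x, y)) (w x) (differential X B w x v) c = ?L (0, ?t)"
      using dir_deriv_slices(2)[OF xS a b c differential_tangent[OF X B w]]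
      by (simp only: differential_apply c)
    ultimately show ?thesis using lin[of ?s ?t] by simp
  qed (simp add: differential_apply)
qed

text \<open>Fundamental fields and local lifts are both differentials of slices. The slice and the
  base point move with \<open>z\<close>, hence smoothness is read off from the joint expression
  \<open>rep\<close> rather than from a single slice.\<close>

lemma msmooth_slice_differentials:
  assumes X: "smooth_manifold X" and u: "map_smooth_at X A x u" and w: "map_smooth_at X B x w"
    and xS: "(u x, w x) \<in> S" and c: "c \<in> C" "F (u x, w x) \<in> fst c"
  shows "a \<in> A \<Longrightarrow> u x \<in> fst a \<Longrightarrow> \<forall>\<^sub>F z in nhds x. v z \<in> tangent_space A (u z) \<Longrightarrow> msmooth X x (\<lambda>z. v z a) \<Longrightarrow>
      msmooth X x (\<lambda>z. differential A C (\<lambda>y. F (y, w z)) (u z) (v z) c)"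
    "b \<in> B \<Longrightarrow> w x \<in> fst b \<Longrightarrow> \<forall>\<^sub>F z in nhds x. v' z \<in> tangent_space B (w z) \<Longrightarrow> msmooth X x (\<lambda>z. v' z b) \<Longrightarrow>
      msmooth X x (\<lambda>z. differential B C (\<lambda>y. F (u z, y)) (w z) (v' z) c)"
proof -
  have *: "msmooth X x (\<lambda>z. frechet_derivative (rep a b c) (at (snd a (u z), snd b (w z))) (\<xi> z))"
    if "msmooth X x \<xi>" "a \<in> A" "u x \<in> fst a" "b \<in> B" "w x \<in> fst b" for a b \<xi>
    unfolding msmooth_def o_def
  proof (intro ballI impI)
    fix k assume k: "k \<in> X" "x \<in> fst k"
    have "smooth_at (snd k x) (\<lambda>y. (snd a (u (chart_inv k y)), snd b (w (chart_inv k y))))"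
      using map_smooth_atD(2)[OF u that(2,3)] map_smooth_atD(2)[OF w that(4,5)] k
      by (intro smooth_at_Pair) (simp_all add: msmooth_def o_def)
    moreover have "smooth_at (snd k x) (\<lambda>y. \<xi> (chart_inv k y))"
      using that(1) k by (simp add: msmooth_def o_def)
    moreover have "smooth_at (snd a (u (chart_inv k (snd k x))), snd b (w (chart_inv k (snd k x))))
        (rep a b c)"
      unfolding chartD(5)[OF X k] by (rule rep_smooth[OF xS that(2-5) c])
    ultimately show "smooth_at (snd k x)
       (\<lambda>y. frechet_derivative (rep a b c) (at (snd a (u (chart_inv k y)), snd b (w (chart_inv k y))))
           (\<xi> (chart_inv k y)))"
      by (rule smooth_at_deriv_comp)
  qed
  show "msmooth X x (\<lambda>z. differential A C (\<lambda>y. F (y, w z)) (u z) (v z) c)"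
    if a: "a \<in> A" "u x \<in> fst a"
      and v: "\<forall>\<^sub>F z in nhds x. v z \<in> tangent_space A (u z)" "msmooth X x (\<lambda>z. v z a)"
  proof (rule msmooth_cong[OF X])
    note b = chart_at_props[OF B, of "w x"]
    show "msmooth X x (\<lambda>z. frechet_derivative (rep a (chart_at B (w x)) c)
        (at (snd a (u z), snd (chart_at B (w x)) (w z))) (v z a, 0))"
      by (rule *[OF msmooth_Pair[OF v(2) msmooth_const] a b])
    show "\<forall>\<^sub>F z in nhds x. frechet_derivative (rep a (chart_at B (w x)) c)
        (at (snd a (u z), snd (chart_at B (w x)) (w z))) (v z a, 0) =
      differential A C (\<lambda>y. F (y, w z)) (u z) (v z) c"
      using rep_eventually(1)[OF X u w xS a b c] v(1)
    proof eventually_elim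
      case (elim z)
      then show ?case
        using dir_deriv_slices(1)[of "u z" "w z" a "chart_at B (w x)" c "v z"] a(1) b(1) c(1)
        by (simp only: differential_apply simp_thms)
    qed
  qed
  show "msmooth X x (\<lambda>z. differential B C (\<lambda>y. F (u z, y)) (w z) (v' z) c)"
    if b: "b \<in> B" "w x \<in> fst b"
      and v: "\<forall>\<^sub>F z in nhds x. v' z \<in> tangent_space B (w z)" "msmooth X x (\<lambda>z. v' z b)"
  proof (rule msmooth_cong[OF X])
    note a = chart_at_props[OF A, of "u x"]
    show "msmooth X x (\<lambda>z. frechet_derivative (rep (chart_at A (u x)) b c)
        (at (snd (chart_at A (u x)) (u z), snd b (w z))) (0, v' z b))"
      by (rule *[OF msmooth_Pair[OF msmooth_const v(2)] a b])
    show "\<forall>\<^sub>F z in nhds x. frechet_derivative (rep (chart_at A (u x)) b c)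
        (at (snd (chart_at A (u x)) (u z), snd b (w z))) (0, v' z b) =
      differential B C (\<lambda>y. F (u z, y)) (w z) (v' z) c"
      using rep_eventually(1)[OF X u w xS a b c] v(1)
    proof eventually_elim
      case (elim z)
      then show ?case
        using dir_deriv_slices(2)[of "u z" "w z" "chart_at A (u x)" b c "v' z"] a(1) b(1) c(1)
        by (simp only: differential_apply simp_thms)
    qed
  qed
qed

end

section \<open>Principal bundles with a connection form\<close>

locale bundle_connection =
  fixes P :: "('p::{t2_space, second_countable_topology}, 'c::fin_dim) chart set"
    and M :: "('m::{t2_space, second_countable_topology}, 'b::fin_dim) chart set"
    and G :: "('g::{t2_space, second_countable_topology}, 'd::fin_dim) chart set"
    and gmult :: "'g \<Rightarrow> 'g \<Rightarrow> 'g" and gid :: 'g and ginv :: "'g \<Rightarrow> 'g"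
    and act :: "'p \<Rightarrow> 'g \<Rightarrow> 'p" and \<pi> :: "'p \<Rightarrow> 'm"
    and \<omega> :: "'p \<Rightarrow> ('p, 'c) tvec \<Rightarrow> ('g, 'd) tvec"
  assumes princ: "principal_bundle P M G gmult gid ginv act \<pi>"
    and form: "connection_form P G gmult gid ginv act \<omega>"
begin

lemma P: "smooth_manifold P" and M: "smooth_manifold M" and G: "smooth_manifold G"
  and group: "Groups.group gmult gid ginv"
  and gmult_smooth: "smooth_map (prod_atlas G G) G (\<lambda>(a, b). gmult a b)"
  and act_smooth: "smooth_map (prod_atlas P G) P (\<lambda>(p, a). act p a)"
  and \<pi>_smooth: "smooth_map P M \<pi>"
  using princ unfolding principal_bundle_def lie_group_def by - (elim conjE, assumption)+

lemma act_gid: "act p gid = p" and \<pi>_act: "\<pi> (act p a) = \<pi> p"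
proof -
  have "\<forall>p. act p gid = p" and fibre: "\<forall>p q. \<pi> p = \<pi> q \<longleftrightarrow> (\<exists>a. q = act p a)"
    using princ unfolding principal_bundle_def by - (elim conjE, assumption)+
  then show "act p gid = p" by (elim allE)
  show "\<pi> (act p a) = \<pi> p"
    by (rule fibre[THEN spec, THEN spec, THEN iffD2, THEN sym]) (rule exI, rule refl)
qed

sublocale action: smooth_product_map P G P UNIV "\<lambda>(p, a). act p a"
  by unfold_locales (rule P G act_smooth open_UNIV)+

sublocale multiplication: smooth_product_map G G G UNIV "\<lambda>(a, b). gmult a b"
  by unfold_locales (rule G gmult_smooth open_UNIV)+

lemma \<pi>_smooth_at: "map_smooth_at P M p \<pi>"
  by (rule smooth_map_on_at[OF P M \<pi>_smooth]) auto

lemma gmult_ginv: "gmult (ginv a) a = gid" "gmult a (gmult (ginv a) b) = b"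
proof -
  interpret gr: Groups.group gmult gid ginv by (rule group)
  show "gmult (ginv a) a = gid" by simp
  show "gmult a (gmult (ginv a) b) = b" by (metis gr.assoc gr.group_left_neutral gr.right_inverse)
qed

section \<open>Fundamental fields and the connection form\<close>

abbreviation "fund \<equiv> fundamental_field P G gid act"

abbreviation "\<pi>' \<equiv> differential P M \<pi>"

lemma act_slice_smooth_at: "map_smooth_at G P gid (act p)"
  using action.map_smooth_at_slices(2)[of p gid] by simp

lemma fund_tangent: "fund B p \<in> tangent_space P p"
  using differential_tangent[OF G P act_slice_smooth_at, of p B]
  by (simp add: fundamental_field_def act_gid)

lemma fund_vertical: "\<pi>' p (fund B p) = 0"
proof -
  have "differential G M (\<lambda>a. \<pi> (act p a)) gid B = \<pi>' (act p gid) (fund B p)"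
    unfolding fundamental_field_def by (rule differential_comp[OF G P act_slice_smooth_at \<pi>_smooth_at])
  then show ?thesis by (simp add: \<pi>_act differential_const act_gid)
qed

lemma linear_fund: "linear (\<lambda>B. fund B p)"
  unfolding fundamental_field_def by (rule linear_differential[OF G act_slice_smooth_at])

lemma fund_vector_field:
  assumes B: "B \<in> tangent_space G gid"
  shows "vector_field P (fund B)"
proof (rule vector_fieldI[OF P fund_tangent])
  fix p
  note c = chart_at_props[OF P, of p]
  have "msmooth P p (\<lambda>z. differential G P (\<lambda>y. (\<lambda>(p, a). act p a) (z, y)) gid B (chart_at P p))"
    by (rule action.msmooth_slice_differentials(2)[OF P map_smooth_at_id[OF P] map_smooth_at_const _ c(1) _
        chart_at_props[OF G]])
       (use c B in \<open>simp_all add: act_gid msmooth_const\<close>)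
  then show "\<exists>c\<in>P. p \<in> fst c \<and> msmooth P p (\<lambda>q. fund B q c)"
    using c by (auto simp: fundamental_field_def)
qed

lemma \<omega>_fund: "B \<in> tangent_space G gid \<Longrightarrow> \<omega> p (fund B p) = B"
  using form unfolding connection_form_def by blast

lemma \<omega>_linear: "linear_between (tangent_space P p) (tangent_space G gid) (\<omega> p)"
  and \<omega>_smooth: "vector_field P X \<Longrightarrow> smooth_fun P (\<lambda>p. \<omega> p (X p) k)"
  using form unfolding connection_form_def one_form_def by blast+

lemma \<omega>_in: "u \<in> tangent_space P p \<Longrightarrow> \<omega> p u \<in> tangent_space G gid"
  and \<omega>_add: "u \<in> tangent_space P p \<Longrightarrow> v \<in> tangent_space P p \<Longrightarrow> \<omega> p (u + v) = \<omega> p u + \<omega> p v"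
  and \<omega>_scale: "u \<in> tangent_space P p \<Longrightarrow> \<omega> p (r *\<^sub>R u) = r *\<^sub>R \<omega> p u"
  using \<omega>_linear[of p] unfolding linear_between_def by blast+

lemma \<omega>_diff:
  assumes "u \<in> tangent_space P p" "v \<in> tangent_space P p"
  shows "\<omega> p (u - v) = \<omega> p u - \<omega> p v"
  using \<omega>_add[of "u - v" p v] subspace_diff[OF subspace_tangent_space[OF P] assms] assms
  by (simp add: algebra_simps)

lemma \<omega>_sum:
  assumes "\<And>i. i \<in> I \<Longrightarrow> u i \<in> tangent_space P p"
  shows "\<omega> p (\<Sum>i\<in>I. u i) = (\<Sum>i\<in>I. \<omega> p (u i))"
proof -
  have zero: "\<omega> p 0 = 0"
    using \<omega>_scale[OF subspace_0[OF subspace_tangent_space[OF P]], of p 0] by simp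
  show ?thesis
    using assms
  proof (induction I rule: infinite_finite_induct)
    case (insert i I)
    then have "u i \<in> tangent_space P p" "sum u I \<in> tangent_space P p"
      using subspace_sum[OF subspace_tangent_space[OF P], of I u p] by simp_all
    moreover have "\<omega> p (sum u I) = (\<Sum>i\<in>I. \<omega> p (u i))" using insert.IH insert.prems by simp
    ultimately show ?case by (simp only: sum.insert[OF insert.hyps] \<omega>_add)
  qed (simp_all add: zero)
qed

text \<open>\<open>\<sigma>\<close> is the inverse of the trivialization. The last property
  expresses equivariance: acting on \<open>q\<close> by \<open>gmult (ginv (\<tau> q)) b\<close>
  changes its group component to \<open>b\<close> and keeps the base point. Thus each fibre slice of
  \<open>\<sigma>\<close> is an orbit map after a left translation.\<close>

lemma local_trivialization:
  obtains U \<sigma> \<tau> where "open U" "\<pi> p \<in> U" "open (\<pi> -` U)"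
    "smooth_product_map M G P (U \<times> UNIV) \<sigma>"
    "\<And>q. \<pi> q \<in> U \<Longrightarrow> map_smooth_at P G q \<tau>"
    "\<And>q. \<pi> q \<in> U \<Longrightarrow> \<sigma> (\<pi> q, \<tau> q) = q"
    "\<And>x b. x \<in> U \<Longrightarrow> \<pi> (\<sigma> (x, b)) = x"
    "\<And>q b. \<pi> q \<in> U \<Longrightarrow> \<sigma> (\<pi> q, b) = act q (gmult (ginv (\<tau> q)) b)"
proof -
  have "\<exists>U \<tau>. open U \<and> \<pi> p \<in> U \<and> bij_betw (\<lambda>p. (\<pi> p, \<tau> p)) (\<pi> -` U) (U \<times> UNIV) \<and>
     smooth_map_on P (prod_atlas M G) (\<pi> -` U) (\<lambda>p. (\<pi> p, \<tau> p)) \<and>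
     smooth_map_on (prod_atlas M G) P (U \<times> UNIV) (inv_into (\<pi> -` U) (\<lambda>p. (\<pi> p, \<tau> p))) \<and>
     (\<forall>p\<in>\<pi> -` U. \<forall>a. \<tau> (act p a) = gmult (\<tau> p) a)"
    using princ unfolding principal_bundle_def Let_def by (elim conjE) (erule allE[where x = "\<pi> p"])
  then obtain U \<tau> where U: "open U" "\<pi> p \<in> U"
    and bij: "bij_betw (\<lambda>p. (\<pi> p, \<tau> p)) (\<pi> -` U) (U \<times> UNIV)"
    and \<psi>: "smooth_map_on P (prod_atlas M G) (\<pi> -` U) (\<lambda>p. (\<pi> p, \<tau> p))"
    and \<sigma>: "smooth_map_on (prod_atlas M G) P (U \<times> UNIV) (inv_into (\<pi> -` U) (\<lambda>p. (\<pi> p, \<tau> p)))"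
    and eq: "\<forall>p\<in>\<pi> -` U. \<forall>a. \<tau> (act p a) = gmult (\<tau> p) a" by blast
  let ?\<psi> = "\<lambda>p. (\<pi> p, \<tau> p)"
  let ?\<sigma> = "inv_into (\<pi> -` U) ?\<psi>"
  have inj: "inj_on ?\<psi> (\<pi> -` U)" and im: "?\<psi> ` (\<pi> -` U) = U \<times> UNIV"
    using bij by (simp_all add: bij_betw_def)
  have "continuous_on UNIV \<pi>" using \<pi>_smooth by (simp add: smooth_map_on_def)
  then have o: "open (\<pi> -` U)" using continuous_open_preimage[of UNIV \<pi> U] U(1) by simp
  have 1: "smooth_product_map M G P (U \<times> UNIV) ?\<sigma>"
    by unfold_locales (rule M G P \<sigma> open_Times[OF U(1) open_UNIV])+
  have 2: "map_smooth_at P G q \<tau>" if "\<pi> q \<in> U" for q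
    using smooth_map_on_snd[OF P M G \<psi> o, of q] that by simp
  have 3: "?\<sigma> (?\<psi> q) = q" if "\<pi> q \<in> U" for q
    by (rule inv_into_f_f[OF inj]) (use that in simp)
  have 4: "\<pi> (?\<sigma> (x, b)) = x" if "x \<in> U" for x b
  proof -
    have "?\<psi> (?\<sigma> (x, b)) = (x, b)" by (rule f_inv_into_f) (use im that in simp)
    then show ?thesis by simp
  qed
  have 5: "?\<sigma> (\<pi> q, b) = act q (gmult (ginv (\<tau> q)) b)" if q: "\<pi> q \<in> U" for q b
  proof -
    let ?r = "act q (gmult (ginv (\<tau> q)) b)"
    have "\<tau> ?r = b" using eq q by (simp add: gmult_ginv)
    then have "?\<psi> ?r = (\<pi> q, b)" by (simp add: \<pi>_act)
    then show ?thesis using 3[of ?r] q by (simp add: \<pi>_act)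
  qed
  show ?thesis by (rule that[of U ?\<sigma> \<tau>]) (use U o 1 2 3 4 5 in simp_all)
qed

text \<open>Differentiating \<open>q = \<sigma>(\<pi> q, \<tau> q)\<close> in a vertical direction \<open>u\<close>, only the
  derivative in the fibre variable remains, where \<open>\<sigma>(\<pi> p, -)\<close> is the action on \<open>p\<close> after a
  left translation of the group.\<close>

lemma vertical_eq_fund:
  assumes u: "u \<in> tangent_space P p" "\<pi>' p u = 0"
  shows "u = fund (\<omega> p u) p"
proof -
  obtain U \<sigma> \<tau> where U: "open U" "\<pi> p \<in> U" "open (\<pi> -` U)"
    and \<sigma>: "smooth_product_map M G P (U \<times> UNIV) \<sigma>"
    and \<tau>: "\<And>q. \<pi> q \<in> U \<Longrightarrow> map_smooth_at P G q \<tau>"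
    and \<sigma>\<psi>: "\<And>q. \<pi> q \<in> U \<Longrightarrow> \<sigma> (\<pi> q, \<tau> q) = q"
    and \<pi>\<sigma>: "\<And>x b. x \<in> U \<Longrightarrow> \<pi> (\<sigma> (x, b)) = x"
    and \<sigma>_act: "\<And>q b. \<pi> q \<in> U \<Longrightarrow> \<sigma> (\<pi> q, b) = act q (gmult (ginv (\<tau> q)) b)"
    by (rule local_trivialization[of p], rule that)
  interpret \<sigma>: smooth_product_map M G P "U \<times> UNIV" \<sigma> by (rule \<sigma>)
  let ?L = "gmult (ginv (\<tau> p))"
  let ?w = "differential P G \<tau> p u"
  have L: "map_smooth_at G G (\<tau> p) ?L"
    using multiplication.map_smooth_at_slices(2)[of "ginv (\<tau> p)" "\<tau> p"] by simp
  have Lp: "?L (\<tau> p) = gid" by (rule gmult_ginv)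
  have "\<forall>\<^sub>F q in nhds p. q \<in> \<pi> -` U" using U by (intro eventually_nhds_in_open) auto
  then have ev: "\<forall>\<^sub>F q in nhds p. q = \<sigma> (\<pi> q, \<tau> q)" by eventually_elim (simp add: \<sigma>\<psi>)
  have "u = differential P P (\<lambda>q. q) p u" by (simp add: differential_id[OF P u(1)])
  also have "\<dots> = differential P P (\<lambda>q. \<sigma> (\<pi> q, \<tau> q)) p u" by (rule differential_cong[OF P ev])
  also have "\<dots> = differential M P (\<lambda>x. \<sigma> (x, \<tau> p)) (\<pi> p) (\<pi>' p u) + differential G P (\<lambda>b. \<sigma> (\<pi> p, b)) (\<tau> p)
      ?w"
    using U(2) by (intro \<sigma>.differential_pair[OF P \<pi>_smooth_at \<tau>]) auto
  also have "differential M P (\<lambda>x. \<sigma> (x, \<tau> p)) (\<pi> p) (\<pi>' p u) = 0"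
    unfolding u(2) by (rule linear_0[OF linear_differential[OF M \<sigma>.map_smooth_at_slices(1)]])
        (simp add: U(2))
  also have "(\<lambda>b. \<sigma> (\<pi> p, b)) = (\<lambda>b. act p (?L b))" using \<sigma>_act[OF U(2)] by simp
  also have "differential G P (\<lambda>b. act p (?L b)) (\<tau> p) ?w =
      differential G P (act p) (?L (\<tau> p)) (differential G G ?L (\<tau> p) ?w)"
    by (rule differential_comp[OF G G L]) (simp only: Lp act_slice_smooth_at)
  finally have eq: "u = fund (differential G G ?L (\<tau> p) ?w) p"
    unfolding fundamental_field_def add_0_left Lp .
  have "differential G G ?L (\<tau> p) ?w \<in> tangent_space G gid"
    using differential_tangent[OF G G L, of ?w] by (simp add: Lp)
  then have "\<omega> p u = differential G G ?L (\<tau> p) ?w" by (subst eq) (rule \<omega>_fund)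
  with eq show ?thesis by (simp only:)
qed

section \<open>The horizontal and vertical projections\<close>

lemma ver_eq:
  assumes "U p \<in> tangent_space P p"
  shows "ver P M \<pi> \<omega> U p = fund (\<omega> p (U p)) p"
  unfolding ver_def
proof (rule the_equality)
  let ?w = "fund (\<omega> p (U p)) p"
  show "?w \<in> vertical_space P M \<pi> p \<and> U p - ?w \<in> horizontal_space P \<omega> p"
    using assms subspace_diff[OF subspace_tangent_space[OF P] assms fund_tangent]
    by (simp add: vertical_space_def horizontal_space_def fund_tangent fund_vertical \<omega>_diff \<omega>_fund \<omega>_in)
  fix v assume v: "v \<in> vertical_space P M \<pi> p \<and> U p - v \<in> horizontal_space P \<omega> p"
  then have "v \<in> tangent_space P p" "\<pi>' p v = 0" "\<omega> p (U p - v) = 0"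
    by (auto simp: vertical_space_def horizontal_space_def)
  \<comment> \<open>A vertical vector is determined by its value under \<open>\<omega>\<close>, and
    \<open>v\<close> has that of \<open>U p\<close>.\<close>
  then show "v = ?w" using vertical_eq_fund[of v p] \<omega>_diff[OF assms, of v] by simp
qed

lemma hor_eq:
  assumes "U p \<in> tangent_space P p"
  shows "hor P M \<pi> \<omega> U p = U p - fund (\<omega> p (U p)) p"
  unfolding hor_def
proof (rule the_equality)
  let ?w = "fund (\<omega> p (U p)) p"
  show "U p - ?w \<in> horizontal_space P \<omega> p \<and> U p - (U p - ?w) \<in> vertical_space P M \<pi> p"
    using assms subspace_diff[OF subspace_tangent_space[OF P] assms fund_tangent]
    by (simp add: vertical_space_def horizontal_space_def fund_tangent fund_vertical \<omega>_diff \<omega>_fund \<omega>_in)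
  fix h assume h: "h \<in> horizontal_space P \<omega> p \<and> U p - h \<in> vertical_space P M \<pi> p"
  then have "U p - h \<in> tangent_space P p" "\<pi>' p (U p - h) = 0" "\<omega> p h = 0" "h \<in> tangent_space P p"
    by (auto simp: vertical_space_def horizontal_space_def)
  then have "U p - h = ?w" using vertical_eq_fund[of "U p - h" p] \<omega>_diff[OF assms, of h] by simp
  then show "h = U p - ?w" by (simp add: algebra_simps)
qed

text \<open>Expanding the value of \<open>\<omega>\<close> in a basis of the Lie algebra exhibits
  the vertical part as a combination of finitely many fundamental fields with smooth
  coefficients.\<close>

lemma ver_vector_field:
  assumes U: "vector_field P U"
  shows "vector_field P (ver P M \<pi> \<omega> U)"
proof -
  let ?k = "chart_at G gid"
  note k = chart_at_props[OF G, of gid]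
  let ?b = "\<lambda>b. tangent_of G ?k gid b"
  have "ver P M \<pi> \<omega> U = (\<lambda>p. \<Sum>b\<in>onb. (\<omega> p (U p) ?k \<bullet> b) *\<^sub>R fund (?b b) p)"
  proof
    fix p
    note Up = vector_fieldD(1)[OF P U, of p]
    have "\<omega> p (U p) = (\<Sum>b\<in>onb. (\<omega> p (U p) ?k \<bullet> b) *\<^sub>R ?b b)"
      using tangent_eq_tangent_of[OF \<omega>_in[OF Up] k] linear_onb_sum[OF linear_tangent_of[OF G k]] by metis
    then have "fund (\<omega> p (U p)) p = fund (\<Sum>b\<in>onb. (\<omega> p (U p) ?k \<bullet> b) *\<^sub>R ?b b) p" by (rule arg_cong)
    then show "ver P M \<pi> \<omega> U p = (\<Sum>b\<in>onb. (\<omega> p (U p) ?k \<bullet> b) *\<^sub>R fund (?b b) p)"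
      by (simp only: ver_eq[where U = U
        and p = p, OF Up] linear_sum[OF linear_fund] linear_scale[OF linear_fund])
  qed
  moreover have "smooth_fun P (\<lambda>p. \<omega> p (U p) ?k \<bullet> b)" for b
    using \<omega>_smooth[OF U, of ?k] by (simp add: smooth_fun_iff[OF P] msmooth_inner_left)
  ultimately show ?thesis
    by (simp only:) (intro vector_field_sum[OF P] vector_field_scale[OF P] fund_vector_field
        tangent_of(1)[OF G k])
qed

lemma hor_ver_add: "vector_field P U \<Longrightarrow> (\<lambda>q. hor P M \<pi> \<omega> U q + ver P M \<pi> \<omega> U q) = U"
  by (simp add: hor_eq ver_eq vector_fieldD(1)[OF P])

lemma hor_vector_field:
  assumes U: "vector_field P U"
  shows "vector_field P (hor P M \<pi> \<omega> U)"
proof -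
  have "hor P M \<pi> \<omega> U = (\<lambda>p. U p - ver P M \<pi> \<omega> U p)"
    using vector_fieldD(1)[OF P U] by (simp add: fun_eq_iff hor_eq ver_eq)
  then show ?thesis using vector_field_diff[OF P U ver_vector_field[OF U]] by simp
qed

lemma \<pi>'_ver: "vector_field P U \<Longrightarrow> \<pi>' p (ver P M \<pi> \<omega> U p) = 0"
  by (simp add: ver_eq vector_fieldD(1)[OF P] fund_vertical)

lemma \<pi>'_hor: "vector_field P U \<Longrightarrow> \<pi>' p (hor P M \<pi> \<omega> U p) = \<pi>' p (U p)"
  by (simp add: hor_eq vector_fieldD(1)[OF P] fund_vertical
      linear_diff[OF linear_differential[OF P \<pi>_smooth_at]])

lemma \<omega>_hor: "vector_field P U \<Longrightarrow> \<omega> p (hor P M \<pi> \<omega> U p) = 0"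
  by (simp add: hor_eq vector_fieldD(1)[OF P] \<omega>_diff fund_tangent \<omega>_fund \<omega>_in)

section \<open>Horizontal lifts\<close>

lemma horizontal_lift_eqI:
  assumes "u \<in> tangent_space P p" "\<omega> p u = 0" "\<pi>' p u = X (\<pi> p)"
  shows "horizontal_lift P M \<pi> \<omega> X p = u"
  unfolding horizontal_lift_def
proof (rule the_equality)
  show "u \<in> horizontal_space P \<omega> p \<and> \<pi>' p u = X (\<pi> p)"
    using assms by (simp add: horizontal_space_def)
  fix u' assume "u' \<in> horizontal_space P \<omega> p \<and> \<pi>' p u' = X (\<pi> p)"
  then have u': "u' \<in> tangent_space P p" "\<omega> p u' = 0" "\<pi>' p u' = X (\<pi> p)"
    by (auto simp: horizontal_space_def)
  have "u' - u = fund (\<omega> p (u' - u)) p"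
    using assms u' by (intro vertical_eq_fund subspace_diff[OF subspace_tangent_space[OF P]])
      (simp_all add: linear_diff[OF linear_differential[OF P \<pi>_smooth_at]])
  also have "\<dots> = 0" using assms u' linear_0[OF linear_fund] by (simp add: \<omega>_diff)
  finally show "u' = u" by simp
qed

text \<open>Provides some smooth lift near \<open>p\<close>, horizontal or not, by moving
  \<open>X\<close> along local sections of the bundle; \<open>hor\<close> then corrects it.\<close>

lemma local_lift:
  assumes X: "vector_field M X"
  obtains Y where "vector_field P Y" "\<forall>\<^sub>F q in nhds p. \<pi>' q (Y q) = X (\<pi> q)"
proof -
  obtain U \<sigma> \<tau> where U: "open U" "\<pi> p \<in> U" "open (\<pi> -` U)"
    and \<sigma>: "smooth_product_map M G P (U \<times> UNIV) \<sigma>"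
    and \<tau>: "\<And>q. \<pi> q \<in> U \<Longrightarrow> map_smooth_at P G q \<tau>"
    and \<sigma>\<psi>: "\<And>q. \<pi> q \<in> U \<Longrightarrow> \<sigma> (\<pi> q, \<tau> q) = q"
    and \<pi>\<sigma>: "\<And>x b. x \<in> U \<Longrightarrow> \<pi> (\<sigma> (x, b)) = x"
    and \<sigma>_act: "\<And>q b. \<pi> q \<in> U \<Longrightarrow> \<sigma> (\<pi> q, b) = act q (gmult (ginv (\<tau> q)) b)"
    by (rule local_trivialization[of p], rule that)
  interpret \<sigma>: smooth_product_map M G P "U \<times> UNIV" \<sigma> by (rule \<sigma>)
  \<comment> \<open>The map from \<open>x\<close> to \<open>\<sigma> (x, \<tau> q)\<close> is the
    local section passing through \<open>q\<close>. It changes with \<open>q\<close>, which is why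
    smoothness of \<open>X'\<close> requires the lemma on moving slices.\<close>
  define X' where "X' q = differential M P (\<lambda>x. \<sigma> (x, \<tau> q)) (\<pi> q) (X (\<pi> q))" for q
  note slice = \<sigma>.map_smooth_at_slices(1)
  have tan: "X' q \<in> tangent_space P q" if "\<pi> q \<in> U" for q
    using differential_tangent[OF M P slice, of "\<pi> q" "\<tau> q" "X (\<pi> q)"] that by (simp add: X'_def \<sigma>\<psi>)
  have proj: "\<pi>' q (X' q) = X (\<pi> q)" if q: "\<pi> q \<in> U" for q
  proof -
    have "\<forall>\<^sub>F x in nhds (\<pi> q). x \<in> U" using U(1) q by (rule eventually_nhds_in_open)
    then have ev: "\<forall>\<^sub>F x in nhds (\<pi> q). \<pi> (\<sigma> (x, \<tau> q)) = x" by eventually_elim (rule \<pi>\<sigma>)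
    have sl: "map_smooth_at M P (\<pi> q) (\<lambda>x. \<sigma> (x, \<tau> q))" using q by (intro slice) simp
    have "\<pi>' (\<sigma> (\<pi> q, \<tau> q)) (X' q) = differential M M (\<lambda>x. \<pi> (\<sigma> (x, \<tau> q))) (\<pi> q) (X (\<pi> q))"
      unfolding X'_def by (rule differential_comp[OF M P sl \<pi>_smooth_at, symmetric])
    also have "\<dots> = X (\<pi> q)"
      using differential_cong[OF M ev, of M] differential_id[OF M vector_fieldD(1)[OF M X]] by simp
    finally show ?thesis by (simp add: \<sigma>\<psi>[OF q])
  qed
  note c = chart_at_props[OF P, of p] and a = chart_at_props[OF M, of "\<pi> p"]
  have "msmooth P p (\<lambda>q. X (\<pi> q) (chart_at M (\<pi> p)))"
    by (rule msmooth_comp[OF P M \<pi>_smooth_at vector_fieldD(2)[OF M X a]])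
  then have "msmooth P p (\<lambda>q. X' q (chart_at P p))"
    unfolding X'_def using U(2) \<sigma>\<psi>[OF U(2)] c a vector_fieldD(1)[OF M X]
    by (intro \<sigma>.msmooth_slice_differentials(1)[OF P \<pi>_smooth_at \<tau>[OF U(2)] _ c(1) _ a]) simp_all
  moreover have evU: "\<forall>\<^sub>F q in nhds p. \<pi> q \<in> U"
    using eventually_nhds_in_open[OF U(3), of p] U(2) by simp
  then have "\<forall>\<^sub>F q in nhds p. X' q \<in> tangent_space P q" by eventually_elim (rule tan)
  ultimately obtain Y where Y: "vector_field P Y" "\<forall>\<^sub>F q in nhds p. Y q = X' q"
    by (rule extend_field_germ[OF P c])
  have "\<forall>\<^sub>F q in nhds p. \<pi>' q (Y q) = X (\<pi> q)"
    using Y(2) evU by eventually_elim (simp add: proj)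
  then show ?thesis by (rule that[OF Y(1)])
qed

text \<open>The definition of the horizontal lift by unique description hides its smoothness. By
  uniqueness it is, near \<open>p\<close>, the horizontal part of any smooth local lift.\<close>

lemma horizontal_lift_local:
  assumes X: "vector_field M X"
  obtains Y where "vector_field P Y" "\<forall>\<^sub>F q in nhds p. hor P M \<pi> \<omega> Y q = horizontal_lift P M \<pi> \<omega> X q"
    "\<forall>\<^sub>F q in nhds p. \<pi>' q (Y q) = X (\<pi> q)"
proof -
  obtain Y where Y: "vector_field P Y" "\<forall>\<^sub>F q in nhds p. \<pi>' q (Y q) = X (\<pi> q)"
    by (rule local_lift[OF X])
  have "\<forall>\<^sub>F q in nhds p. hor P M \<pi> \<omega> Y q = horizontal_lift P M \<pi> \<omega> X q"
    using Y(2)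
    by eventually_elim (rule horizontal_lift_eqI[symmetric],
      simp_all add: vector_fieldD(1)[OF P hor_vector_field[OF Y(1)]] \<omega>_hor[OF Y(1)] \<pi>'_hor[OF Y(1)])
  then show ?thesis using Y by (intro that)
qed

lemma horizontal_lift_vector_field:
  assumes X: "vector_field M X"
  shows "vector_field P (horizontal_lift P M \<pi> \<omega> X)"
proof (rule vector_field_local[OF P])
  fix p
  obtain Y where Y: "vector_field P Y" "\<forall>\<^sub>F q in nhds p. hor P M \<pi> \<omega> Y q = horizontal_lift P M \<pi> \<omega> X q"
    "\<forall>\<^sub>F q in nhds p. \<pi>' q (Y q) = X (\<pi> q)"
    by (rule horizontal_lift_local[OF X])
  then show "\<exists>Y. vector_field P Y \<and> (\<forall>\<^sub>F q in nhds p. Y q = horizontal_lift P M \<pi> \<omega> X q)"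
    using hor_vector_field by blast
qed

lemma \<pi>'_horizontal_lift:
  assumes X: "vector_field M X"
  shows "\<pi>' p (horizontal_lift P M \<pi> \<omega> X p) = X (\<pi> p)"
proof -
  obtain Y where Y: "vector_field P Y" "\<forall>\<^sub>F q in nhds p. hor P M \<pi> \<omega> Y q = horizontal_lift P M \<pi> \<omega> X q"
    "\<forall>\<^sub>F q in nhds p. \<pi>' q (Y q) = X (\<pi> q)"
    by (rule horizontal_lift_local[OF X])
  from eventually_nhds_x_imp_x[OF Y(2)] eventually_nhds_x_imp_x[OF Y(3)]
  show ?thesis using \<pi>'_hor[OF Y(1), of p] by simp
qed

lemma \<omega>_\<pi>'_eq_0:
  assumes "u \<in> tangent_space P p" "\<omega> p u = 0" "\<pi>' p u = 0"
  shows "u = 0"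
  using vertical_eq_fund[OF assms(1,3)] assms(2) linear_0[OF linear_fund] by simp

end

section \<open>The composition formula\<close>

text \<open>The expansion of \<open>Z\<close> is known at \<open>p\<close> only; continuing it with
  constant coefficients gives a global field with the same value.\<close>

lemma tensorial_combination:
  fixes \<Phi> :: "('a::{t2_space, second_countable_topology}, 'e::fin_dim) field \<Rightarrow> 'w::real_vector"
  assumes A: "smooth_manifold A"
    and add: "\<And>Y Z. vector_field A Y \<Longrightarrow> vector_field A Z \<Longrightarrow> \<Phi> (\<lambda>q. Y q + Z q) = \<Phi> Y + \<Phi> Z"
    and scl: "\<And>f Y. smooth_fun A f \<Longrightarrow> vector_field A Y \<Longrightarrow> \<Phi> (\<lambda>q. f q *\<^sub>R Y q) = f p *\<^sub>R \<Phi> Y"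
    and Z: "vector_field A Z" and E: "\<And>i. vector_field A (E i)" and Zp: "Z p = (\<Sum>i\<in>I. r i *\<^sub>R E i p)"
  shows "\<Phi> Z = (\<Sum>i\<in>I. r i *\<^sub>R \<Phi> (E i))"
proof -
  have zero: "\<Phi> (\<lambda>q. 0) = 0"
    using scl[OF smooth_fun_const[OF A, of 0] vector_field_zero[OF A]] by simp
  have rE: "vector_field A (\<lambda>q. r i *\<^sub>R E i q)" for i
    by (rule vector_field_scale[OF A smooth_fun_const[OF A] E])
  have "\<Phi> Z = \<Phi> (\<lambda>q. \<Sum>i\<in>I. r i *\<^sub>R E i q)"
    by (rule tensorial_operator[where \<Phi> = \<Phi> and p = p, OF A add scl Z vector_field_sum[OF A rE] Zp])
  also have "\<dots> = (\<Sum>i\<in>I. \<Phi> (\<lambda>q. r i *\<^sub>R E i q))"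
    by (rule additive_operator_sum[OF A add zero rE])
  also have "\<dots> = (\<Sum>i\<in>I. r i *\<^sub>R \<Phi> (E i))"
    by (simp only: scl[OF smooth_fun_const[OF A] E])
  finally show ?thesis .
qed

text \<open>The derivative of \<open>f\<close> enters both terms of the definition, each time with
  the factor \<open>F_*Z\<close>, and cancels.\<close>

lemma second_fundamental_form_scale_right:
  assumes A: "smooth_manifold A" and B: "smooth_manifold B"
    and DA: "connection A DA" and DB: "connection B DB" and F: "\<And>p. map_smooth_at A B p F"
    and Y: "vector_field A Y" and Z: "vector_field A Z" and f: "smooth_fun A f"
  shows "second_fundamental_form A DA B DB F Y (\<lambda>q. f q *\<^sub>R Z q) p =
    f p *\<^sub>R second_fundamental_form A DA B DB F Y Z p"
proof -
  have "mdiff A p f" using f by (simp add: smooth_fun_iff[OF A] msmooth_imp_mdiff)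
  from pullback_deriv_scale[OF A B DB F this section_diff_differential[OF A B F Z], of "Y p"]
  show ?thesis
    by (simp add: second_fundamental_form_def connectionD(5)[OF DA f Y Z] differential_add[OF A F]
        differential_scale[OF A F] scaleR_diff_right)
qed

text \<open>With \<open>Y'\<close> pushed forward and expanded as a sum of \<open>f b\<close> times
  \<open>E b\<close>, the terms containing derivatives of \<open>f b\<close> are the same on both
  sides. What remains is the sum of \<open>f b q\<close> times the second fundamental form of
  \<open>G\<close> on \<open>X\<close> and \<open>E b\<close>, and tensoriality gathers it into the
  value on \<open>X\<close> and \<open>X'\<close>.\<close>

lemma second_fundamental_form_comp:
  fixes A :: "('a::{t2_space, second_countable_topology}, 'e::fin_dim) chart set"
    and B :: "('b::{t2_space, second_countable_topology}, 'f::fin_dim) chart set"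
    and C :: "('c::{t2_space, second_countable_topology}, 'g::fin_dim) chart set"
  assumes A: "smooth_manifold A" and B: "smooth_manifold B" and C: "smooth_manifold C"
    and DA: "connection A DA" and DB: "connection B DB" and DC: "connection C DC"
    and F: "\<And>p. map_smooth_at A B p F" and G: "\<And>p. map_smooth_at B C p G"
    and Y: "vector_field A Y" "vector_field A Y'"
    and X: "vector_field B X" "X (F q) = differential A B F q (Y q)"
    and X': "vector_field B X'" "X' (F q) = differential A B F q (Y' q)"
  shows "second_fundamental_form A DA C DC (\<lambda>x. G (F x)) Y Y' q =
    differential B C G (F q) (second_fundamental_form A DA B DB F Y Y' q) +
    second_fundamental_form B DB C DC G X X' (F q)"
proof -
  obtain f :: "'f \<Rightarrow> 'a \<Rightarrow> real" and E where f: "\<And>b. msmooth A q (f b)" and E: "\<And>b. vector_field B (E b)"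
    and W: "\<forall>\<^sub>F x in nhds q. differential A B F x (Y' x) = (\<Sum>b\<in>onb. f b x *\<^sub>R E b (F x))"
    by (rule pushforward_frame[OF A B DA DB F Y(2)], rule that)
  note lin = linear_differential[OF B G, of "F q"]
  note GF = map_smooth_at_comp[OF A B F G]
  define S where "S b x = differential B C G x (E b x)" for b x
  have S: "section_diff B C G (F q) (S b)" for b
    unfolding S_def by (rule section_diff_differential[OF B C G E])
  have SF: "section_diff A C (\<lambda>x. G (F x)) q (\<lambda>x. S b (F x))" for b
    by (rule section_diff_comp[OF A B F S])
  note fd = msmooth_imp_mdiff[OF f]
  have GW: "\<forall>\<^sub>F x in nhds q. differential A C (\<lambda>x. G (F x)) x (Y' x) = (\<Sum>b\<in>onb. f b x *\<^sub>R S b (F x))"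
    using W
  proof eventually_elim
    case (elim x)
    show ?case
      unfolding differential_comp[OF A B F G] elim S_def
      by (simp only: linear_sum[OF linear_differential[OF B G]]
          linear_scale[OF linear_differential[OF B G]])
  qed
  let ?v = "Y q"
  have "pullback_deriv A C DC (\<lambda>x. G (F x)) q ?v (\<lambda>x. differential A C (\<lambda>x. G (F x)) x (Y' x)) =
     pullback_deriv A C DC (\<lambda>x. G (F x)) q ?v (\<lambda>x. \<Sum>b\<in>onb. f b x *\<^sub>R S b (F x))"
    by (rule pullback_deriv_cong[OF A GW])
  also have "\<dots> = (\<Sum>b\<in>onb. pullback_deriv A C DC (\<lambda>x. G (F x)) q ?v (\<lambda>x. f b x *\<^sub>R S b (F x)))"
    by (rule pullback_deriv_sum[OF A C DC GF]) (rule section_diff_scale[OF C fd SF])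
  also have "\<dots> = (\<Sum>b\<in>onb. dir_deriv A q ?v (f b) *\<^sub>R S b (F q) +
      f b q *\<^sub>R pullback_deriv B C DC G (F q) (differential A B F q ?v) (S b))"
    by (simp only: pullback_deriv_scale[OF A C DC GF fd SF] pullback_deriv_comp[OF A B C F G S])
  finally have 1: "pullback_deriv A C DC (\<lambda>x. G (F x)) q ?v (\<lambda>x. differential A C (\<lambda>x. G (F x)) x (Y' x)) =
      (\<Sum>b\<in>onb. dir_deriv A q ?v (f b) *\<^sub>R S b (F q)) +
      (\<Sum>b\<in>onb. f b q *\<^sub>R pullback_deriv B C DC G (F q) (differential A B F q ?v) (S b))"
    by (simp only: sum.distrib)
  have "differential B C G (F q) (pullback_deriv A B DB F q ?v (\<lambda>x. differential A B F x (Y' x))) =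
     differential B C G (F q) (\<Sum>b\<in>onb. dir_deriv A q ?v (f b) *\<^sub>R E b (F q) + f b q *\<^sub>R DB X (E b) (F q))"
    by (rule arg_cong[OF pullback_deriv_frame[OF A B DA DB F f E W X]])
  also have "\<dots> = (\<Sum>b\<in>onb. dir_deriv A q ?v (f b) *\<^sub>R S b (F q)) +
      (\<Sum>b\<in>onb. f b q *\<^sub>R differential B C G (F q) (DB X (E b) (F q)))"
    by (simp only: linear_sum[OF lin] linear_add[OF lin] linear_scale[OF lin] S_def sum.distrib)
  finally have 2: "differential B C G (F q) (pullback_deriv A B DB F q ?v (\<lambda>x. differential A B F x (Y' x)))
      =
      (\<Sum>b\<in>onb. dir_deriv A q ?v (f b) *\<^sub>R S b (F q)) +
      (\<Sum>b\<in>onb. f b q *\<^sub>R differential B C G (F q) (DB X (E b) (F q)))" .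
  \<comment> \<open>Only the value of \<open>X'\<close> at \<open>F q\<close> is prescribed, and
    there the expansion along \<open>F\<close> becomes a combination of the frame fields.\<close>
  have X'q: "X' (F q) = (\<Sum>b\<in>onb. f b q *\<^sub>R E b (F q))"
    using eventually_nhds_x_imp_x[OF W] X'(2) by (simp only:)
  have "second_fundamental_form B DB C DC G X X' (F q) =
      (\<Sum>b\<in>onb. f b q *\<^sub>R second_fundamental_form B DB C DC G X (E b) (F q))"
    by (rule tensorial_combination[where \<Phi> = "\<lambda>Z. second_fundamental_form B DB C DC G X Z (F q)"
      and p = "F q",
        OF B second_fundamental_form_add_right[OF B C DB DC G X(1)]
          second_fundamental_form_scale_right[OF B C DB DC G X(1)] X'(1) E X'q])
  also have "\<dots> = (\<Sum>b\<in>onb. f b q *\<^sub>R pullback_deriv B C DC G (F q) (differential A B F q ?v) (S b)) -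
      (\<Sum>b\<in>onb. f b q *\<^sub>R differential B C G (F q) (DB X (E b) (F q)))"
    unfolding second_fundamental_form_def X(2) S_def[abs_def]
    by (simp only: scaleR_diff_right sum_subtractf)
  finally have 3: "second_fundamental_form B DB C DC G X X' (F q) =
      (\<Sum>b\<in>onb. f b q *\<^sub>R pullback_deriv B C DC G (F q) (differential A B F q ?v) (S b)) -
      (\<Sum>b\<in>onb. f b q *\<^sub>R differential B C G (F q) (DB X (E b) (F q)))" .
  have 4: "differential A C (\<lambda>x. G (F x)) q (DA Y Y' q) =
      differential B C G (F q) (differential A B F q (DA Y Y' q))"
    by (rule differential_comp[OF A B F G])
  show ?thesis
    unfolding second_fundamental_form_def[of A DA] 1 3 4 linear_diff[OF lin] 2 by (simp only: algebra_simps)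
qed

section \<open>Harmonic maps into principal bundles\<close>

lemma orthonormal_basis_exists:
  assumes N: "smooth_manifold N" and g: "riemannian_metric N g"
  shows "\<exists>E. orthonormal_basis N g q E"
proof -
  obtain S where S: "finite S" "S \<subseteq> tangent_space N q" "span S = tangent_space N q"
    using tangent_space_spanned[OF N] by blast
  have "\<exists>E. finite E \<and> span E = span S \<and> (\<forall>u\<in>E. \<forall>v\<in>E. g q u v = (if u = v then 1 else 0))"
    by (rule gram_schmidt[OF subspace_tangent_space[OF N] _ _ _ S(1,2)])
       (use g in \<open>auto simp: riemannian_metric_def\<close>)
  then show ?thesis using S(3) by (auto simp: orthonormal_basis_def)
qed

text \<open>Names the basis chosen inside \<open>metric_trace\<close>. It does not depend on the
  form being traced, so all traces at \<open>q\<close> run over the same vectors.\<close>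

definition trace_basis :: "('a, 'e::real_normed_vector) chart set \<Rightarrow> ('a, 'e) metric \<Rightarrow> 'a \<Rightarrow> ('a, 'e) tvec
    set" where
  "trace_basis N g q = (SOME E. orthonormal_basis N g q E)"

lemma metric_trace_eq: "metric_trace N g q b = (\<Sum>e\<in>trace_basis N g q. b e e)"
  by (simp add: metric_trace_def trace_basis_def)

lemma trace_basis_subset:
  assumes "smooth_manifold N" "riemannian_metric N g"
  shows "trace_basis N g q \<subseteq> tangent_space N q"
proof -
  have "orthonormal_basis N g q (trace_basis N g q)"
    unfolding trace_basis_def by (rule someI_ex[OF orthonormal_basis_exists[OF assms]])
  then show ?thesis using span_superset by (auto simp: orthonormal_basis_def)
qed

text \<open>Traces see only the diagonal, where passing to the symmetric part changes
  nothing.\<close>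

lemma sym_part_diagonal: "sym_part B U U = B U U"
  unfolding sym_part_def by (rule scaleR_half_double)

lemma cov_deriv_form_apply:
  "cov_deriv_form A D \<theta> X Y p k = dir_deriv A p (X p) (\<lambda>q. \<theta> q (Y q) k) - \<theta> p (D X Y p) k"
  by (simp add: cov_deriv_form_def)

context bundle_connection
begin

text \<open>In the second slot, the Leibniz terms of the derivative of \<open>\<omega>(f Y)\<close>
  and of \<open>D X (f Y)\<close> cancel after applying \<open>\<omega>\<close>.\<close>

lemma cov_deriv_form_tensorial:
  assumes D: "connection P D" and X: "vector_field P X"
  shows "vector_field P Y \<Longrightarrow> vector_field P Z \<Longrightarrow>
      cov_deriv_form P D \<omega> X (\<lambda>q. Y q + Z q) p = cov_deriv_form P D \<omega> X Y p + cov_deriv_form P D \<omega> X Z p"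
    "smooth_fun P f \<Longrightarrow> vector_field P Y \<Longrightarrow>
      cov_deriv_form P D \<omega> X (\<lambda>q. f q *\<^sub>R Y q) p = f p *\<^sub>R cov_deriv_form P D \<omega> X Y p"
proof -
  have diff: "mdiff P p (\<lambda>q. \<omega> q (Y q) k)" if "vector_field P Y" for Y k
    using \<omega>_smooth[OF that] by (simp add: smooth_fun_iff[OF P] msmooth_imp_mdiff)
  note tan = vector_fieldD(1)[OF P]
  show "cov_deriv_form P D \<omega> X (\<lambda>q. Y q + Z q) p = cov_deriv_form P D \<omega> X Y p + cov_deriv_form P D \<omega> X Z p"
    if Y: "vector_field P Y" and Z: "vector_field P Z"
  proof
    fix k
    have "dir_deriv P p (X p) (\<lambda>q. \<omega> q (Y q + Z q) k) = dir_deriv P p (X p) (\<lambda>q. \<omega> q (Y q) k + \<omega> q (Z q) k)"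
      using \<omega>_add[OF tan[OF Y] tan[OF Z]] by simp
    then show "cov_deriv_form P D \<omega> X (\<lambda>q. Y q + Z q) p k =
        (cov_deriv_form P D \<omega> X Y p + cov_deriv_form P D \<omega> X Z p) k"
      using connectionD(1)[OF D X Y] connectionD(1)[OF D X Z]
      by (simp add: cov_deriv_form_apply connectionD(4)[OF D X Y Z] \<omega>_add tan dir_deriv_add[OF P diff[OF Y]
          diff[OF Z]])
  qed
  show "cov_deriv_form P D \<omega> X (\<lambda>q. f q *\<^sub>R Y q) p = f p *\<^sub>R cov_deriv_form P D \<omega> X Y p"
    if f: "smooth_fun P f" and Y: "vector_field P Y"
  proof
    fix k
    have fd: "mdiff P p f" using f by (simp add: smooth_fun_iff[OF P] msmooth_imp_mdiff)
    have "dir_deriv P p (X p) (\<lambda>q. \<omega> q (f q *\<^sub>R Y q) k) = dir_deriv P p (X p) (\<lambda>q. f q *\<^sub>R \<omega> q (Y q) k)"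
      using \<omega>_scale[OF tan[OF Y]] by (simp add: scaleR_fun_def)
    moreover have "\<omega> p (D X (\<lambda>q. f q *\<^sub>R Y q) p) = dir_deriv P p (X p) f *\<^sub>R \<omega> p (Y p) + f p *\<^sub>R \<omega> p
        (D X Y p)"
      using tan[OF Y] tan[OF connectionD(1)[OF D X Y]] subspace_scale[OF subspace_tangent_space[OF P]]
      by (simp add: connectionD(5)[OF D f X Y] \<omega>_add \<omega>_scale)
    ultimately show "cov_deriv_form P D \<omega> X (\<lambda>q. f q *\<^sub>R Y q) p k = (f p *\<^sub>R cov_deriv_form P D \<omega> X Y p) k"
      by (simp add: cov_deriv_form_apply dir_deriv_scaleR[OF P fd diff[OF Y]] scaleR_fun_def
          scaleR_diff_right)
  qed
qed

text \<open>Derivatives of the coefficients \<open>f b\<close> occur alike in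
  \<open>\<omega>\<close> of the derivative along \<open>F\<close> and in the derivative of the
  pulled-back form, so they cancel, as do the terms with \<open>DN Y Y\<close>. The remainder is a
  combination of covariant derivatives of \<open>\<omega>\<close> on the frame fields, hence its
  value on \<open>Z\<close> and \<open>Z\<close>.\<close>

lemma \<omega>_second_fundamental_form:
  fixes N :: "('n::{t2_space, second_countable_topology}, 'a::fin_dim) chart set"
  assumes N: "smooth_manifold N" and DN: "connection N DN" and D: "connection P D"
    and F: "\<And>q. map_smooth_at N P q F" and Y: "vector_field N Y"
    and Z: "vector_field P Z" "Z (F q) = differential N P F q (Y q)"
  shows "\<omega> (F q) (second_fundamental_form N DN P D F Y Y q) =
    cov_deriv_form N DN (pullback_form N P F \<omega>) Y Y q - cov_deriv_form P D \<omega> Z Z (F q)"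
proof -
  obtain f :: "'c \<Rightarrow> 'n \<Rightarrow> real" and E where f: "\<And>b. msmooth N q (f b)" and E: "\<And>b. vector_field P (E b)"
    and W: "\<forall>\<^sub>F x in nhds q. differential N P F x (Y x) = (\<Sum>b\<in>onb. f b x *\<^sub>R E b (F x))"
    by (rule pushforward_frame[OF N P DN D F Y], rule that)
  note fd = msmooth_imp_mdiff[OF f]
  note T = subspace_tangent_space[OF P]
  note ET = vector_fieldD(1)[OF P E]
  note DET = vector_fieldD(1)[OF P connectionD(1)[OF D Z(1) E]]
  let ?v = "Y q"
  have "\<omega> (F q) (pullback_deriv N P D F q ?v (\<lambda>x. differential N P F x (Y x))) =
      \<omega> (F q) (\<Sum>b\<in>onb. dir_deriv N q ?v (f b) *\<^sub>R E b (F q) + f b q *\<^sub>R D Z (E b) (F q))"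
    by (rule arg_cong[OF pullback_deriv_frame[OF N P DN D F f E W Z]])
  also have "\<dots> = (\<Sum>b\<in>onb. dir_deriv N q ?v (f b) *\<^sub>R \<omega> (F q) (E b (F q)) + f b q *\<^sub>R \<omega> (F q)
      (D Z (E b) (F q)))"
    by (simp only: \<omega>_sum \<omega>_add \<omega>_scale subspace_add[OF T] subspace_scale[OF T] ET DET)
  finally have 1: "\<omega> (F q) (pullback_deriv N P D F q ?v (\<lambda>x. differential N P F x (Y x))) =
      (\<Sum>b\<in>onb. dir_deriv N q ?v (f b) *\<^sub>R \<omega> (F q) (E b (F q)) + f b q *\<^sub>R \<omega> (F q) (D Z (E b) (F q)))" .
  have 2: "\<omega> (F q) (second_fundamental_form N DN P D F Y Y q) =
      \<omega> (F q) (pullback_deriv N P D F q ?v (\<lambda>x. differential N P F x (Y x))) - \<omega> (F q)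
          (differential N P F q (DN Y Y q))"
    unfolding second_fundamental_form_def
    by (rule \<omega>_diff[OF pullback_deriv_differential_tangent[OF N P DN D F Y] differential_tangent[OF N P F]])
  have Zq: "Z (F q) = (\<Sum>b\<in>onb. f b q *\<^sub>R E b (F q))"
    using eventually_nhds_x_imp_x[OF W] Z(2) by (simp only:)
  have 3: "cov_deriv_form P D \<omega> Z Z (F q) = (\<Sum>b\<in>onb. f b q *\<^sub>R cov_deriv_form P D \<omega> Z (E b) (F q))"
    by (rule tensorial_combination[where \<Phi> = "\<lambda>Y. cov_deriv_form P D \<omega> Z Y (F q)" and p = "F q",
        OF P cov_deriv_form_tensorial[OF D Z(1)] Z(1) E Zq])
  have 4: "dir_deriv N q ?v (\<lambda>x. pullback_form N P F \<omega> x (Y x) k) =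
      (\<Sum>b\<in>onb. dir_deriv N q ?v (f b) *\<^sub>R \<omega> (F q) (E b (F q)) k +
        f b q *\<^sub>R dir_deriv P (F q) (Z (F q)) (\<lambda>r. \<omega> r (E b r) k))" for k
  proof -
    have ev: "\<forall>\<^sub>F x in nhds q. pullback_form N P F \<omega> x (Y x) k = (\<Sum>b\<in>onb. f b x *\<^sub>R \<omega> (F x) (E b (F x)) k)"
      using W
    proof eventually_elim
      case (elim x)
      have "\<omega> (F x) (\<Sum>b\<in>onb. f b x *\<^sub>R E b (F x)) = (\<Sum>b\<in>onb. f b x *\<^sub>R \<omega> (F x) (E b (F x)))"
        by (simp only: \<omega>_sum \<omega>_scale subspace_scale[OF T] ET)
      then show ?case unfolding pullback_form_def elim by (simp add: sum_fun_apply scaleR_fun_def)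
    qed
    have E\<omega>: "mdiff P (F q) (\<lambda>r. \<omega> r (E b r) k)" for b
      using \<omega>_smooth[OF E] by (simp add: smooth_fun_iff[OF P] msmooth_imp_mdiff)
    note comp = dir_deriv_comp[OF N P F E\<omega>]
    have "dir_deriv N q ?v (\<lambda>x. pullback_form N P F \<omega> x (Y x) k) =
        (\<Sum>b\<in>onb. dir_deriv N q ?v (\<lambda>x. f b x *\<^sub>R \<omega> (F x) (E b (F x)) k))"
      unfolding dir_deriv_cong[OF N ev] by (rule dir_deriv_sum[OF N mdiff_scaleR[OF fd comp(2)]])
    then show ?thesis by (simp only: dir_deriv_scaleR[OF N fd comp(2)] comp(1) Z(2))
  qed
  show ?thesis
  proof
    fix k
    show "\<omega> (F q) (second_fundamental_form N DN P D F Y Y q) k =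
      (cov_deriv_form N DN (pullback_form N P F \<omega>) Y Y q - cov_deriv_form P D \<omega> Z Z (F q)) k"
      unfolding 2 1 3 minus_apply cov_deriv_form_apply 4 sum_fun_apply
      by (simp add: pullback_form_def cov_deriv_form_apply scaleR_fun_def sum.distrib scaleR_diff_right
          sum_subtractf)
  qed
qed

lemma second_fundamental_form_\<pi>:
  assumes D: "connection P D" and DM: "is_projection P M \<pi> \<omega> D DM" and Z: "vector_field P Z"
  shows "second_fundamental_form P D M DM \<pi> Z Z p =
    - \<pi>' p ((2 *\<^sub>R sym_part (tensor_A P M \<pi> \<omega> D) Z Z + sym_part (tensor_T P M \<pi> \<omega> D) Z Z) p)"
proof -
  have conM: "connection M DM"
    and hp: "\<And>X. vector_field M X \<Longrightarrow> hor P M \<pi> \<omega> (D (horizontal_lift P M \<pi> \<omega> X) (horizontal_lift P M \<pi> \<omega> X))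
        =
        horizontal_lift P M \<pi> \<omega> (DM X X)"
    using DM by (simp_all add: is_projection_def)
  let ?\<beta> = "second_fundamental_form P D M DM \<pi>" and ?H = "hor P M \<pi> \<omega> Z" and ?V = "ver P M \<pi> \<omega> Z"
  note H = hor_vector_field[OF Z] and V = ver_vector_field[OF Z]
  note sym = second_fundamental_form_symmetric[OF P M D conM \<pi>_smooth_at]
  note lin = linear_differential[OF P \<pi>_smooth_at, of p]
  have HH: "?\<beta> ?H ?H p = 0"
  proof -
    \<comment> \<open>The horizontal part of \<open>Z\<close> at \<open>p\<close> is also the value
      of the horizontal lift of a field on \<open>M\<close> extending the projection of
      \<open>Z p\<close>. By tensoriality that lift may be used instead, and for lifts the
      projection property of \<open>DM\<close> is available.\<close>
    define X where "X = extend M (\<pi> p) (\<pi>' p (Z p))"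
    note X = extend[OF M differential_tangent[OF P M \<pi>_smooth_at, of p "Z p"], folded X_def]
    let ?X = "horizontal_lift P M \<pi> \<omega> X"
    note lift = horizontal_lift_vector_field[OF X(1)]
    have eq: "?H p = ?X p"
      by (rule horizontal_lift_eqI[symmetric])
         (simp_all add: vector_fieldD(1)[OF P H] \<omega>_hor[OF Z] \<pi>'_hor[OF Z] X(2))
    have "pullback_deriv P M DM \<pi> p (?X p) (\<lambda>x. X (\<pi> x)) = DM X X (\<pi> p)"
      by (rule pullback_deriv_field[OF P M conM \<pi>_smooth_at X(1) X(1)])
          (simp add: \<pi>'_horizontal_lift[OF X(1)])
    \<comment> \<open>The projection property concerns the horizontal part of
      \<open>D ?X ?X\<close>, but the differential of \<open>\<pi>\<close> does not notice the
      vertical part.\<close>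
    moreover have "\<pi>' p (D ?X ?X p) = DM X X (\<pi> p)"
      using \<pi>'_hor[OF connectionD(1)[OF D lift lift], of p]
      by (simp add: hp[OF X(1)] \<pi>'_horizontal_lift[OF connectionD(1)[OF conM X(1) X(1)]])
    ultimately have "?\<beta> ?X ?X p = 0"
      by (simp add: second_fundamental_form_def \<pi>'_horizontal_lift[OF X(1)])
    then show ?thesis
      using second_fundamental_form_cong[OF P M D conM \<pi>_smooth_at H lift eq H lift eq] by simp
  qed
  \<comment> \<open>The projection of a vertical field is the zero section along
    \<open>\<pi>\<close>, so the pulled-back derivative contributes nothing.\<close>
  have YV: "?\<beta> Y ?V p = - \<pi>' p (D Y ?V p)" for Y
    by (simp add: second_fundamental_form_def \<pi>'_ver[OF Z] pullback_deriv_zero[OF P M conM \<pi>_smooth_at])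
  have "?\<beta> Z Z p = ?\<beta> (\<lambda>q. ?H q + ?V q) (\<lambda>q. ?H q + ?V q) p" by (simp only: hor_ver_add[OF Z])
  also have "\<dots> = ?\<beta> ?H ?H p + ?\<beta> ?H ?V p + (?\<beta> ?V ?H p + ?\<beta> ?V ?V p)"
    using vector_field_add[OF P H V]
    by (simp only: second_fundamental_form_add_left[OF P M D conM \<pi>_smooth_at _ H V]
        second_fundamental_form_add_right[OF P M D conM \<pi>_smooth_at _ H V] H V)
  \<comment> \<open>By symmetry the mixed term with the vertical field first equals the other one;
    this is the origin of the 2.\<close>
  also have "\<dots> = - (2 *\<^sub>R \<pi>' p (D ?H ?V p) + \<pi>' p (D ?V ?V p))"
    unfolding sym[OF V H] HH YV by (simp add: scaleR_2)
  \<comment> \<open>Of the two summands of \<open>tensor_A\<close>, one is vertical and disappears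
    under the differential of \<open>\<pi>\<close>; in the other, taking the horizontal part is
    invisible to it. The same holds for \<open>tensor_T\<close> below.\<close>
  also have "\<pi>' p (D ?H ?V p) = \<pi>' p (tensor_A P M \<pi> \<omega> D Z Z p)"
    unfolding tensor_A_def Let_def plus_fun_apply linear_add[OF lin]
    by (simp add: \<pi>'_ver \<pi>'_hor connectionD(1)[OF D] H V)
  also have "\<pi>' p (D ?V ?V p) = \<pi>' p (tensor_T P M \<pi> \<omega> D Z Z p)"
    unfolding tensor_T_def Let_def plus_fun_apply linear_add[OF lin]
    by (simp add: \<pi>'_ver \<pi>'_hor connectionD(1)[OF D] H V)
  also have "2 *\<^sub>R \<pi>' p (tensor_A P M \<pi> \<omega> D Z Z p) + \<pi>' p (tensor_T P M \<pi> \<omega> D Z Z p) =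
      \<pi>' p ((2 *\<^sub>R tensor_A P M \<pi> \<omega> D Z Z + tensor_T P M \<pi> \<omega> D Z Z) p)"
    unfolding plus_fun_apply linear_add[OF lin] scaleR_fun_def[of _ "tensor_A P M \<pi> \<omega> D Z Z"]
        linear_scale[OF lin] ..
  finally show ?thesis unfolding sym_part_diagonal .
qed

end

theorem theorem3p2:
  fixes P :: "('p::{t2_space, second_countable_topology}, 'c::fin_dim) chart set"
    and M :: "('m::{t2_space, second_countable_topology}, 'b::fin_dim) chart set"
    and G :: "('g::{t2_space, second_countable_topology}, 'd::fin_dim) chart set"
    and N :: "('n::{t2_space, second_countable_topology}, 'a::fin_dim) chart set"
    and gmult :: "'g \<Rightarrow> 'g \<Rightarrow> 'g" and gid :: 'g and ginv :: "'g \<Rightarrow> 'g"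
    and act :: "'p \<Rightarrow> 'g \<Rightarrow> 'p" and \<pi> :: "'p \<Rightarrow> 'm"
    and \<omega> :: "'p \<Rightarrow> ('p, 'c) tvec \<Rightarrow> ('g, 'd) tvec"
    and nablaP :: "('p, 'c) cov_deriv" and nablaM :: "('m, 'b) cov_deriv"
    and g :: "('n, 'a) metric" and nablaN :: "('n, 'a) cov_deriv"
    and F :: "'n \<Rightarrow> 'p"
  assumes "principal_bundle P M G gmult gid ginv act \<pi>"
    and "connection_form P G gmult gid ginv act \<omega>"
    and "projectable_connection P M act \<pi> \<omega> nablaP"
    and "is_projection P M \<pi> \<omega> nablaP nablaM"
    and "smooth_manifold N" and "riemannian_metric N g" and "levi_civita N g nablaN"
    and "smooth_map N P F"
  shows "harmonic_map N g nablaN P nablaP F \<longleftrightarrow>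
    (\<forall>q. codifferential N g nablaN (pullback_form N P F \<omega>) q =
         metric_trace N g q (\<lambda>u v.
           at_point P (cov_deriv_form P nablaP \<omega>) (F q)
             (differential N P F q u) (differential N P F q v))) \<and>
    (\<forall>q. tension_field N g nablaN M nablaM (\<pi> \<circ> F) q =
         - metric_trace N g q (\<lambda>u v.
           differential P M \<pi> (F q)
             (at_point P (\<lambda>U V. 2 *\<^sub>R sym_part (tensor_A P M \<pi> \<omega> nablaP) U V
                               + sym_part (tensor_T P M \<pi> \<omega> nablaP) U V) (F q)
               (differential N P F q u) (differential N P F q v))))"
proof -
  interpret bundle_connection P M G gmult gid ginv act \<pi> \<omega>
    by unfold_locales (rule assms)+
  have DP: "connection P nablaP"
    using assms(3) by (simp add: projectable_connection_def invariant_connection_def)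
  have DM: "connection M nablaM" using assms(4) by (simp add: is_projection_def)
  have DN: "connection N nablaN" using assms(7) by (simp add: levi_civita_def)
  note N = assms(5) and g = assms(6)
  have F: "map_smooth_at N P q F" for q
    by (rule smooth_map_on_at[OF N P assms(8)]) auto
  show ?thesis
    \<comment> \<open>With the two quantifiers on the right merged into one, the equivalence can be
      proved at each point \<open>q\<close>.\<close>
    unfolding harmonic_map_def all_conj_distrib[symmetric]
  proof (intro iff_allI)
    fix q
    let ?F' = "differential N P F q"
    \<comment> \<open>These five functions are the summands of the traces at a basis vector
      \<open>e\<close>: the tension of \<open>F\<close> and of \<open>\<pi> \<circ> F\<close>, the
      codifferential, and the right sides of the two conditions up to sign. The aim is
      \<open>\<omega>(\<beta>) = \<delta> - \<epsilon>\<close> and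
      \<open>\<pi>'(\<beta>) = \<gamma> + \<zeta>\<close> for each \<open>e\<close>.\<close>
    define \<beta> where "\<beta> e = at_point N (second_fundamental_form N nablaN P nablaP F) q e e" for e
    define \<gamma> where "\<gamma> e = at_point N (second_fundamental_form N nablaN M nablaM (\<pi> \<circ> F)) q e e" for e
    define \<delta> where "\<delta> e = at_point N (cov_deriv_form N nablaN (pullback_form N P F \<omega>)) q e e" for e
    define \<epsilon> where "\<epsilon> e = at_point P (cov_deriv_form P nablaP \<omega>) (F q) (?F' e) (?F' e)" for e
    define \<zeta> where "\<zeta> e = \<pi>' (F q) (at_point P (\<lambda>U V. 2 *\<^sub>R sym_part (tensor_A P M \<pi> \<omega> nablaP) U V
        + sym_part (tensor_T P M \<pi> \<omega> nablaP) U V) (F q) (?F' e) (?F' e))" for e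
    define E where "E = trace_basis N g q"
    have E: "E \<subseteq> tangent_space N q" unfolding E_def by (rule trace_basis_subset[OF N g])
    note tr = metric_trace_eq[of N g q, folded E_def]
    have tension: "tension_field N g nablaN P nablaP F q = sum \<beta> E"
      by (simp add: tension_field_def tr \<beta>_def)
    have \<beta>: "\<beta> e \<in> tangent_space P (F q)" and \<omega>\<beta>: "\<omega> (F q) (\<beta> e) = \<delta> e - \<epsilon> e"
      and \<pi>\<beta>: "\<pi>' (F q) (\<beta> e) = \<gamma> e + \<zeta> e" if "e \<in> E" for e
    proof -
      have e: "e \<in> tangent_space N q" using that E by blast
      define Y where "Y = extend N q e"
      \<comment> \<open>The same extension that \<open>at_point\<close> picks on \<open>P\<close>,
        so the summands \<open>\<epsilon> e\<close> and \<open>\<zeta> e\<close> unfold literally to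
        expressions in \<open>Z\<close>.\<close>
      define Z where "Z = extend P (F q) (?F' e)"
      have Y: "vector_field N Y" "Y q = e" unfolding Y_def by (rule extend[OF N e])+
      have Z: "vector_field P Z" "Z (F q) = ?F' (Y q)"
        unfolding Z_def Y(2) by (rule extend[OF P differential_tangent[OF N P F]])+
      show "\<beta> e \<in> tangent_space P (F q)"
        unfolding \<beta>_def at_point_def Y_def[symmetric]
        by (rule second_fundamental_form_tangent[OF N P DN DP F Y(1) Y(1)])
      show "\<omega> (F q) (\<beta> e) = \<delta> e - \<epsilon> e"
        unfolding \<beta>_def \<delta>_def \<epsilon>_def at_point_def Y_def[symmetric] Z_def[symmetric]
        by (rule \<omega>_second_fundamental_form[OF N DN DP F Y(1) Z])
      have "\<gamma> e = \<pi>' (F q) (\<beta> e) + second_fundamental_form P nablaP M nablaM \<pi> Z Z (F q)"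
        unfolding \<gamma>_def \<beta>_def at_point_def Y_def[symmetric] o_def
        by (rule second_fundamental_form_comp[OF N P M DN DP DM F \<pi>_smooth_at Y(1) Y(1) Z Z])
      also have "second_fundamental_form P nablaP M nablaM \<pi> Z Z (F q) = - \<zeta> e"
        unfolding \<zeta>_def at_point_def Z_def[symmetric]
        by (rule second_fundamental_form_\<pi>[OF DP assms(4) Z(1)])
      finally have "\<gamma> e = \<pi>' (F q) (\<beta> e) + - \<zeta> e" .
      then show "\<pi>' (F q) (\<beta> e) = \<gamma> e + \<zeta> e" by (simp only: add.assoc left_minus add_0_right)
    qed
    have T: "sum \<beta> E \<in> tangent_space P (F q)"
      by (rule subspace_sum[OF subspace_tangent_space[OF P] \<beta>])
    have 1: "\<omega> (F q) (sum \<beta> E) = sum \<delta> E - sum \<epsilon> E"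
      by (simp only: \<omega>_sum \<beta> \<omega>\<beta> sum_subtractf cong: sum.cong)
    have 2: "\<pi>' (F q) (sum \<beta> E) = sum \<gamma> E + sum \<zeta> E"
      by (simp only: linear_sum[OF linear_differential[OF P \<pi>_smooth_at]] \<pi>\<beta> sum.distrib cong: sum.cong)
    have zero: "\<omega> (F q) 0 = 0" using \<omega>_sum[of "{}" _ "F q"] by simp
    have "sum \<beta> E = 0 \<longleftrightarrow> \<omega> (F q) (sum \<beta> E) = 0 \<and> \<pi>' (F q) (sum \<beta> E) = 0"
      using \<omega>_\<pi>'_eq_0[OF T] zero linear_0[OF linear_differential[OF P \<pi>_smooth_at]] by metis
    also have "\<dots> \<longleftrightarrow> sum \<delta> E = sum \<epsilon> E \<and> sum \<gamma> E = - sum \<zeta> E"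
      unfolding 1 2 by (simp only: right_minus_eq eq_neg_iff_add_eq_0)
    finally show "tension_field N g nablaN P nablaP F q = 0 \<longleftrightarrow>
      codifferential N g nablaN (pullback_form N P F \<omega>) q =
         metric_trace N g q (\<lambda>u v. at_point P (cov_deriv_form P nablaP \<omega>) (F q) (?F' u) (?F' v)) \<and>
      tension_field N g nablaN M nablaM (\<pi> \<circ> F) q =
         - metric_trace N g q (\<lambda>u v. \<pi>' (F q) (at_point P (\<lambda>U V. 2 *\<^sub>R sym_part (tensor_A P M \<pi> \<omega> nablaP) U
             V
               + sym_part (tensor_T P M \<pi> \<omega> nablaP) U V) (F q) (?F' u) (?F' v)))"
      unfolding tension unfolding codifferential_def tension_field_def tr
        \<gamma>_def[symmetric] \<delta>_def[symmetric] \<epsilon>_def[symmetric] \<zeta>_def[symmetric] .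
  qed
qed

end
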